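(* Let $p\colon[0,1]\to[1,\infty)$ be measurable. Then the Banach space $$L_0^{p(\cdot)}:=\overline{\bigcup_{n\in\mathbb{N}}\left\{1_{p(\cdot)\le n}\,f\colon f\in\widetilde{L}^{p(\cdot)}\right\}}\subset\widetilde{L}^{p(\cdot)}$$ satisfies $L_0^{p(\cdot)}\subset L^{p(\cdot)}$. In particular, if $\overline{p}:=\operatorname{ess\,sup}_{t}p(t)<\infty$, then $L^{p(\cdot)}=\widetilde{L}^{p(\cdot)}$ and, consequently, $L^{p(\cdot)}$ is a Banach space.
   Context: Let $m$ be Lebesgue measure on $[0,1]$ and let $L^0$ be the space of Lebesgue-to-Borel measurable functions $[0,1]\to\mathbb{R}$, where inequalities between elements of $L^0$ are understood a.e. and functions equal a.e. are identified. $1_{p(\cdot)\le n}$ is the indicator function of $\{t\colon p(t)\le n\}$. ODE-determined class $L^{p(\cdot)}$. For $f\in L^0$ and $x_0>0$, a solution with initial value $x_0$ (weak, in the sense of Carathéodory) is an absolutely continuous function $\varphi_{f,x_0}\colon[0,1]\to(0,\infty)$ with $\varphi_{f,x_0}(T)=x_0+\int_0^T \frac{|f(t)|^{p(t)}}{p(t)}\varphi_{f,x_0}(t)^{1-p(t)}\,dt$ for all $T\in[0,1]$; it is unique if it exists. If it exists for every $x_0>0$, then as $x_0\searrow 0$ the functions $\varphi_{f,x_0}$ decrease to an absolutely continuous function $\varphi_f$ which solves $\varphi'(t)=\frac{|f(t)|^{p(t)}}{p(t)}\varphi(t)^{1-p(t)}$ for a.e. $t$, with $\varphi(0)=0$ (the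 right-hand side is read as $0$ where $f(t)=0$); this is called the solution with initial value $0^+$. The class $L^{p(\cdot)}\subset L^0$ consists of those $f$ for which $\varphi_f$ exists, i.e. for which $\varphi_{f,x_0}$ exists on $[0,1]$ for every $x_0>0$; for such $f$ put $\|f\|_{p(\cdot)}:=\varphi_f(1)$. When $L^{p(\cdot)}$ is a linear space, this is the norm with which it is equipped. The space $\widetilde{L}^{p(\cdot)}$ and its norm $\rho$. For $a,b\ge 0$ and $1\le r<\infty$ put $a\boxplus_r b=(a^r+b^r)^{1/r}$. A simple semi-norm of standard form $N$ is given by finitely many measures $\mu_1,\dots,\mu_n$, each the restriction of $m$ to a compact set $\mathrm{supp}(\mu_i)\subset[0,1]$, with $\max\mathrm{supp}(\mu_i)\le\min\mathrm{supp}(\mu_{i+1})$, and constants $p_1,\dots,p_n\in[1,\infty)$, via $$\|f\|_N=(\ldots(|f|_{p_1,\mu_1}\boxplus_{p_2}|f|_{p_2,\mu_2})\boxplus_{p_3}\ldots)\boxplus_{p_n}|f|_{p_n,\mu_n},\qquad |f|_{p,\mu}=\Big(\int|f|^p\,d\mu\Big)^{1/p}.$$ Its exponent function is $\tilde p_N(t)=p_i$ for $t\in\mathrm{supp}(\mu_i)$ and $\tilde p_N(t)=1$ otherwise. Write $N\le M$ if the union of the supports of the measures of $M$ includes that of $N$ and $\tilde p_N\le\tilde p_M$. Let $\mathcal{N}_{\le p(\cdot)}$ be the collection of simple semi-norms $N$ of standard form with $\tilde p_N\le p(\cdot)$. Define $\rho(f)=\limsup_N\|f\|_N$, the $\limsup$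 being taken along $N\in\mathcal{N}_{\le p(\cdot)}$ with $\tilde p_N\to p$ in measure, that is, $$\rho(f)=\inf_{K\in\mathcal{N}_{\le p(\cdot)}}\ \sup_{N\in\mathcal{N}_{\le p(\cdot)},\,K\le N}\|f\|_N,$$ and $\widetilde{L}^{p(\cdot)}=\{f\in L^0\colon\rho(f)<\infty\}$, normed by $\rho$. The closure in the definition of $L_0^{p(\cdot)}$ is taken in $\widetilde{L}^{p(\cdot)}$ with respect to $\rho$.
   Formalization: ρ is the limsup along N with p̃_N → p in measure; the formula inf_K sup_{K≤N}, said to be the same, is not used: with it the claim fails, e.g. for p=2 on a nowhere dense compact set of positive measure and p=1 elsewhere. *)

theory Defs
  imports "HOL-Analysis.Analysis" "HOL-Probability.Essential_Supremum"
begin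

abbreviation unit_leb :: "real measure" where
  "unit_leb \<equiv> lebesgue_on {0..1}"

section \<open>The space of measurable functions on the unit interval modulo a.e. equality\<close>

definition ae_eq_rel :: "(real \<Rightarrow> real) \<Rightarrow> (real \<Rightarrow> real) \<Rightarrow> bool" where
  "ae_eq_rel f g \<longleftrightarrow> f \<in> borel_measurable unit_leb \<and> g \<in> borel_measurable unit_leb
     \<and> (AE t in unit_leb. f t = g t)"

quotient_type L0 = "real \<Rightarrow> real" / partial: ae_eq_rel
proof (rule part_equivpI)
  show "\<exists>f. ae_eq_rel f f"
    by (rule exI[of _ "\<lambda>_. 0"]) (simp add: ae_eq_rel_def)
  show "symp ae_eq_rel"
    unfolding symp_def ae_eq_rel_def by (auto elim: AE_mp)
  show "transp ae_eq_rel"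
    unfolding transp_def ae_eq_rel_def by (auto elim: AE_mp)
qed

instantiation L0 :: "{real_vector, times}"
begin

lift_definition zero_L0 :: L0 is "\<lambda>_. 0"
  by (simp add: ae_eq_rel_def)

lift_definition plus_L0 :: "L0 \<Rightarrow> L0 \<Rightarrow> L0" is "\<lambda>f g t. f t + g t"
  by (auto simp: ae_eq_rel_def elim!: AE_mp)

lift_definition minus_L0 :: "L0 \<Rightarrow> L0 \<Rightarrow> L0" is "\<lambda>f g t. f t - g t"
  by (auto simp: ae_eq_rel_def elim!: AE_mp)

lift_definition uminus_L0 :: "L0 \<Rightarrow> L0" is "\<lambda>f t. - f t"
  by (auto simp: ae_eq_rel_def elim!: AE_mp)

lift_definition times_L0 :: "L0 \<Rightarrow> L0 \<Rightarrow> L0" is "\<lambda>f g t. f t * g t"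
  by (auto simp: ae_eq_rel_def elim!: AE_mp)

lift_definition scaleR_L0 :: "real \<Rightarrow> L0 \<Rightarrow> L0" is "\<lambda>c f t. c * f t"
  by (auto simp: ae_eq_rel_def elim!: AE_mp)

instance
  by standard (transfer; auto simp: ae_eq_rel_def algebra_simps)+

end

section \<open>The ODE-determined class\<close>

definition abs_cont_on :: "real set \<Rightarrow> (real \<Rightarrow> real) \<Rightarrow> bool" where
  "abs_cont_on S g \<longleftrightarrow>
     (\<forall>\<epsilon>>0. \<exists>\<delta>>0. \<forall>D. finite D \<longrightarrow> (\<forall>(a, b)\<in>D. a \<le> b \<and> {a..b} \<subseteq> S)
        \<longrightarrow> disjoint_family_on (\<lambda>(a, b). {a<..<b}) D \<longrightarrow> (\<Sum>(a, b)\<in>D. b - a) < \<delta>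
        \<longrightarrow> (\<Sum>(a, b)\<in>D. \<bar>g b - g a\<bar>) < \<epsilon>)"

lemma ode_rhs_cong:
  assumes "ae_eq_rel f g"
  shows "(\<integral>\<^sup>+t\<in>A. ennreal (\<bar>f t\<bar> powr p t / p t * \<phi> t powr (1 - p t)) \<partial>unit_leb)
       = (\<integral>\<^sup>+t\<in>A. ennreal (\<bar>g t\<bar> powr p t / p t * \<phi> t powr (1 - p t)) \<partial>unit_leb)"
  using assms unfolding ae_eq_rel_def by (intro nn_integral_cong_AE) (auto elim!: AE_mp)

text \<open>The right-hand side is nonnegative. Written with the nonnegative integral, the equation
  includes that it is integrable. Only the values of \<open>\<phi>\<close> on the unit interval matter.\<close>

lift_definition ode_solution ::
    "(real \<Rightarrow> real) \<Rightarrow> L0 \<Rightarrow> real \<Rightarrow> (real \<Rightarrow> real) \<Rightarrow> bool" is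
  "\<lambda>p f x0 \<phi>. abs_cont_on {0..1} \<phi> \<and> (\<forall>t\<in>{0..1}. 0 < \<phi> t)
     \<and> (\<forall>T\<in>{0..1}. ennreal (\<phi> T) = ennreal x0 +
          (\<integral>\<^sup>+t\<in>{0..T}. ennreal (\<bar>f t\<bar> powr p t / p t * \<phi> t powr (1 - p t)) \<partial>unit_leb))"
  subgoal premises prems by (simp only: ode_rhs_cong[OF prems])
  done

definition ode_class :: "(real \<Rightarrow> real) \<Rightarrow> L0 set" where
  "ode_class p = {f. \<forall>x0>0. \<exists>\<phi>. ode_solution p f x0 \<phi>}"

text \<open>The solution with initial value \<open>x0\<close> is unique on the unit interval, so its value at a point
  there is well defined; the solution with initial value \<open>0\<^sup>+\<close> is the pointwise limit.\<close>

definition ode_flow :: "(real \<Rightarrow> real) \<Rightarrow> L0 \<Rightarrow> real \<Rightarrow> real \<Rightarrow> real" where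
  "ode_flow p f x0 T = (THE y. \<exists>\<phi>. ode_solution p f x0 \<phi> \<and> y = \<phi> T)"

definition ode_flow0 :: "(real \<Rightarrow> real) \<Rightarrow> L0 \<Rightarrow> real \<Rightarrow> real" where
  "ode_flow0 p f T = Lim (at_right 0) (\<lambda>x0. ode_flow p f x0 T)"

definition ode_norm :: "(real \<Rightarrow> real) \<Rightarrow> L0 \<Rightarrow> real" where
  "ode_norm p f = ode_flow0 p f 1"

section \<open>Simple semi-norms of standard form\<close>

text \<open>A simple semi-norm is encoded by the list of pairs of a compact set (the support of the
  measure) and an exponent.\<close>

type_synonym simple_seminorm = "(real set \<times> real) list"

definition standard_form :: "simple_seminorm \<Rightarrow> bool" where
  "standard_form N \<longleftrightarrow> N \<noteq> []
     \<and> (\<forall>(K, q)\<in>set N. compact K \<and> K \<noteq> {} \<and> K \<subseteq> {0..1} \<and> 1 \<le> q)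
     \<and> successively (\<lambda>(K, _) (K', _). Sup K \<le> Inf K') N"

text \<open>Consecutive supports may share an endpoint; there the exponent of the first one is taken,
  which is immaterial, as exponent functions are only compared up to null sets.\<close>

fun exponent_fun :: "simple_seminorm \<Rightarrow> real \<Rightarrow> real" where
  "exponent_fun [] t = 1"
| "exponent_fun ((K, q) # N) t = (if t \<in> K then q else exponent_fun N t)"

definition ennpowr :: "ennreal \<Rightarrow> real \<Rightarrow> ennreal" where
  "ennpowr a r = (if a = top then top else ennreal (enn2real a powr r))"

definition boxplus :: "real \<Rightarrow> ennreal \<Rightarrow> ennreal \<Rightarrow> ennreal" where
  "boxplus r a b = ennpowr (ennpowr a r + ennpowr b r) (1 / r)"

lift_definition Lp_seminorm :: "real \<Rightarrow> real set \<Rightarrow> L0 \<Rightarrow> ennreal" is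
  "\<lambda>q K f. ennpowr (\<integral>\<^sup>+t\<in>K. ennreal (\<bar>f t\<bar> powr q) \<partial>unit_leb) (1 / q)"
  unfolding ae_eq_rel_def
  by (intro arg_cong2[where f = ennpowr] nn_integral_cong_AE refl) (auto elim!: AE_mp)

fun simple_norm :: "simple_seminorm \<Rightarrow> L0 \<Rightarrow> ennreal" where
  "simple_norm [] f = 0"
| "simple_norm ((K, q) # N) f =
     foldl (\<lambda>a (K', q'). boxplus q' a (Lp_seminorm q' K' f)) (Lp_seminorm q K f) N"

definition simple_below :: "(real \<Rightarrow> real) \<Rightarrow> simple_seminorm set" where
  "simple_below p = {N. standard_form N \<and> (AE t in unit_leb. exponent_fun N t \<le> p t)}"

section \<open>The limit superior norm and its spaces\<close>

text \<open>The filter of convergence in measure of the exponent functions to \<open>p\<close>, on the simple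
  semi-norms below \<open>p\<close>. A limit superior along the order "larger support and larger exponent function"
  would not do: this order is not directed. For instance, let \<open>p\<close> be 2 on a nowhere dense compact set
  of positive measure and 1 elsewhere. The seminorm with support \<open>[0,1]\<close> and exponent 1 is below \<open>p\<close>,
  but every larger one below \<open>p\<close> also coincides with the \<open>L\<^sup>1\<close> norm.\<close>

definition in_measure_filter :: "(real \<Rightarrow> real) \<Rightarrow> simple_seminorm filter" where
  "in_measure_filter p = (INF (\<epsilon>, \<delta>)\<in>{0<..} \<times> {0<..}. principal
     {N \<in> simple_below p. measure unit_leb {t\<in>{0..1}. \<epsilon> < \<bar>exponent_fun N t - p t\<bar>} < \<delta>})"

definition rho :: "(real \<Rightarrow> real) \<Rightarrow> L0 \<Rightarrow> ennreal" where
  "rho p f = Limsup (in_measure_filter p) (\<lambda>N. simple_norm N f)"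

definition Ltilde :: "(real \<Rightarrow> real) \<Rightarrow> L0 set" where
  "Ltilde p = {f. rho p f < \<infinity>}"

definition rho_norm :: "(real \<Rightarrow> real) \<Rightarrow> L0 \<Rightarrow> real" where
  "rho_norm p f = enn2real (rho p f)"

definition Lzero :: "(real \<Rightarrow> real) \<Rightarrow> L0 set" where
  "Lzero p = Metric_space.mtopology (Ltilde p) (\<lambda>f g. rho_norm p (f - g)) closure_of
     (\<Union>n::nat. {abs_L0 (indicator {t. p t \<le> real n}) * f |f. f \<in> Ltilde p})"

definition banach_space_on :: "'a::real_vector set \<Rightarrow> ('a \<Rightarrow> real) \<Rightarrow> bool" where
  "banach_space_on V \<nu> \<longleftrightarrow> subspace V
     \<and> (\<forall>x\<in>V. 0 \<le> \<nu> x \<and> (\<nu> x = 0 \<longleftrightarrow> x = 0))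
     \<and> (\<forall>x\<in>V. \<forall>c. \<nu> (c *\<^sub>R x) = \<bar>c\<bar> * \<nu> x)
     \<and> (\<forall>x\<in>V. \<forall>y\<in>V. \<nu> (x + y) \<le> \<nu> x + \<nu> y)
     \<and> (\<forall>s. range s \<subseteq> V \<longrightarrow> (\<forall>\<epsilon>>0. \<exists>M. \<forall>m\<ge>M. \<forall>n\<ge>M. \<nu> (s m - s n) < \<epsilon>)
          \<longrightarrow> (\<exists>l\<in>V. (\<lambda>n. \<nu> (s n - l)) \<longlonglongrightarrow> 0))"

end

theory Submission
  imports Defs
begin

text \<open>
  Accumulated from left to right, the simple semi-norm of \<open>f\<close> with exponent function \<open>q\<close> solves
  \<open>\<phi>' = \<bar>f\<bar> powr q / q * \<phi> powr (1 - q)\<close>, that is, \<open>(ln \<phi>)' = (\<bar>f\<bar> / \<phi>) powr q / q\<close>. By Young's inequality,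
  lowering the exponent function from \<open>p\<close> to \<open>q\<close> raises \<open>ln \<phi>\<close> by at most \<open>\<integral> (1 / q - 1 / p)\<close>. Hence
  \<open>exp (- \<integral> 1 / q) * \<parallel>f\<parallel>\<close> is monotone in \<open>q\<close>, and the limit superior \<open>rho\<close> is a supremum of weighted
  semi-norms. As such it satisfies the triangle inequality and has the Fatou property; it dominates
  the \<open>L\<^sup>1\<close> norm, which gives completeness.

  The same comparison bounds \<open>rho p f\<close> by the value at 1 of every solution for \<open>f\<close>. Conversely, where
  \<open>p\<close> is bounded, the solutions for semi-norms converging to \<open>p\<close> bound the solution for \<open>p\<close> by
  \<open>x + rho p f\<close>. For \<open>f\<close> in the closure, the solutions \<open>\<phi>\<^sub>n\<close> for the restrictions of \<open>f\<close> to \<open>{p \<le> n}\<close>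
  increase to a solution: the right-hand side decreases in \<open>\<phi>\<close>, so \<open>{n < p \<le> m}\<close> contributes to \<open>\<phi>\<^sub>m\<close>
  at most what that part of \<open>f\<close> produces alone, and this is at most its \<open>rho\<close>.
\<close>


section \<open>Primitives of nonnegative functions on the unit interval\<close>

text \<open>Three obstacles shape the development. The right-hand side is singular at
  \<open>\<phi> = 0\<close> where \<open>p > 1\<close>, so everything is proved for a positive
  initial value \<open>x\<close>, which is removed at the end. For this reason semi-norms are
  computed with an initial value as well (\<open>fold_norm a\<close>), at a cost of at most
  \<open>a\<close>. Next, \<open>p\<close> may be unbounded, so \<open>\<bar>f\<bar> powr p\<close>
  may fail to be integrable; the reciprocals \<open>1 / p\<close>, however, are bounded by 1, so the
  weights are always finite and pass to limits. Finally, a semi-norm sees only compact sets and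
  finitely many exponents, so a given \<open>N\<close> below \<open>p\<close> is in general not
  dominated by approximations \<open>M k\<close> of \<open>p\<close>. It is dominated, up to a
  factor, for functions cut to \<open>support (M k)\<close>, provided that the exponents of
  \<open>N\<close> belong to the grid to which \<open>p\<close> is rounded down; Fatou's lemma
  recovers what was cut away. Absolutely continuous functions occur together with a density, as
  \<open>primitive u c \<phi>\<close>. The chain rule and the comparison principle thereby become
  statements about integrals, and differentiation almost everywhere is avoided.\<close>

definition primitive :: "(real \<Rightarrow> real) \<Rightarrow> real \<Rightarrow> (real \<Rightarrow> real) \<Rightarrow> bool" where
  "primitive u c \<phi> \<longleftrightarrow> integrable unit_leb u \<and> (\<forall>t\<in>{0..1}. 0 \<le> u t)
     \<and> (\<forall>T\<in>{0..1}. \<phi> T = c + (\<integral>t. indicator {0..T} t * u t \<partial>unit_leb))"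

lemma space_unit_leb [simp]: "space unit_leb = {0..1}"
  by (simp add: space_restrict_space)

lemma sets_unit_leb_borel: "A \<in> sets borel \<Longrightarrow> A \<inter> {0..1} \<in> sets unit_leb"
  by (simp add: sets_restrict_space image_iff) (metis Int_commute sets_completionI_sets sets_lborel)

lemma borel_measurable_unit_leb:
  "g \<in> borel_measurable borel \<Longrightarrow> g \<in> borel_measurable unit_leb"
  by (simp add: measurable_restrict_space1 measurable_completion)

lemma indicator_measurable_unit_leb [measurable]:
  "A \<in> sets borel \<Longrightarrow> (indicator A :: real \<Rightarrow> 'a::{zero_neq_one,topological_space}) \<in> borel_measurable unit_leb"
  by (rule borel_measurable_unit_leb) simp

lemma emeasure_unit_leb_UNIV: "emeasure unit_leb {0..1} = 1"
  by (simp add: emeasure_restrict_space)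

lemma finite_measure_unit_leb: "finite_measure unit_leb"
  by (rule finite_measureI) (simp add: emeasure_restrict_space)

lemma AE_unit_leb_neq: "AE t in unit_leb. t \<noteq> (c::real)"
proof (rule AE_I'[of "{c} \<inter> {0..1}"])
  have "emeasure lborel ({c} \<inter> {0..1}) \<le> emeasure lborel {c}" by (intro emeasure_mono) auto
  then show "{c} \<inter> {0..1} \<in> null_sets unit_leb"
    by (auto simp: null_sets_def emeasure_restrict_space intro!: sets_unit_leb_borel)
qed auto

lemma AE_in_unit_interval: "AE t in unit_leb. 0 \<le> t \<and> t \<le> 1"
  by (rule AE_I2) auto

lemma integrable_indicator_times:
  assumes "integrable unit_leb (u::real\<Rightarrow>real)" "A \<in> sets borel"
  shows "integrable unit_leb (\<lambda>t. indicator A t * u t)"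
proof -
  have "integrable unit_leb (\<lambda>t. u t * indicator (A \<inter> {0..1}) t)"
    by (rule integrable_real_mult_indicator[OF sets_unit_leb_borel[OF assms(2)] assms(1)])
  then show ?thesis
    by (rule Bochner_Integration.integrable_cong[THEN iffD1, rotated 2]) (auto simp: indicator_def)
qed

lemma nn_integral_indicator_eq:
  assumes "integrable unit_leb (u::real\<Rightarrow>real)" "\<And>t. t \<in> {0..1} \<Longrightarrow> 0 \<le> u t" "A \<in> sets borel"
  shows "(\<integral>\<^sup>+t. ennreal (indicator A t * u t) \<partial>unit_leb) = ennreal (\<integral>t. indicator A t * u t \<partial>unit_leb)"
    and "0 \<le> (\<integral>t. indicator A t * u t \<partial>unit_leb)"
proof -
  have *: "AE t in unit_leb. 0 \<le> indicator A t * u t"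
    by (rule AE_I2) (use assms(2) in simp)
  show "(\<integral>\<^sup>+t. ennreal (indicator A t * u t) \<partial>unit_leb) = ennreal (\<integral>t. indicator A t * u t \<partial>unit_leb)"
    by (rule nn_integral_eq_integral[OF integrable_indicator_times[OF assms(1,3)] *])
  show "0 \<le> (\<integral>t. indicator A t * u t \<partial>unit_leb)" by (rule integral_nonneg_AE[OF *])
qed

lemma primitive_diff:
  assumes "primitive u c \<phi>" "0 \<le> S" "S \<le> T" "T \<le> 1"
  shows "\<phi> T = \<phi> S + (\<integral>t. indicator {S<..T} t * u t \<partial>unit_leb)"
proof -
  have i: "integrable unit_leb u" using assms by (simp add: primitive_def)
  have "(\<integral>t. indicator {0..T} t * u t \<partial>unit_leb)
      = (\<integral>t. indicator {0..S} t * u t + indicator {S<..T} t * u t \<partial>unit_leb)"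
    using assms by (intro Bochner_Integration.integral_cong) (auto simp: indicator_def)
  also have "\<dots> = (\<integral>t. indicator {0..S} t * u t \<partial>unit_leb) + (\<integral>t. indicator {S<..T} t * u t \<partial>unit_leb)"
    by (intro Bochner_Integration.integral_add integrable_indicator_times i) auto
  finally show ?thesis using assms by (simp add: primitive_def)
qed

lemma primitive_0: "primitive u c \<phi> \<Longrightarrow> \<phi> 0 = c"
proof -
  assume "primitive u c \<phi>"
  moreover have "(\<integral>t. indicator {0..0} t * u t \<partial>unit_leb) = 0"
    by (rule integral_eq_zero_AE, rule AE_mp[OF AE_unit_leb_neq[of 0]]) (auto simp: indicator_def)
  ultimately show ?thesis by (simp add: primitive_def)
qed

lemma primitive_mono:
  assumes "primitive u c \<phi>" "0 \<le> S" "S \<le> T" "T \<le> 1"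
  shows "\<phi> S \<le> \<phi> T"
proof -
  have "0 \<le> (\<integral>t. indicator {S<..T} t * u t \<partial>unit_leb)"
    using assms(1) by (intro integral_nonneg_AE AE_I2) (auto simp: primitive_def)
  then show ?thesis using primitive_diff[OF assms] by simp
qed

lemma primitive_ge: "primitive u c \<phi> \<Longrightarrow> t \<in> {0..1} \<Longrightarrow> c \<le> \<phi> t"
  using primitive_mono[of u c \<phi> 0 t] primitive_0[of u c \<phi>] by auto

text \<open>Absolute continuity of the integral: \<open>u\<close> is at most a constant
  \<open>k\<close>, which contributes at most \<open>k\<close> times the total length, plus a
  remainder \<open>v\<close> of small integral.\<close>

lemma primitive_abs_cont:
  assumes p: "primitive u c \<phi>"
  shows "abs_cont_on {0..1} \<phi>"
  unfolding abs_cont_on_def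
proof (intro allI impI)
  fix \<epsilon> :: real assume e: "\<epsilon> > 0"
  have i: "integrable unit_leb u" and u0: "\<And>t. t \<in> {0..1} \<Longrightarrow> 0 \<le> u t"
    using p by (auto simp: primitive_def)
  have um [measurable]: "u \<in> borel_measurable unit_leb" using i by auto
  have "(\<lambda>k. \<integral>t. min (u t) (real k) \<partial>unit_leb) \<longlonglongrightarrow> (\<integral>t. u t \<partial>unit_leb)"
  proof (rule integral_dominated_convergence[where w=u])
    show "AE x in unit_leb. (\<lambda>k. min (u x) (real k)) \<longlonglongrightarrow> u x"
    proof (rule AE_I2, rule tendsto_eventually)
      fix x show "\<forall>\<^sub>F k in sequentially. min (u x) (real k) = u x"
      proof -
        obtain k0 :: nat where "u x \<le> real k0" using real_arch_simple by blast
        then show ?thesis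
          by (intro eventually_sequentiallyI[of k0]) (simp add: min_def)
      qed
    qed
    show "AE x in unit_leb. norm (min (u x) (real k)) \<le> u x" for k
      by (rule AE_I2) (use u0 in \<open>auto simp: min_def\<close>)
    show "integrable unit_leb u" by (rule i)
    show "u \<in> borel_measurable unit_leb" by (rule um)
    show "(\<lambda>t. min (u t) (real k)) \<in> borel_measurable unit_leb" for k
      by (intro borel_measurable_min um borel_measurable_const)
  qed
  then have "\<forall>\<^sub>F k in sequentially. dist (\<integral>t. min (u t) (real k) \<partial>unit_leb) (\<integral>t. u t \<partial>unit_leb) < \<epsilon>/2"
    by (rule tendstoD) (use e in simp)
  then obtain k where k: "\<bar>(\<integral>t. min (u t) (real k) \<partial>unit_leb) - (\<integral>t. u t \<partial>unit_leb)\<bar> < \<epsilon>/2"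
    unfolding eventually_sequentially dist_real_def by (meson order_refl)
  define v where "v = (\<lambda>t. u t - min (u t) (real k))"
  have im: "integrable unit_leb (\<lambda>t. min (u t) (real k))"
    by (rule Bochner_Integration.integrable_bound[OF i]) (use u0 in auto)
  have iv: "integrable unit_leb v" unfolding v_def using i im by auto
  have v0: "0 \<le> v t" "u t \<le> v t + k" for t unfolding v_def by auto
  have vint: "(\<integral>t. v t \<partial>unit_leb) < \<epsilon>/2"
    using k Bochner_Integration.integral_diff[OF i im] unfolding v_def by linarith
  show "\<exists>\<delta>>0. \<forall>D. finite D \<longrightarrow> (\<forall>(a, b)\<in>D. a \<le> b \<and> {a..b} \<subseteq> {0..1}) \<longrightarrow>
     disjoint_family_on (\<lambda>(a, b). {a<..<b}) D \<longrightarrow> (\<Sum>(a, b)\<in>D. b - a) < \<delta> \<longrightarrow>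
     (\<Sum>(a, b)\<in>D. \<bar>\<phi> b - \<phi> a\<bar>) < \<epsilon>"
  \<comment> \<open>This makes \<open>k\<close> times the total length at most
    \<open>\<epsilon> / 2\<close>; the \<open>+ 1\<close> covers \<open>k = 0\<close>.\<close>
  proof (intro exI[of _ "\<epsilon> / (2 * (real k + 1))"] conjI allI impI)
    show "0 < \<epsilon> / (2 * (real k + 1))" using e by auto
    fix D :: "(real \<times> real) set"
    assume D: "finite D" "\<forall>(a, b)\<in>D. a \<le> b \<and> {a..b} \<subseteq> {0..1}"
      "disjoint_family_on (\<lambda>(a, b). {a<..<b}) D" "(\<Sum>(a, b)\<in>D. b - a) < \<epsilon> / (2 * (real k + 1))"
    \<comment> \<open>Only the interiors of the members of \<open>D\<close> are disjoint, so the
      estimate is over open intervals; the endpoint \<open>b\<close> is a null set.\<close>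
    have bnd: "\<bar>\<phi> b - \<phi> a\<bar> \<le> (\<integral>t. indicator {a<..<b} t * v t \<partial>unit_leb) + k * (b - a)" if "(a,b) \<in> D" for a b :: real
    proof -
      have ab: "0 \<le> a" "a \<le> b" "b \<le> 1" using D(2) that by auto
      have m: "(\<integral>t. indicator {a<..<b} t \<partial>unit_leb) = b - a"
      proof -
        have "(\<integral>t. indicator {a<..<b} t \<partial>unit_leb) = measure unit_leb ({a<..<b} \<inter> {0..1})" by simp
        also have "\<dots> = measure lebesgue ({a<..<b} \<inter> {0..1})"
          by (subst measure_restrict_space) auto
        also have "\<dots> = measure lebesgue {a<..<b}"
          using ab by (intro arg_cong[where f="measure lebesgue"]) auto
        finally show ?thesis using ab by simp
      qed
      have ii: "integrable unit_leb (\<lambda>t. indicator {a<..<b} t * (1::real))"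
        by (intro integrable_indicator_times finite_measure.integrable_const finite_measure_unit_leb) auto
      have "\<bar>\<phi> b - \<phi> a\<bar> = (\<integral>t. indicator {a<..b} t * u t \<partial>unit_leb)"
        using primitive_diff[OF p ab] primitive_mono[OF p ab] by auto
      also have "\<dots> \<le> (\<integral>t. indicator {a<..<b} t * v t + real k * (indicator {a<..<b} t * 1) \<partial>unit_leb)"
      proof (rule integral_mono_AE)
        show "AE x in unit_leb. indicator {a<..b} x * u x
             \<le> indicator {a<..<b} x * v x + real k * (indicator {a<..<b} x * 1)"
          using AE_unit_leb_neq[of b] by eventually_elim (use v0 in \<open>auto simp: indicator_def\<close>)
        show "integrable unit_leb (\<lambda>t. indicator {a<..b} t * u t)"
          by (intro integrable_indicator_times i) simp
        show "integrable unit_leb (\<lambda>t. indicator {a<..<b} t * v t + real k * (indicator {a<..<b} t * 1))"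
          by (intro Bochner_Integration.integrable_add integrable_indicator_times iv
              integrable_mult_right[OF ii]) simp
      qed
      also have "\<dots> = (\<integral>t. indicator {a<..<b} t * v t \<partial>unit_leb) + k * (b - a)"
        using Bochner_Integration.integral_add[OF integrable_indicator_times[OF iv, of "{a<..<b}"] integrable_mult_right[OF ii, of k]] m
        by simp
      finally show ?thesis .
    qed
    have "(\<Sum>(a, b)\<in>D. \<bar>\<phi> b - \<phi> a\<bar>) \<le> (\<Sum>(a, b)\<in>D. (\<integral>t. indicator {a<..<b} t * v t \<partial>unit_leb) + k * (b - a))"
      using bnd by (intro sum_mono) auto
    also have "\<dots> = (\<Sum>(a, b)\<in>D. (\<integral>t. indicator {a<..<b} t * v t \<partial>unit_leb)) + k * (\<Sum>(a, b)\<in>D. (b - a))"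
      by (simp add: sum.distrib sum_distrib_left case_prod_unfold)
    also have "(\<Sum>(a, b)\<in>D. (\<integral>t. indicator {a<..<b} t * v t \<partial>unit_leb))
       = (\<integral>t. (\<Sum>(a, b)\<in>D. indicator {a<..<b} t * v t) \<partial>unit_leb)"
      unfolding case_prod_unfold
      by (rule Bochner_Integration.integral_sum[symmetric]) (intro integrable_indicator_times iv, simp)
    also have "\<dots> \<le> (\<integral>t. v t \<partial>unit_leb)"
    proof (rule integral_mono)
      fix t
      have "(\<Sum>(a, b)\<in>D. indicator {a<..<b} t) \<le> (1::real)"
      proof -
        have "(\<Sum>d\<in>D. indicator (case d of (a, b) \<Rightarrow> {a<..<b}) t) = (indicator (\<Union>d\<in>D. case d of (a, b) \<Rightarrow> {a<..<b}) t :: real)"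
          by (rule indicator_UN_disjoint[symmetric]) (use D in auto)
        also have "\<dots> \<le> 1" by (simp add: indicator_def)
        finally show ?thesis by (simp add: case_prod_unfold)
      qed
      then have "(\<Sum>(a, b)\<in>D. indicator {a<..<b} t) * v t \<le> 1 * v t"
        by (rule mult_right_mono) (rule v0)
      then show "(\<Sum>(a, b)\<in>D. indicator {a<..<b} t * v t) \<le> v t"
        by (simp add: sum_distrib_right case_prod_unfold)
      show "integrable unit_leb (\<lambda>t. \<Sum>(a, b)\<in>D. indicator {a<..<b} t * v t)"
        unfolding case_prod_unfold
        by (intro Bochner_Integration.integrable_sum integrable_indicator_times iv) simp
    qed (rule iv)
    also have "k * (\<Sum>(a, b)\<in>D. (b - a)) \<le> \<epsilon>/2"
    proof -
      have "k * (\<Sum>(a, b)\<in>D. (b - a)) \<le> k * (\<epsilon> / (2 * (real k + 1)))"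
        using D(4) by (intro mult_left_mono) auto
      also have "\<dots> \<le> \<epsilon>/2" using e by (simp add: field_simps)
      finally show ?thesis .
    qed
    finally show "(\<Sum>(a, b)\<in>D. \<bar>\<phi> b - \<phi> a\<bar>) < \<epsilon>" using vint by simp
  qed
qed

lemma abs_cont_on_imp_continuous_on:
  assumes "abs_cont_on {a..b} g"
  shows "continuous_on {a..b} g"
  unfolding continuous_on_iff
proof (intro ballI allI impI)
  fix x \<epsilon> :: real assume x: "x \<in> {a..b}" and e: "\<epsilon> > 0"
  have "\<exists>\<delta>>0. \<forall>D. finite D \<longrightarrow> (\<forall>(s, t)\<in>D. s \<le> t \<and> {s..t} \<subseteq> {a..b})
        \<longrightarrow> disjoint_family_on (\<lambda>(s, t). {s<..<t}) D \<longrightarrow> (\<Sum>(s, t)\<in>D. t - s) < \<delta>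
        \<longrightarrow> (\<Sum>(s, t)\<in>D. \<bar>g t - g s\<bar>) < \<epsilon>"
    using assms[unfolded abs_cont_on_def, rule_format, OF e] .
  then obtain \<delta> where d: "\<delta> > 0" and d': "\<And>D. finite D \<Longrightarrow> (\<forall>(s, t)\<in>D. s \<le> t \<and> {s..t} \<subseteq> {a..b})
        \<Longrightarrow> disjoint_family_on (\<lambda>(s, t). {s<..<t}) D \<Longrightarrow> (\<Sum>(s, t)\<in>D. t - s) < \<delta>
        \<Longrightarrow> (\<Sum>(s, t)\<in>D. \<bar>g t - g s\<bar>) < \<epsilon>"
    by blast
  have "dist (g y) (g x) < \<epsilon>" if y: "y \<in> {a..b}" "dist y x < \<delta>" for y
  proof -
    define l r where "l = min x y" and "r = max x y"
    have lr: "l \<le> r" "{l..r} \<subseteq> {a..b}" "r - l < \<delta>"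
      using x y by (auto simp: l_def r_def dist_real_def)
    have "(\<Sum>(s, t)\<in>{(l, r)}. \<bar>g t - g s\<bar>) < \<epsilon>"
      by (rule d') (use lr in \<open>auto simp: disjoint_family_on_def\<close>)
    then show ?thesis
      by (auto simp: l_def r_def dist_real_def min_def max_def split: if_splits)
  qed
  with d show "\<exists>d>0. \<forall>x'\<in>{a..b}. dist x' x < d \<longrightarrow> dist (g x') (g x) < \<epsilon>" by blast
qed

lemma primitive_cont: "primitive u c \<phi> \<Longrightarrow> continuous_on {0..1} \<phi>"
  by (rule abs_cont_on_imp_continuous_on[OF primitive_abs_cont])

lemma continuous_measurable_unit_leb:
  "continuous_on {0..1} \<phi> \<Longrightarrow> (\<phi>::real\<Rightarrow>real) \<in> borel_measurable unit_leb"
  by (rule continuous_imp_measurable_on_sets_lebesgue) auto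

lemma primitive_measurable: "primitive u c \<phi> \<Longrightarrow> \<phi> \<in> borel_measurable unit_leb"
  by (rule continuous_measurable_unit_leb[OF primitive_cont])

lemma primitive_nn:
  assumes "primitive u c \<phi>" "T \<in> {0..1}"
  shows "(\<integral>\<^sup>+t. ennreal (indicator {0..T} t * u t) \<partial>unit_leb) = ennreal (\<phi> T - c)"
proof -
  have "integrable unit_leb u" "\<And>t. t \<in> {0..1} \<Longrightarrow> 0 \<le> u t" "\<phi> T = c + (\<integral>t. indicator {0..T} t * u t \<partial>unit_leb)"
    using assms by (auto simp: primitive_def)
  then show ?thesis using nn_integral_indicator_eq(1)[of u "{0..T}"] by simp
qed

text \<open>Entry point for equations written with nonnegative integrals: integrability of
  \<open>u\<close> comes from finiteness at \<open>T = 1\<close>.\<close>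

lemma primitive_nnI:
  assumes "u \<in> borel_measurable unit_leb" "\<And>t. t \<in> {0..1} \<Longrightarrow> 0 \<le> u t"
    and "\<And>T. T \<in> {0..1} \<Longrightarrow> c \<le> \<phi> T"
    and "\<And>T. T \<in> {0..1} \<Longrightarrow> (\<integral>\<^sup>+t. ennreal (indicator {0..T} t * u t) \<partial>unit_leb) = ennreal (\<phi> T - c)"
  shows "primitive u c \<phi>"
proof -
  have "(\<integral>\<^sup>+t. ennreal (u t) \<partial>unit_leb) = (\<integral>\<^sup>+t. ennreal (indicator {0..1} t * u t) \<partial>unit_leb)"
    by (intro nn_integral_cong) auto
  then have i: "integrable unit_leb u"
    using assms(4)[of 1] by (intro integrableI_nonneg assms(1) AE_I2) (simp_all add: assms(2))
  have "\<phi> T = c + (\<integral>t. indicator {0..T} t * u t \<partial>unit_leb)" if T: "T \<in> {0..1}" for T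
  proof -
    have "ennreal (\<integral>t. indicator {0..T} t * u t \<partial>unit_leb) = ennreal (\<phi> T - c)"
      using assms(4)[OF T] nn_integral_indicator_eq(1)[OF i assms(2), of "{0..T}"] by simp
    then have "(\<integral>t. indicator {0..T} t * u t \<partial>unit_leb) = \<phi> T - c"
      using assms(3)[OF T] nn_integral_indicator_eq(2)[OF i assms(2), of "{0..T}"] by simp
    then show ?thesis by simp
  qed
  with i assms(2) show ?thesis by (auto simp: primitive_def)
qed

lemma primitive_add:
  assumes "primitive u c \<phi>" "primitive v d \<psi>"
  shows "primitive (\<lambda>t. u t + v t) (c + d) (\<lambda>t. \<phi> t + \<psi> t)"
  using assms
  by (auto simp: primitive_def distrib_left Bochner_Integration.integral_add integrable_indicator_times)

lemma primitive_integral: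
  assumes "integrable unit_leb u" "\<And>t. t \<in> {0..1} \<Longrightarrow> 0 \<le> u t"
  shows "primitive u c (\<lambda>T. c + (\<integral>t. indicator {0..T} t * u t \<partial>unit_leb))"
  using assms by (auto simp: primitive_def)

text \<open>Let \<open>S\<close> be the last time up to \<open>T\<close> with
  \<open>\<phi> \<le> \<psi>\<close>. After \<open>S\<close> the inequality between the densities is
  available almost everywhere, and integrating it over \<open>{S<..T}\<close> gives the claim.
  Asking for it only where \<open>\<psi> < \<phi>\<close> suits right-hand sides that decrease in
  the solution.\<close>

lemma primitive_compare:
  assumes p: "primitive u c \<phi>" and q: "primitive v d \<psi>" and cd: "c \<le> d"
    and e: "integrable unit_leb e" "\<And>t. t \<in> {0..1} \<Longrightarrow> 0 \<le> e t"
    and le: "AE t in unit_leb. \<psi> t < \<phi> t \<longrightarrow> u t \<le> v t + e t"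
    and T: "T \<in> {0..1}"
  shows "\<phi> T \<le> \<psi> T + (\<integral>t. e t \<partial>unit_leb)"
proof -
  have cf: "continuous_on {0..T} \<phi>" "continuous_on {0..T} \<psi>"
    using primitive_cont[OF p] primitive_cont[OF q] T by (auto intro: continuous_on_subset)
  define Z where "Z = {s\<in>{0..T}. \<phi> s - \<psi> s \<le> 0}"
  have "compact Z"
  proof -
    have "closed Z" unfolding Z_def
      by (intro continuous_on_closed_Collect_le continuous_intros cf)
    moreover have "Z \<subseteq> {0..T}" by (auto simp: Z_def)
    ultimately show ?thesis by (meson bounded_closed_interval bounded_subset compact_eq_bounded_closed)
  qed
  moreover have "0 \<in> Z" using primitive_0[OF p] primitive_0[OF q] cd T by (auto simp: Z_def)
  ultimately obtain S where S: "S \<in> Z" "\<And>s. s \<in> Z \<Longrightarrow> s \<le> S"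
    using compact_attains_sup[of Z] by auto
  have ST: "0 \<le> S" "S \<le> T" "T \<le> 1" "\<phi> S \<le> \<psi> S" using S T by (auto simp: Z_def)
  have iu: "integrable unit_leb u" and iv: "integrable unit_leb v" using p q by (auto simp: primitive_def)
  have "(\<integral>t. indicator {S<..T} t * u t \<partial>unit_leb) \<le> (\<integral>t. indicator {S<..T} t * v t + e t \<partial>unit_leb)"
  proof (rule integral_mono_AE)
    show "AE t in unit_leb. indicator {S<..T} t * u t \<le> indicator {S<..T} t * v t + e t"
      using le AE_in_unit_interval
    proof eventually_elim
      case (elim t)
      have "\<psi> t < \<phi> t" if "t \<in> {S<..T}"
      proof (rule ccontr)
        assume "\<not> \<psi> t < \<phi> t"
        then have "t \<in> Z" using that ST by (auto simp: Z_def)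
        then show False using S(2)[of t] that by auto
      qed
      then show ?case using elim e(2)[of t] by (auto simp: indicator_def)
    qed
  qed (auto intro!: integrable_indicator_times iu iv e)
  also have "\<dots> = (\<integral>t. indicator {S<..T} t * v t \<partial>unit_leb) + (\<integral>t. e t \<partial>unit_leb)"
    by (intro Bochner_Integration.integral_add integrable_indicator_times iv e) auto
  finally show ?thesis
    using primitive_diff[OF p ST(1-3)] primitive_diff[OF q ST(1-3)] ST by simp
qed

text \<open>Chain rule without pointwise derivatives of \<open>\<phi>\<close>: since
  \<open>\<phi>\<close> is continuous and monotone, its image of the measure with density
  \<open>u\<close> on \<open>{0..T}\<close> is Lebesgue measure on \<open>{c..\<phi> T}\<close>.
  Hence the integral of \<open>G' (\<phi> t) * u t\<close> is that of \<open>G'\<close> over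
  \<open>{c..\<phi> T}\<close>, where the fundamental theorem of calculus applies.\<close>

lemma primitive_chain:
  assumes p: "primitive u c \<phi>"
    and G': "G' \<in> borel_measurable borel" "\<And>y. y \<in> {c..\<phi> 1} \<Longrightarrow> 0 \<le> G' y"
    and G: "\<And>y. y \<in> {c..\<phi> 1} \<Longrightarrow> (G has_real_derivative G' y) (at y)"
  shows "primitive (\<lambda>t. G' (\<phi> t) * u t) (G c) (\<lambda>t. G (\<phi> t))"
proof (rule primitive_nnI)
  have um [measurable]: "u \<in> borel_measurable unit_leb" and u0: "\<And>t. t \<in> {0..1} \<Longrightarrow> 0 \<le> u t"
    using p by (auto simp: primitive_def)
  note [measurable] = G'(1) primitive_measurable[OF p]
  have rng: "\<phi> t \<in> {c..\<phi> 1}" if "t \<in> {0..1}" for t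
    using primitive_ge[OF p] primitive_mono[OF p, of t 1] that by auto
  show "(\<lambda>t. G' (\<phi> t) * u t) \<in> borel_measurable unit_leb" by measurable
  show "0 \<le> G' (\<phi> t) * u t" if "t \<in> {0..1}" for t using G'(2)[OF rng[OF that]] u0[OF that] by simp
  show "G c \<le> G (\<phi> T)" if T: "T \<in> {0..1}" for T
  proof -
    have "\<exists>l. (G has_real_derivative l) (at y) \<and> 0 \<le> l" if "c \<le> y" "y \<le> \<phi> T" for y
    proof -
      have "y \<in> {c..\<phi> 1}" using that rng[OF T] by auto
      then show ?thesis using G G'(2) by blast
    qed
    then show ?thesis
      using DERIV_nonneg_imp_nondecreasing[of c "\<phi> T" G] rng[OF T] by auto
  qed
  fix T :: real assume T: "T \<in> {0..1}"
  define w where "w = (\<lambda>t. ennreal (indicator {0..T} t * u t))"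
  have wm [measurable]: "w \<in> borel_measurable unit_leb"
    unfolding w_def
    by (intro measurable_compose[OF _ measurable_ennreal] borel_measurable_times um indicator_measurable_unit_leb) simp
  \<comment> \<open>Both measures are finite on the half-lines \<open>{x<..}\<close>, so it suffices
    that they agree there.\<close>
  have eq: "distr (density unit_leb w) borel \<phi> = density lborel (indicator {c..\<phi> T})"
  proof (rule measure_eqI_lessThan)
    fix x :: real
    have L: "emeasure (distr (density unit_leb w) borel \<phi>) {x<..}
        = (\<integral>\<^sup>+t. w t * indicator {x<..} (\<phi> t) \<partial>unit_leb)"
    proof -
      have "\<phi> -` {x<..} \<inter> {0..1} \<in> sets unit_leb"
        using measurable_sets[OF primitive_measurable[OF p], of "{x<..}"] by simp
      then have "emeasure (distr (density unit_leb w) borel \<phi>) {x<..}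
          = (\<integral>\<^sup>+t. w t * indicator (\<phi> -` {x<..} \<inter> {0..1}) t \<partial>unit_leb)"
        by (subst emeasure_distr) (simp_all add: emeasure_density)
      also have "\<dots> = (\<integral>\<^sup>+t. w t * indicator {x<..} (\<phi> t) \<partial>unit_leb)"
        by (intro nn_integral_cong) (simp add: indicator_def)
      finally show ?thesis .
    qed
    have R: "emeasure (density lborel (indicator {c..\<phi> T})) {x<..} = emeasure lborel ({c..\<phi> T} \<inter> {x<..})"
      by (simp add: emeasure_density nn_integral_set_ennreal flip: indicator_inter_arith)
    consider "x < c" | "\<phi> T \<le> x" | "c \<le> x" "x < \<phi> T" by linarith
    then have "(\<integral>\<^sup>+t. w t * indicator {x<..} (\<phi> t) \<partial>unit_leb) = emeasure lborel ({c..\<phi> T} \<inter> {x<..})"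
    proof cases
      case 1
      have "(\<integral>\<^sup>+t. w t * indicator {x<..} (\<phi> t) \<partial>unit_leb) = (\<integral>\<^sup>+t. w t \<partial>unit_leb)"
        using rng 1 by (intro nn_integral_cong) (force simp: indicator_def)
      also have "\<dots> = ennreal (\<phi> T - c)" unfolding w_def by (rule primitive_nn[OF p T])
      moreover have "{c..\<phi> T} \<inter> {x<..} = {c..\<phi> T}" using 1 by auto
      ultimately show ?thesis using rng[OF T] by simp
    next
      case 2
      have "w t * indicator {x<..} (\<phi> t) = 0" if "t \<in> {0..1}" for t
        using primitive_mono[OF p, of t T] that T 2 by (auto simp: w_def indicator_def)
      then have "(\<integral>\<^sup>+t. w t * indicator {x<..} (\<phi> t) \<partial>unit_leb) = 0"
        by (subst nn_integral_cong[where v="\<lambda>_. 0"]) auto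
      moreover have "{c..\<phi> T} \<inter> {x<..} = {}" using 2 by auto
      ultimately show ?thesis by simp
    next
      case 3
      have cf: "continuous_on {0..T} \<phi>"
        using primitive_cont[OF p] T by (auto intro: continuous_on_subset)
      \<comment> \<open>\<open>S\<close> will be the last time at which
        \<open>\<phi> \<le> x\<close>, so within \<open>{0..T}\<close> the set where
        \<open>x < \<phi>\<close> is \<open>{S<..T}\<close>, of mass
        \<open>\<phi> T - \<phi> S\<close>. The intermediate value theorem gives
        \<open>\<phi> S = x\<close>.\<close>
      define Z where "Z = {s\<in>{0..T}. \<phi> s \<le> x}"
      have "compact Z"
      proof -
        have "closed Z" unfolding Z_def
          by (intro continuous_on_closed_Collect_le cf) auto
        moreover have "Z \<subseteq> {0..T}" by (auto simp: Z_def)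
        ultimately show ?thesis by (meson bounded_closed_interval bounded_subset compact_eq_bounded_closed)
      qed
      moreover have "0 \<in> Z" using primitive_0[OF p] 3 T by (auto simp: Z_def)
      ultimately obtain S where S: "S \<in> Z" "\<And>s. s \<in> Z \<Longrightarrow> s \<le> S"
        using compact_attains_sup[of Z] by auto
      have ST: "0 \<le> S" "S \<le> T" "T \<le> 1" "\<phi> S \<le> x" using S T by (auto simp: Z_def)
      obtain S' where S': "0 \<le> S'" "S' \<le> T" "\<phi> S' = x"
        using IVT'[of \<phi> 0 x T] primitive_0[OF p] 3 T cf by auto
      have "S' \<le> S" using S(2)[of S'] S' by (auto simp: Z_def)
      then have Sx: "\<phi> S = x" using primitive_mono[OF p, of S' S] ST S' by auto
      have "(\<integral>\<^sup>+t. w t * indicator {x<..} (\<phi> t) \<partial>unit_leb) = (\<integral>\<^sup>+t. ennreal (indicator {S<..T} t * u t) \<partial>unit_leb)"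
      proof (intro nn_integral_cong)
        fix t assume "t \<in> space unit_leb" 
        then have t: "t \<in> {0..1}" by simp
        have "x < \<phi> t \<longleftrightarrow> S < t" if "t \<le> T"
        proof
          assume "x < \<phi> t" then show "S < t" using primitive_mono[OF p, of t S] t ST Sx by force
        next
          assume "S < t" then show "x < \<phi> t" using S(2)[of t] t that by (force simp: Z_def)
        qed
        then show "w t * indicator {x<..} (\<phi> t) = ennreal (indicator {S<..T} t * u t)"
          using t ST by (auto simp: w_def indicator_def)
      qed
      also have "\<dots> = ennreal (\<phi> T - \<phi> S)"
        using primitive_diff[OF p ST(1-3)] nn_integral_indicator_eq(1)[OF _ u0, where A="{S<..T}"] p
        by (simp add: primitive_def)
      moreover have "{c..\<phi> T} \<inter> {x<..} = {x<..\<phi> T}" using 3 by auto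
      ultimately show ?thesis using 3 Sx by simp
    qed
    then show "emeasure (distr (density unit_leb w) borel \<phi>) {x<..} = emeasure (density lborel (indicator {c..\<phi> T})) {x<..}"
      using L R by simp
    have "emeasure lborel ({c..\<phi> T} \<inter> {x<..}) \<le> emeasure lborel {c..\<phi> T}"
      by (intro emeasure_mono) auto
    also have "\<dots> < \<infinity>" using rng[OF T] by (simp add: emeasure_lborel_Icc_eq)
    finally show "emeasure (distr (density unit_leb w) borel \<phi>) {x<..} < \<infinity>"
      using L \<open>(\<integral>\<^sup>+t. w t * indicator {x<..} (\<phi> t) \<partial>unit_leb) = _\<close> by simp
  qed auto
  have "(\<integral>\<^sup>+t. ennreal (indicator {0..T} t * (G' (\<phi> t) * u t)) \<partial>unit_leb)
      = (\<integral>\<^sup>+t. w t * ennreal (G' (\<phi> t)) \<partial>unit_leb)"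
  proof (rule nn_integral_cong)
    fix t assume "t \<in> space unit_leb"
    then have "0 \<le> G' (\<phi> t)" "0 \<le> u t" using G'(2)[OF rng] u0 by auto
    then show "ennreal (indicator {0..T} t * (G' (\<phi> t) * u t)) = w t * ennreal (G' (\<phi> t))"
      by (simp add: w_def indicator_def mult.commute flip: ennreal_mult)
  qed
  also have "\<dots> = (\<integral>\<^sup>+t. ennreal (G' (\<phi> t)) \<partial>density unit_leb w)"
    by (subst nn_integral_density) auto
  also have "\<dots> = (\<integral>\<^sup>+y. ennreal (G' y) \<partial>distr (density unit_leb w) borel \<phi>)"
    by (subst nn_integral_distr) auto
  also have "\<dots> = (\<integral>\<^sup>+y. ennreal (G' y) * indicator {c..\<phi> T} y \<partial>lborel)"
    unfolding eq by (subst nn_integral_density) (auto simp: mult.commute)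
  also have "\<dots> = ennreal (G (\<phi> T) - G c)"
    using rng[OF T] by (intro nn_integral_FTC_Icc G' G) auto
  finally show "(\<integral>\<^sup>+t. ennreal (indicator {0..T} t * (G' (\<phi> t) * u t)) \<partial>unit_leb) = ennreal (G (\<phi> T) - G c)" .
qed

section \<open>The Caratheodory equation\<close>

definition ode_rhs :: "(real \<Rightarrow> real) \<Rightarrow> (real \<Rightarrow> real) \<Rightarrow> (real \<Rightarrow> real) \<Rightarrow> real \<Rightarrow> real" where
  "ode_rhs p g \<phi> t = \<bar>g t\<bar> powr p t / p t * \<phi> t powr (1 - p t)"

text \<open>\<open>ode_solution\<close> for a function instead of a class, in terms of the Bochner
  integral. Positivity of \<open>\<phi>\<close> follows from \<open>0 < x\<close>, since the
  primitive of a nonnegative function is monotone.\<close>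

definition solves_ode :: "(real \<Rightarrow> real) \<Rightarrow> (real \<Rightarrow> real) \<Rightarrow> real \<Rightarrow> (real \<Rightarrow> real) \<Rightarrow> bool" where
  "solves_ode p g x \<phi> \<longleftrightarrow> primitive (ode_rhs p g \<phi>) x \<phi>"

lemma primitive_cong:
  assumes "primitive u c \<phi>" "\<And>t. t \<in> {0..1} \<Longrightarrow> u t = v t" "\<And>t. t \<in> {0..1} \<Longrightarrow> \<phi> t = \<psi> t"
  shows "primitive v c \<psi>"
proof -
  have 1: "integrable unit_leb u = integrable unit_leb v"
    by (rule Bochner_Integration.integrable_cong) (use assms in auto)
  have 2: "(\<integral>t. indicator {0..T} t * u t \<partial>unit_leb) = (\<integral>t. indicator {0..T} t * v t \<partial>unit_leb)" for T :: real
    by (rule Bochner_Integration.integral_cong) (use assms in auto)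
  show ?thesis using assms 1 2 unfolding primitive_def by metis
qed

lemma ode_rhs_nonneg: "1 \<le> p t \<Longrightarrow> 0 \<le> ode_rhs p g \<phi> t"
  by (simp add: ode_rhs_def)

lemma ode_rhs_measurable [measurable (raw)]:
  assumes "p \<in> borel_measurable unit_leb" "g \<in> borel_measurable unit_leb" "\<phi> \<in> borel_measurable unit_leb"
  shows "ode_rhs p g \<phi> \<in> borel_measurable unit_leb"
proof -
  note [measurable] = assms
  show ?thesis unfolding ode_rhs_def by measurable
qed

text \<open>The exponent \<open>1 - p t\<close> is nonpositive. This one-sided monotonicity drives
  the stability estimate, the iteration for existence and the treatment of tails.\<close>

lemma ode_rhs_antimono:
  assumes "1 \<le> p t" "0 < \<phi> t" "\<phi> t \<le> \<psi> t"
  shows "ode_rhs p g \<psi> t \<le> ode_rhs p g \<phi> t"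
  unfolding ode_rhs_def using assms by (intro mult_left_mono powr_mono2') auto

text \<open>Weighted AM-GM for \<open>s powr p\<close> and \<open>1\<close> with weights
  \<open>q / p\<close> and \<open>1 - q / p\<close>, divided by \<open>q\<close>. For
  \<open>r = s = 1\<close> it is an equality, so the loss \<open>1 / q - 1 / p\<close> cannot be
  improved.\<close>

lemma young_exponents:
  fixes p q r s :: real
  assumes "1 \<le> q" "q \<le> p" "0 \<le> r" "r \<le> s"
  shows "r powr q / q \<le> s powr p / p + (1 / q - 1 / p)"
proof (cases "s = 0")
  case True
  then show ?thesis using assms by (simp add: frac_le)
next
  case False
  then have s: "s > 0" using assms by simp
  have "r powr q \<le> s powr q" using assms by (intro powr_mono2) auto
  also have "s powr q = (s powr p) powr (q/p) * 1 powr (1 - q/p)"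
    using assms by (simp add: powr_powr)
  also have "\<dots> \<le> q/p * s powr p + (1 - q/p) * 1"
    using assms s by (intro Youngs_inequality_0) auto
  finally have "r powr q / q \<le> (q/p * s powr p + (1 - q/p) * 1) / q"
    using assms by (intro divide_right_mono) auto
  also have "\<dots> = s powr p / p + (1 / q - 1 / p)" using assms by (simp add: field_simps)
  finally show ?thesis .
qed

text \<open>The logarithmic derivative depends on \<open>\<phi>\<close> only through the quotient
  \<open>\<bar>g\<bar> / \<phi>\<close>, which brings the equation into the form of
  \<open>young_exponents\<close>.\<close>

lemma ode_rhs_div:
  assumes "1 \<le> p t" "0 < \<phi> t"
  shows "inverse (\<phi> t) * ode_rhs p g \<phi> t = (\<bar>g t\<bar> / \<phi> t) powr p t / p t"
  using assms by (simp add: ode_rhs_def powr_divide powr_diff field_simps)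

lemma inverse_exponent_integrable:
  fixes p :: "real \<Rightarrow> real"
  assumes "p \<in> borel_measurable unit_leb" "\<And>t. t \<in> {0..1} \<Longrightarrow> 1 \<le> p t"
  shows "integrable unit_leb (\<lambda>t. 1 / p t)"
proof -
  have *: "AE t in unit_leb. norm (1 / p t) \<le> 1"
  proof (rule AE_I2)
    fix t assume "t \<in> space unit_leb"
    then have "1 \<le> p t" using assms by simp
    then show "norm (1 / p t) \<le> 1" by simp
  qed
  note [measurable] = assms(1)
  have "(\<lambda>t. 1 / p t) \<in> borel_measurable unit_leb" by measurable
  then show ?thesis
    by (rule finite_measure.integrable_const_bound[OF finite_measure_unit_leb *])
qed

lemma solves_ode_ln:
  assumes "solves_ode p g x \<phi>" "0 < x"
  shows "primitive (\<lambda>t. inverse (\<phi> t) * ode_rhs p g \<phi> t) (ln x) (\<lambda>t. ln (\<phi> t))"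
  by (rule primitive_chain[where G'=inverse and G=ln])
    (use assms in \<open>auto simp: solves_ode_def intro!: DERIV_ln\<close>)

lemma solves_ode_pos: "solves_ode p g x \<phi> \<Longrightarrow> 0 < x \<Longrightarrow> t \<in> {0..1} \<Longrightarrow> 0 < \<phi> t"
  using primitive_ge[of "ode_rhs p g \<phi>" x \<phi> t] by (simp add: solves_ode_def)

text \<open>\<open>ln \<psi>\<close> is compared with \<open>ln \<phi> + w\<close>, where
  \<open>w\<close> is the primitive of the loss in \<open>young_exponents\<close>. Since
  \<open>w\<close> is nonnegative, wherever \<open>ln \<psi>\<close> is larger also
  \<open>\<psi> > \<phi>\<close>, so
  \<open>\<bar>g\<bar> / \<psi> \<le> \<bar>f\<bar> / \<phi>\<close>, and Young's inequality bounds
  one logarithmic derivative by the other.\<close>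

lemma solves_ode_compare:
  assumes f: "solves_ode p f x \<phi>" and g: "solves_ode q g y \<psi>"
    and pm: "p \<in> borel_measurable unit_leb" "\<And>t. t \<in> {0..1} \<Longrightarrow> 1 \<le> p t"
    and qm: "q \<in> borel_measurable unit_leb" "\<And>t. t \<in> {0..1} \<Longrightarrow> 1 \<le> q t"
    and qp: "AE t in unit_leb. q t \<le> p t" and gf: "AE t in unit_leb. \<bar>g t\<bar> \<le> \<bar>f t\<bar>"
    and yx: "0 < y" "y \<le> x" and T: "T \<in> {0..1}"
  shows "\<psi> T \<le> exp (\<integral>t. 1 / q t - 1 / p t \<partial>unit_leb) * \<phi> T"
proof -
  \<comment> \<open>\<open>q \<le> p\<close> holds only almost everywhere; the maximum makes
    \<open>e\<close> nonnegative at every point, as \<open>primitive\<close> demands.\<close>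
  define e where "e = (\<lambda>t. max 0 (1 / q t - 1 / p t))"
  define w where "w = (\<lambda>T. 0 + (\<integral>t. indicator {0..T} t * e t \<partial>unit_leb))"
  have ie: "integrable unit_leb e" unfolding e_def
    by (intro integrable_max Bochner_Integration.integrable_diff inverse_exponent_integrable pm qm) simp
  have pw: "primitive e 0 w" unfolding w_def
    by (rule primitive_integral[OF ie]) (simp add: e_def)
  have ew: "(\<integral>t. e t \<partial>unit_leb) = (\<integral>t. 1 / q t - 1 / p t \<partial>unit_leb)"
  proof (rule integral_cong_AE)
    show "AE t in unit_leb. e t = 1 / q t - 1 / p t"
      using qp AE_in_unit_interval
    proof eventually_elim
      case (elim t)
      then have "1 \<le> q t" using qm by simp
      then have "1 / p t \<le> 1 / q t" using elim by (intro divide_left_mono) auto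
      then show ?case by (simp add: e_def)
    qed
    note [measurable] = pm(1) qm(1)
    show "e \<in> borel_measurable unit_leb" unfolding e_def by measurable
    show "(\<lambda>t. 1 / q t - 1 / p t) \<in> borel_measurable unit_leb" by measurable
  qed
  have x: "0 < x" using yx by simp
  have \<psi>: "primitive (\<lambda>t. inverse (\<psi> t) * ode_rhs q g \<psi> t) (ln y) (\<lambda>t. ln (\<psi> t))"
    by (rule solves_ode_ln[OF g yx(1)])
  have \<phi>: "primitive (\<lambda>t. inverse (\<phi> t) * ode_rhs p f \<phi> t + e t) (ln x + 0) (\<lambda>t. ln (\<phi> t) + w t)"
    by (rule primitive_add[OF solves_ode_ln[OF f x] pw])
  have "ln (\<psi> T) \<le> (ln (\<phi> T) + w T) + (\<integral>t. 0 \<partial>unit_leb)"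
  proof (rule primitive_compare[OF \<psi> \<phi> _ _ _ _ T])
    show "AE t in unit_leb. ln (\<phi> t) + w t < ln (\<psi> t) \<longrightarrow> inverse (\<psi> t) * ode_rhs q g \<psi> t
        \<le> inverse (\<phi> t) * ode_rhs p f \<phi> t + e t + 0"
      using qp gf AE_in_unit_interval
    proof eventually_elim
      case (elim t)
      then have t: "t \<in> {0..1}" by simp
      show ?case
      proof
        assume less: "ln (\<phi> t) + w t < ln (\<psi> t)"
        have pos: "0 < \<phi> t" "0 < \<psi> t"
          using solves_ode_pos[OF f x t] solves_ode_pos[OF g yx(1) t] by auto
        have "0 \<le> w t" using primitive_ge[OF pw t] .
        then have "ln (\<phi> t) < ln (\<psi> t)" using less by simp
        then have "\<phi> t < \<psi> t" using pos by simp
        then have "\<bar>g t\<bar> / \<psi> t \<le> \<bar>f t\<bar> / \<phi> t" using elim pos by (intro frac_le) auto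
        then have "(\<bar>g t\<bar> / \<psi> t) powr q t / q t \<le> (\<bar>f t\<bar> / \<phi> t) powr p t / p t + (1 / q t - 1 / p t)"
          using elim qm(2)[OF t] pos by (intro young_exponents) auto
        also have "\<dots> \<le> (\<bar>f t\<bar> / \<phi> t) powr p t / p t + e t" by (simp add: e_def)
        finally show "inverse (\<psi> t) * ode_rhs q g \<psi> t \<le> inverse (\<phi> t) * ode_rhs p f \<phi> t + e t + 0"
          using pos t pm(2) qm(2) by (simp add: ode_rhs_div)
      qed
    qed
  qed (use yx in simp_all)
  also have "\<dots> = ln (\<phi> T) + w T" by simp
  also have "w T \<le> w 1" using primitive_mono[OF pw, of T 1] T by simp
  also have "w 1 = (\<integral>t. e t \<partial>unit_leb)"
    unfolding w_def by (simp, rule Bochner_Integration.integral_cong) auto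
  finally have "ln (\<psi> T) \<le> ln (\<phi> T) + (\<integral>t. 1 / q t - 1 / p t \<partial>unit_leb)" using ew by simp
  then have "exp (ln (\<psi> T)) \<le> exp (ln (\<phi> T) + (\<integral>t. 1 / q t - 1 / p t \<partial>unit_leb))" by simp
  then show ?thesis
    using solves_ode_pos[OF f x T] solves_ode_pos[OF g yx(1) T] by (simp add: exp_add mult.commute)
qed

text \<open>With equal exponents the factor is \<open>exp 0\<close>. Applied in both directions this
  gives uniqueness.\<close>

lemma solves_ode_mono:
  assumes f: "solves_ode p f x \<phi>" and g: "solves_ode p g y \<psi>"
    and pm: "p \<in> borel_measurable unit_leb" "\<And>t. t \<in> {0..1} \<Longrightarrow> 1 \<le> p t"
    and gf: "AE t in unit_leb. \<bar>g t\<bar> \<le> \<bar>f t\<bar>"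
    and yx: "0 < y" "y \<le> x" and T: "T \<in> {0..1}"
  shows "\<psi> T \<le> \<phi> T"
  using solves_ode_compare[OF f g pm pm _ gf yx T] by simp

text \<open>The right-hand sides are compared along \<open>\<phi>\<close> alone: where
  \<open>\<psi> < \<phi>\<close>, antitonicity gives
  \<open>ode_rhs q g \<phi> t \<le> ode_rhs q g \<psi> t\<close>. So no Lipschitz constant enters,
  and in a limit over \<open>q\<close>, \<open>g\<close> and \<open>\<psi>\<close> the error is an
  integral along one fixed function.\<close>

lemma solves_ode_stable:
  assumes f: "solves_ode p f x \<phi>" and g: "solves_ode q g y \<psi>" and yx: "0 < y" "x \<le> y"
    and qm: "\<And>t. t \<in> {0..1} \<Longrightarrow> 1 \<le> q t"
    and i: "integrable unit_leb (\<lambda>t. ode_rhs p f \<phi> t - ode_rhs q g \<phi> t)"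
    and T: "T \<in> {0..1}"
  shows "\<phi> T \<le> \<psi> T + (\<integral>t. \<bar>ode_rhs p f \<phi> t - ode_rhs q g \<phi> t\<bar> \<partial>unit_leb)"
proof (rule primitive_compare[OF f[unfolded solves_ode_def] g[unfolded solves_ode_def] yx(2) _ _ _ T])
  show "integrable unit_leb (\<lambda>t. \<bar>ode_rhs p f \<phi> t - ode_rhs q g \<phi> t\<bar>)"
    by (rule integrable_abs[OF i])
  show "AE t in unit_leb. \<psi> t < \<phi> t \<longrightarrow> ode_rhs p f \<phi> t \<le> ode_rhs q g \<psi> t + \<bar>ode_rhs p f \<phi> t - ode_rhs q g \<phi> t\<bar>"
    using AE_in_unit_interval
  proof eventually_elim
    case (elim t)
    then have "ode_rhs q g \<phi> t \<le> ode_rhs q g \<psi> t" if "\<psi> t < \<phi> t"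
      using ode_rhs_antimono[of q t \<psi> \<phi> g] qm[of t] solves_ode_pos[OF g yx(1), of t] that by simp
    then show ?case by auto
  qed
qed simp

section \<open>Existence for bounded exponents\<close>

lemma powr_neg_bound:
  fixes x y p n :: real
  assumes "0 < x" "x \<le> y" "1 \<le> p" "p \<le> n"
  shows "y powr (1 - p) \<le> 1 + x powr (1 - n)"
proof -
  have "y powr (1 - p) \<le> x powr (1 - p)" using assms by (intro powr_mono2') auto
  \<comment> \<open>The largest power over \<open>1 \<le> p \<le> n\<close> occurs at
    \<open>p = n\<close> if \<open>x \<le> 1\<close> and at \<open>p = 1\<close> otherwise; the sum
    covers both.\<close>
  also have "\<dots> \<le> 1 + x powr (1 - n)"
  proof (cases "x \<le> 1")
    case True
    then have "x powr (1 - p) \<le> x powr (1 - n)" using assms by (intro powr_mono') auto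
    then show ?thesis by simp
  next
    case False
    then have "x powr (1 - p) \<le> x powr 0" using assms by (intro powr_mono) auto
    also have "x powr 0 = 1" using assms by simp
    also have "1 \<le> 1 + x powr (1 - n)" by simp
    finally show ?thesis .
  qed
  finally show ?thesis .
qed

text \<open>Convexity: \<open>y powr (1 - p)\<close> as a function of \<open>y\<close> lies above
  its tangent at \<open>x\<close>, whose slope is
  \<open>- x powr (1 - p) * ((p - 1) / x)\<close>.\<close>

lemma powr_neg_lipschitz:
  fixes x y p :: real
  assumes "0 < x" "x \<le> y" "1 \<le> p"
  shows "x powr (1 - p) - y powr (1 - p) \<le> x powr (1 - p) * ((p - 1) / x) * (y - x)"
proof -
  have "1 + (1 - p) * ln (y / x) \<le> exp ((1 - p) * ln (y / x))" by (rule exp_ge_add_one_self)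
  also have "\<dots> = (y / x) powr (1 - p)" using assms by (simp add: powr_def)
  finally have "1 - (y / x) powr (1 - p) \<le> (p - 1) * ln (y / x)" by (simp add: algebra_simps)
  also have "ln (y / x) \<le> y / x - 1" using assms by (intro ln_le_minus_one) auto
  finally have *: "1 - (y / x) powr (1 - p) \<le> (p - 1) * (y / x - 1)" using assms
    by (simp add: mult_left_mono)
  have "x powr (1 - p) - y powr (1 - p) = x powr (1 - p) * (1 - (y / x) powr (1 - p))"
    using assms by (simp add: powr_divide field_simps)
  also have "\<dots> \<le> x powr (1 - p) * ((p - 1) * (y / x - 1))"
    by (rule mult_left_mono[OF *]) simp
  also have "\<dots> = x powr (1 - p) * ((p - 1) / x) * (y - x)" using assms by (simp add: field_simps)
  finally show ?thesis .
qed

text \<open>Comparing \<open>ln (w + \<epsilon>)\<close> with the primitive of \<open>k\<close> replaces the usual iteration.\<close>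

lemma gronwall_zero:
  assumes w: "primitive v 0 w" and k: "integrable unit_leb k" "\<And>t. t \<in> {0..1} \<Longrightarrow> 0 \<le> k t"
    and v: "\<And>t. t \<in> {0..1} \<Longrightarrow> v t \<le> k t * w t" and T: "T \<in> {0..1}"
  shows "w T = 0"
proof -
  have w0: "0 \<le> w t" if "t \<in> {0..1}" for t using primitive_ge[OF w that] .
  define K where "K = (\<integral>t. k t \<partial>unit_leb)"
  have "w T \<le> \<epsilon> * exp K" if \<epsilon>: "\<epsilon> > 0" for \<epsilon>
  proof -
    have p: "primitive (\<lambda>t. inverse (w t + \<epsilon>) * v t) (ln (0 + \<epsilon>)) (\<lambda>t. ln (w t + \<epsilon>))"
      by (rule primitive_chain[OF w, where G'="\<lambda>y. inverse (y + \<epsilon>)" and G="\<lambda>y. ln (y + \<epsilon>)"])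
        (use \<epsilon> in \<open>auto intro!: derivative_eq_intros simp: divide_inverse\<close>)
    have z: "primitive (\<lambda>t. 0) (ln (0 + \<epsilon>)) (\<lambda>t. ln \<epsilon>)" by (simp add: primitive_def)
    have "ln (w T + \<epsilon>) \<le> ln \<epsilon> + (\<integral>t. k t \<partial>unit_leb)"
    proof (rule primitive_compare[OF p z order_refl k _ T])
      show "AE t in unit_leb. ln \<epsilon> < ln (w t + \<epsilon>) \<longrightarrow> inverse (w t + \<epsilon>) * v t \<le> 0 + k t"
        using AE_in_unit_interval
      proof eventually_elim
        case (elim t)
        then have t: "t \<in> {0..1}" by simp
        have "v t \<le> k t * (w t + \<epsilon>)"
          using v[OF t] mult_nonneg_nonneg[OF k(2)[OF t], of \<epsilon>] \<epsilon> unfolding distrib_left by linarith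
        then show ?case using w0[OF t] \<epsilon> by (simp add: field_simps)
      qed
    qed
    then have "exp (ln (w T + \<epsilon>)) \<le> exp (ln \<epsilon> + K)" by (simp add: K_def)
    then show ?thesis using \<epsilon> w0[OF T] by (simp add: exp_add)
  qed
  then have "w T \<le> e" if "e > 0" for e
    using that[THEN divide_pos_pos, of "exp K"] by (metis exp_gt_zero exp_not_eq_zero nonzero_eq_divide_eq)
  then have "w T \<le> 0" by (rule field_le_epsilon[of "w T" 0, simplified])
  with w0[OF T] show ?thesis by simp
qed


text \<open>\<open>p t \<le> n\<close> is demanded only where \<open>g\<close> does not vanish, so
  that functions cut to \<open>{p \<le> n}\<close> are covered for unbounded
  \<open>p\<close>.\<close>

lemma ode_rhs_bound:
  assumes "0 < x" "x \<le> \<phi> t" "1 \<le> p t" "g t \<noteq> 0 \<Longrightarrow> p t \<le> n"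
  shows "ode_rhs p g \<phi> t \<le> (1 + x powr (1 - n)) * \<bar>g t\<bar> powr p t"
proof (cases "g t = 0")
  case True
  then show ?thesis by (simp add: ode_rhs_def)
next
  case False
  have "\<bar>g t\<bar> powr p t / p t \<le> \<bar>g t\<bar> powr p t / 1" using assms by (intro divide_left_mono) auto
  moreover have "\<phi> t powr (1 - p t) \<le> 1 + x powr (1 - n)"
    by (rule powr_neg_bound) (use assms False in auto)
  ultimately have "ode_rhs p g \<phi> t \<le> \<bar>g t\<bar> powr p t * (1 + x powr (1 - n))"
    unfolding ode_rhs_def by (intro mult_mono) auto
  then show ?thesis by (simp add: mult.commute)
qed

lemma ode_rhs_integrable:
  assumes pm: "p \<in> borel_measurable unit_leb" "\<And>t. t \<in> {0..1} \<Longrightarrow> 1 \<le> p t"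
    and gm: "g \<in> borel_measurable unit_leb" and bnd: "\<And>t. t \<in> {0..1} \<Longrightarrow> g t \<noteq> 0 \<Longrightarrow> p t \<le> n"
    and i: "integrable unit_leb (\<lambda>t. \<bar>g t\<bar> powr p t)" and x: "0 < x"
    and ym: "y \<in> borel_measurable unit_leb" and y: "\<And>t. t \<in> {0..1} \<Longrightarrow> x \<le> y t"
  shows "integrable unit_leb (ode_rhs p g y)"
proof (rule Bochner_Integration.integrable_bound)
  show "integrable unit_leb (\<lambda>t. (1 + x powr (1 - n)) * \<bar>g t\<bar> powr p t)"
    by (rule integrable_mult_right[OF i])
  show "AE t in unit_leb. norm (ode_rhs p g y t) \<le> norm ((1 + x powr (1 - n)) * \<bar>g t\<bar> powr p t)"
  proof (rule AE_I2)
    fix t assume "t \<in> space unit_leb"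
    then have t: "t \<in> {0..1}" by simp
    have "ode_rhs p g y t \<le> (1 + x powr (1 - n)) * \<bar>g t\<bar> powr p t"
      by (rule ode_rhs_bound) (use x y[OF t] pm(2)[OF t] bnd[OF t] in auto)
    then show "norm (ode_rhs p g y t) \<le> norm ((1 + x powr (1 - n)) * \<bar>g t\<bar> powr p t)"
      using ode_rhs_nonneg[of p t g y] pm(2)[OF t] by simp
  qed
qed (rule ode_rhs_measurable[OF pm(1) gm ym])

text \<open>The integral operator \<open>P\<close> reverses order. So the iterates of
  \<open>P \<circ> P\<close> from the smallest candidate \<open>\<lambda>_. x\<close> increase to
  \<open>L\<close>, their images under \<open>P\<close> decrease to \<open>U\<close>, and
  \<open>P L = U\<close>, \<open>P U = L\<close>, \<open>L \<le> U\<close>. The difference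
  \<open>U - L\<close> vanishes by Gronwall's lemma, since above \<open>x\<close> the right-hand
  side is Lipschitz with an integrable constant. This avoids a contraction argument on short
  intervals.\<close>

lemma solves_ode_exists:
  fixes n :: real
  assumes pm: "p \<in> borel_measurable unit_leb" "\<And>t. t \<in> {0..1} \<Longrightarrow> 1 \<le> p t"
    and gm: "g \<in> borel_measurable unit_leb" and bnd: "\<And>t. t \<in> {0..1} \<Longrightarrow> g t \<noteq> 0 \<Longrightarrow> p t \<le> n"
    and i: "integrable unit_leb (\<lambda>t. \<bar>g t\<bar> powr p t)" and x: "0 < x"
  shows "\<exists>\<phi>. solves_ode p g x \<phi>"
proof -
  define F where "F = (\<lambda>y. ode_rhs p g y)"
  define P where "P = (\<lambda>y T. x + (\<integral>t. indicator {0..T} t * F y t \<partial>unit_leb))"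
  define adm where "adm = (\<lambda>y::real\<Rightarrow>real. y \<in> borel_measurable unit_leb \<and> (\<forall>t\<in>{0..1}. x \<le> y t))"
  have Fi: "integrable unit_leb (F y)" if "adm y" for y
    unfolding F_def using that
    by (intro ode_rhs_integrable[OF pm gm bnd i x]) (auto simp: adm_def)
  have F0: "0 \<le> F y t" if "t \<in> {0..1}" for t y unfolding F_def using ode_rhs_nonneg pm(2)[OF that] by blast
  have Pp: "primitive (F y) x (P y)" if "adm y" for y
    unfolding P_def by (rule primitive_integral[OF Fi[OF that] F0])
  have adm: "adm (P y)" if "adm y" for y
    using primitive_measurable[OF Pp[OF that]] primitive_ge[OF Pp[OF that]] by (simp add: adm_def)
  have anti: "P z T \<le> P y T" if "adm y" "adm z" "\<And>t. t \<in> {0..1} \<Longrightarrow> y t \<le> z t" for y z T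
  proof -
    have "(\<integral>t. indicator {0..T} t * F z t \<partial>unit_leb) \<le> (\<integral>t. indicator {0..T} t * F y t \<partial>unit_leb)"
    proof (rule integral_mono)
      fix t assume "t \<in> space unit_leb"
      then have t: "t \<in> {0..1}" by simp
      have "0 < y t" using that(1) t x by (force simp: adm_def)
      then have "F z t \<le> F y t" unfolding F_def
        by (intro ode_rhs_antimono pm(2) that t)
      then show "indicator {0..T} t * F z t \<le> indicator {0..T} t * F y t" by (simp add: mult_left_mono)
    qed (intro integrable_indicator_times Fi that, simp)+
    then show ?thesis by (simp add: P_def)
  qed
  have lim: "(\<lambda>k. P (y k) T) \<longlonglongrightarrow> P z T"
    if "\<And>k. adm (y k)" "adm z" "\<And>t. t \<in> {0..1} \<Longrightarrow> (\<lambda>k. y k t) \<longlonglongrightarrow> z t" for y z T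
    unfolding P_def
  \<comment> \<open>All admissible functions are at least \<open>x\<close>, so
    \<open>ode_rhs_bound\<close> gives a majorant that does not depend on \<open>k\<close>.\<close>
  proof (intro tendsto_add tendsto_const integral_dominated_convergence[where w="\<lambda>t. (1 + x powr (1 - n)) * \<bar>g t\<bar> powr p t"])
    show "integrable unit_leb (\<lambda>t. (1 + x powr (1 - n)) * \<bar>g t\<bar> powr p t)"
      by (rule integrable_mult_right[OF i])
    show "(\<lambda>t. indicator {0..T} t * F z t) \<in> borel_measurable unit_leb"
      by (rule borel_measurable_integrable, rule integrable_indicator_times[OF Fi[OF that(2)]]) simp
    show "(\<lambda>t. indicator {0..T} t * F (y k) t) \<in> borel_measurable unit_leb" for k
      by (rule borel_measurable_integrable, rule integrable_indicator_times[OF Fi[OF that(1)]]) simp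
    show "AE t in unit_leb. (\<lambda>k. indicator {0..T} t * F (y k) t) \<longlonglongrightarrow> indicator {0..T} t * F z t"
    proof (rule AE_I2)
      fix t assume "t \<in> space unit_leb"
      then have t: "t \<in> {0..1}" by simp
      have "0 < z t" using that(2) t x by (force simp: adm_def)
      then show "(\<lambda>k. indicator {0..T} t * F (y k) t) \<longlonglongrightarrow> indicator {0..T} t * F z t"
        unfolding F_def ode_rhs_def
        by (intro tendsto_mult tendsto_const tendsto_powr that t) simp
    qed
    show "AE t in unit_leb. norm (indicator {0..T} t * F (y k) t) \<le> (1 + x powr (1 - n)) * \<bar>g t\<bar> powr p t" for k
    proof (rule AE_I2)
      fix t assume "t \<in> space unit_leb"
      then have t: "t \<in> {0..1}" by simp
      have "F (y k) t \<le> (1 + x powr (1 - n)) * \<bar>g t\<bar> powr p t" unfolding F_def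
        by (rule ode_rhs_bound) (use x that(1)[of k] pm(2)[OF t] bnd[OF t] t in \<open>auto simp: adm_def\<close>)
      then show "norm (indicator {0..T} t * F (y k) t) \<le> (1 + x powr (1 - n)) * \<bar>g t\<bar> powr p t"
        using F0[OF t, of "y k"] by (auto simp: indicator_def)
    qed
  qed
  define l where "l = (\<lambda>k. ((P \<circ> P) ^^ k) (\<lambda>_. x))"
  define u where "u = (\<lambda>k. P (l k))"
  have l0: "l 0 = (\<lambda>_. x)" and lS: "l (Suc k) = P (u k)" for k by (simp_all add: l_def u_def)
  have uk: "u k = P (l k)" for k by (simp add: u_def)
  have al: "adm (l k)" for k
  proof (induction k)
    case 0
    show ?case by (simp add: l0 adm_def)
  next
    case (Suc k)
    then show ?case unfolding lS u_def by (intro adm)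
  qed
  have au: "adm (u k)" for k unfolding u_def by (intro adm al)
  have lu: "l k t \<le> u k t" if "t \<in> {0..1}" for k t
    using that
  proof (induction k arbitrary: t)
    case 0
    then show ?case using au[of 0] by (simp add: l0 adm_def)
  next
    case (Suc k)
    have *: "l (Suc k) s \<le> u k s" if "s \<in> {0..1}" for s
      unfolding lS unfolding uk[of k] by (rule anti[OF al adm[OF al]]) (use Suc.IH in \<open>simp add: uk\<close>)
    show ?case unfolding lS unfolding uk[of "Suc k"]
      by (rule anti[OF al au *])
  qed
  have mono: "l k t \<le> l (Suc k) t" if "t \<in> {0..1}" for k t
    using that
  proof (induction k arbitrary: t)
    case 0
    then show ?case using al[of 1] by (simp add: l0 adm_def)
  next
    case (Suc k)
    have "u (Suc k) s \<le> u k s" if "s \<in> {0..1}" for s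
      unfolding u_def by (rule anti[OF al al Suc.IH])
    then show ?case unfolding lS by (intro anti au)
  qed
  have umono: "u (Suc k) t \<le> u k t" if "t \<in> {0..1}" for k t
    unfolding u_def by (rule anti[OF al al mono])
  have u_le: "u k t \<le> u 0 t" if "t \<in> {0..1}" for k t
  proof (induction k)
    case (Suc k)
    then show ?case using umono[OF that, of k] by linarith
  qed simp
  define L where "L = (\<lambda>t. lim (\<lambda>k. l k t))"
  have L: "(\<lambda>k. l k t) \<longlonglongrightarrow> L t" if t: "t \<in> {0..1}" for t
  proof -
    have "incseq (\<lambda>k. l k t)" using mono[OF t] by (rule incseq_SucI)
    moreover have "l k t \<le> u 0 t" for k using lu[OF t, of k] u_le[OF t, of k] by linarith
    ultimately have "convergent (\<lambda>k. l k t)"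
      using incseq_convergent[of "\<lambda>k. l k t" "u 0 t"] unfolding convergent_def by metis
    then show ?thesis unfolding L_def by (simp add: convergent_LIMSEQ_iff)
  qed
  have aL: "adm L"
    unfolding adm_def
  proof
    show "L \<in> borel_measurable unit_leb"
      by (rule borel_measurable_LIMSEQ_real[of _ l]) (use L al in \<open>auto simp: adm_def\<close>)
    show "\<forall>t\<in>{0..1}. x \<le> L t"
    proof
      fix t :: real assume t: "t \<in> {0..1}"
      then have "x \<le> l k t" for k using al[of k] by (simp add: adm_def)
      then show "x \<le> L t" using LIMSEQ_le_const[OF L[OF t]] by blast
    qed
  qed
  define U where "U = P L"
  have aU: "adm U" unfolding U_def by (rule adm[OF aL])
  have U: "(\<lambda>k. u k t) \<longlonglongrightarrow> U t" for t
    unfolding u_def U_def by (rule lim[OF al aL L])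
  have PU: "P U t = L t" if "t \<in> {0..1}" for t
  proof (rule LIMSEQ_unique)
    show "(\<lambda>k. l (Suc k) t) \<longlonglongrightarrow> P U t" unfolding lS by (rule lim[OF au aU U])
    show "(\<lambda>k. l (Suc k) t) \<longlonglongrightarrow> L t" by (rule LIMSEQ_Suc[OF L[OF that]])
  qed
  have LU: "L t \<le> U t" if "t \<in> {0..1}" for t
    by (rule LIMSEQ_le[OF L[OF that] U]) (use lu[OF that] in auto)
  \<comment> \<open>\<open>U = P L\<close> and \<open>L = P U\<close> turn the difference of the
    limits into a primitive of the difference of the right-hand sides.\<close>
  have pw: "primitive (\<lambda>t. F L t - F U t) 0 (\<lambda>t. U t - L t)"
    unfolding primitive_def
  proof (intro conjI ballI)
    show "integrable unit_leb (\<lambda>t. F L t - F U t)"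
      by (intro Bochner_Integration.integrable_diff Fi aL aU)
    show "0 \<le> F L t - F U t" if "t \<in> {0..1}" for t
      using ode_rhs_antimono[of p t L U g] LU[OF that] pm(2)[OF that] that x aL by (force simp: F_def adm_def)
    show "U T - L T = 0 + (\<integral>t. indicator {0..T} t * (F L t - F U t) \<partial>unit_leb)" if T: "T \<in> {0..1}" for T
    proof -
      have "U T - L T = P L T - P U T" using PU[OF T] by (simp add: U_def)
      also have "\<dots> = (\<integral>t. indicator {0..T} t * F L t \<partial>unit_leb) - (\<integral>t. indicator {0..T} t * F U t \<partial>unit_leb)"
        by (simp add: P_def)
      also have "\<dots> = (\<integral>t. indicator {0..T} t * F L t - indicator {0..T} t * F U t \<partial>unit_leb)"
        by (rule Bochner_Integration.integral_diff[symmetric]; rule integrable_indicator_times[OF Fi]) (simp_all add: aL aU)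
      finally show ?thesis by (simp add: right_diff_distrib)
    qed
  qed
  define B where "B = 1 + x powr (1 - n)"
  \<comment> \<open>\<open>B\<close> bounds the power and \<open>\<bar>n\<bar> / x\<close> the
    factor \<open>(p - 1) / L\<close> of the tangent estimate. The absolute value keeps
    \<open>k\<close> nonnegative, as \<open>n\<close> may be negative when \<open>g\<close> vanishes
    on \<open>{0..1}\<close>.\<close>
  define k where "k = (\<lambda>t. B * (\<bar>n\<bar> / x) * \<bar>g t\<bar> powr p t)"
  have eq: "U t - L t = 0" if t: "t \<in> {0..1}" for t
  proof (rule gronwall_zero[OF pw _ _ _ t])
    show "integrable unit_leb k" unfolding k_def by (rule integrable_mult_right[OF i])
    show "0 \<le> k t" for t unfolding k_def B_def using x by simp
    fix t :: real assume t: "t \<in> {0..1}"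
    show "F L t - F U t \<le> k t * (U t - L t)"
    proof (cases "g t = 0")
      case True
      then show ?thesis by (simp add: F_def ode_rhs_def k_def)
    next
      case False
      have Lx: "x \<le> L t" using aL t by (simp add: adm_def)
      have pn: "1 \<le> p t" "p t \<le> n" using pm(2)[OF t] bnd[OF t False] by auto
      have "L t powr (1 - p t) - U t powr (1 - p t) \<le> L t powr (1 - p t) * ((p t - 1) / L t) * (U t - L t)"
        by (rule powr_neg_lipschitz) (use Lx x LU[OF t] pn in auto)
      also have "\<dots> \<le> B * (\<bar>n\<bar> / x) * (U t - L t)"
      proof (intro mult_right_mono mult_mono)
        show "L t powr (1 - p t) \<le> B" unfolding B_def by (rule powr_neg_bound) (use Lx x pn in auto)
        show "(p t - 1) / L t \<le> \<bar>n\<bar> / x" by (rule frac_le) (use Lx x pn in auto)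
      qed (use Lx x pn LU[OF t] in \<open>auto simp: B_def\<close>)
      finally have *: "L t powr (1 - p t) - U t powr (1 - p t) \<le> B * (\<bar>n\<bar> / x) * (U t - L t)" .
      have "F L t - F U t = \<bar>g t\<bar> powr p t / p t * (L t powr (1 - p t) - U t powr (1 - p t))"
        by (simp add: F_def ode_rhs_def right_diff_distrib)
      also have "\<dots> \<le> \<bar>g t\<bar> powr p t / 1 * (B * (\<bar>n\<bar> / x) * (U t - L t))"
        by (intro mult_mono[OF _ *] divide_left_mono)
          (use pn powr_mono2'[of "1 - p t" "L t" "U t"] Lx x LU[OF t] in auto)
      finally show ?thesis by (simp add: k_def mult_ac)
    qed
  qed
  have "primitive (F U) x U"
    by (rule primitive_cong[OF Pp[OF aU]]) (use PU eq in auto)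
  then show ?thesis unfolding solves_ode_def F_def by blast
qed

section \<open>Norms on nonnegative functions\<close>

lemma ennpowr_ennreal [simp]: "0 \<le> x \<Longrightarrow> ennpowr (ennreal x) r = ennreal (x powr r)"
  by (simp add: ennpowr_def)

lemma ennpowr_top [simp]: "ennpowr top r = top"
  by (simp add: ennpowr_def)

lemma ennpowr_0 [simp]: "ennpowr 0 r = 0"
  by (simp add: ennpowr_def)

lemma ennpowr_one [simp]: "ennpowr a 1 = a"
  by (cases a) auto

lemma ennpowr_mono: "a \<le> b \<Longrightarrow> 0 < r \<Longrightarrow> ennpowr a r \<le> ennpowr b r"
  by (cases a; cases b) (auto simp: top_unique intro!: ennreal_leI powr_mono2)

lemma ennpowr_inverse [simp]: "r \<noteq> 0 \<Longrightarrow> ennpowr (ennpowr a r) (1 / r) = a"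
  by (cases a) (auto simp: powr_powr)

lemma ennpowr_inverse' [simp]: "r \<noteq> 0 \<Longrightarrow> ennpowr (ennpowr a (1 / r)) r = a"
  using ennpowr_inverse[of "1 / r" a] by simp

lemma ennpowr_mult: "0 < r \<Longrightarrow> ennpowr (a * b) r = ennpowr a r * ennpowr b r"
  by (cases a; cases b)
    (auto simp: powr_mult ennreal_mult_top ennreal_top_mult simp flip: ennreal_mult)

lemma ennpowr_le_iff: "0 < r \<Longrightarrow> ennpowr a r \<le> b \<longleftrightarrow> a \<le> ennpowr b (1 / r)"
  using ennpowr_mono[of "ennpowr a r" b "1 / r"] ennpowr_mono[of a "ennpowr b (1 / r)" r] by auto

text \<open>\<open>ennpowr_le_iff\<close> is a Galois connection between the powers \<open>r\<close>
  and \<open>1 / r\<close>, which yields arbitrary suprema without a continuity argument.\<close>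

lemma ennpowr_SUP:
  assumes "0 < r"
  shows "ennpowr (SUP i\<in>I. f i) r = (SUP i\<in>I. ennpowr (f i) r)"
proof (rule antisym)
  show "ennpowr (SUP i\<in>I. f i) r \<le> (SUP i\<in>I. ennpowr (f i) r)"
    unfolding ennpowr_le_iff[OF assms]
    by (rule SUP_least, subst ennpowr_le_iff[OF assms, symmetric]) (rule SUP_upper)
  show "(SUP i\<in>I. ennpowr (f i) r) \<le> ennpowr (SUP i\<in>I. f i) r"
    by (rule SUP_least) (intro ennpowr_mono SUP_upper assms)
qed

lemma ennpowr_measurable [measurable (raw)]:
  "h \<in> borel_measurable M \<Longrightarrow> (\<lambda>t. ennpowr (h t) r) \<in> borel_measurable M"
proof -
  assume [measurable]: "h \<in> borel_measurable M"
  have "(\<lambda>t. if h t = top then top else ennreal (enn2real (h t) powr r)) \<in> borel_measurable M"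
    by (rule measurable_If) measurable
  then show ?thesis by (simp add: ennpowr_def)
qed

text \<open>Minkowski's inequality before integration: \<open>(u + v) / (A + B)\<close> is the
  convex combination of \<open>u / A\<close> and \<open>v / B\<close> with weights
  \<open>A / (A + B)\<close> and \<open>B / (A + B)\<close>. With \<open>A\<close> and
  \<open>B\<close> as bounds for the two norms no conjugate exponent appears, so
  \<open>q = 1\<close> is no special case.\<close>

lemma powr_add_le:
  fixes u v A B q :: real
  assumes q: "1 \<le> q" and AB: "0 < A" "0 < B" and uv: "0 \<le> u" "0 \<le> v"
  shows "(u + v) powr q \<le> (A + B) powr q * (A / (A + B) * (u / A) powr q + B / (A + B) * (v / B) powr q)"
proof -
  \<comment> \<open>For the case of one vanishing summand; the convexity argument below is run for
    positive \<open>u\<close> and \<open>v\<close>.\<close>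
  have single: "w powr q \<le> (A + B) powr q * (C / (A + B) * (w / C) powr q)"
    if C: "0 < C" "C \<le> A + B" and w: "0 \<le> w" for C w
  proof -
    have "C powr (q - 1) \<le> (A + B) powr (q - 1)" using q C by (intro powr_mono2) auto
    then have "1 \<le> (A + B) powr (q - 1) / C powr (q - 1)" using C by simp
    also have "\<dots> = (A + B) powr q * (C / (A + B)) / C powr q" using C AB by (simp add: powr_diff field_simps)
    finally have "w powr q * 1 \<le> w powr q * ((A + B) powr q * (C / (A + B)) / C powr q)"
      by (intro mult_left_mono) auto
    then show ?thesis using C w by (simp add: powr_divide mult_ac)
  qed
  consider "u = 0" | "v = 0" | "0 < u" "0 < v" using uv by linarith
  then show ?thesis
  proof cases
    case 1 then show ?thesis using single[of B v] AB uv by simp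
  next
    case 2 then show ?thesis using single[of A u] AB uv by simp
  next
    case 3
    have "((A / (A + B)) * (u / A) + (B / (A + B)) * (v / B)) powr q
        \<le> (A / (A + B)) * (u / A) powr q + (B / (A + B)) * (v / B) powr q"
      using convex_onD[OF powr_convex[OF q], of "B / (A + B)" "u / A" "v / B"] AB 3
      by (simp add: field_simps)
    moreover have "(A / (A + B)) * (u / A) + (B / (A + B)) * (v / B) = (u + v) / (A + B)"
      using AB by (simp add: add_divide_distrib)
    ultimately have "(u + v) powr q / (A + B) powr q
        \<le> (A / (A + B)) * (u / A) powr q + (B / (A + B)) * (v / B) powr q"
      using AB uv by (simp add: powr_divide)
    then show ?thesis using AB by (simp add: field_simps)
  qed
qed

text \<open>Summing or integrating the first part and inserting the bounds \<open>A powr q\<close>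
  and \<open>B powr q\<close> returns \<open>(A + B) powr q\<close> by the second. Both the integral
  and the two-term sum in \<open>boxplus\<close> are handled in this way.\<close>

lemma ennpowr_add_le:
  fixes A B q :: real
  assumes q: "1 \<le> q" and AB: "0 < A" "0 < B"
  defines "cA \<equiv> (A + B) powr q * (A / (A + B)) / A powr q"
    and "cB \<equiv> (A + B) powr q * (B / (A + B)) / B powr q"
  shows "ennpowr (u + v) q \<le> ennreal cA * ennpowr u q + ennreal cB * ennpowr v q"
    and "ennreal cA * ennreal (A powr q) + ennreal cB * ennreal (B powr q) = ennreal ((A + B) powr q)"
proof -
  have c0: "0 < cA" "0 < cB" using AB unfolding cA_def cB_def by auto
  show "ennpowr (u + v) q \<le> ennreal cA * ennpowr u q + ennreal cB * ennpowr v q"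
  proof (cases "u = top \<or> v = top")
    case True
    then show ?thesis using c0 by (auto simp: ennreal_mult_top)
  next
    case False
    then obtain a b where ab: "u = ennreal a" "v = ennreal b" "0 \<le> a" "0 \<le> b"
      by (metis ennreal_cases)
    have "(a + b) powr q \<le> cA * a powr q + cB * b powr q"
      using powr_add_le[OF q AB ab(3,4)] AB ab by (simp add: cA_def cB_def powr_divide distrib_left mult_ac)
    then have "ennreal ((a + b) powr q) \<le> ennreal (cA * a powr q + cB * b powr q)" by (rule ennreal_leI)
    also have "\<dots> = ennreal cA * ennreal (a powr q) + ennreal cB * ennreal (b powr q)"
      using c0 by (simp add: ennreal_mult)
    finally show ?thesis using ab by (simp flip: ennreal_plus)
  qed
  have "cA * A powr q + cB * B powr q = (A + B) powr q * (A / (A + B) + B / (A + B))"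
    using AB by (simp add: cA_def cB_def distrib_left)
  also have "A / (A + B) + B / (A + B) = 1" using AB by (simp flip: add_divide_distrib)
  finally have "cA * A powr q + cB * B powr q = (A + B) powr q" by simp
  then show "ennreal cA * ennreal (A powr q) + ennreal cB * ennreal (B powr q) = ennreal ((A + B) powr q)"
    using c0 by (simp flip: ennreal_mult ennreal_plus)
qed

text \<open>Reduces a triangle inequality to upper bounds \<open>A\<close> and \<open>B\<close> for
  the two norms. The bounds used exceed the norms by \<open>e / 2\<close>, so they are positive even
  when a norm is zero.\<close>

lemma ennpowr_triangleI:
  assumes q: "1 \<le> q"
    and *: "\<And>A B. 0 < A \<Longrightarrow> 0 < B \<Longrightarrow> U \<le> ennreal (A powr q) \<Longrightarrow> V \<le> ennreal (B powr q)
      \<Longrightarrow> W \<le> ennreal ((A + B) powr q)"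
  shows "ennpowr W (1 / q) \<le> ennpowr U (1 / q) + ennpowr V (1 / q)"
proof (cases "ennpowr U (1 / q) = top \<or> ennpowr V (1 / q) = top")
  case True
  then show ?thesis by auto
next
  case False
  then obtain a b where ab: "ennpowr U (1 / q) = ennreal a" "ennpowr V (1 / q) = ennreal b" "0 \<le> a" "0 \<le> b"
    by (metis ennreal_cases)
  have U: "U = ennreal (a powr q)" and V: "V = ennreal (b powr q)"
    using ennpowr_inverse'[of q U] ennpowr_inverse'[of q V] ab q by auto
  show ?thesis
  proof (rule ennreal_le_epsilon)
    fix e :: real assume e: "0 < e"
    have "W \<le> ennreal (((a + e/2) + (b + e/2)) powr q)"
      by (rule *) (use ab e q in \<open>auto simp: U V intro!: ennreal_leI powr_mono2\<close>)
    then have "ennpowr W (1 / q) \<le> ennpowr (ennreal (((a + e/2) + (b + e/2)) powr q)) (1 / q)"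
      using q by (intro ennpowr_mono) auto
    also have "\<dots> = ennreal (a + b + e)" using ab e q by (simp add: powr_powr)
    also have "\<dots> = ennpowr U (1 / q) + ennpowr V (1 / q) + ennreal e"
      using ab e by simp
    finally show "ennpowr W (1 / q) \<le> ennpowr U (1 / q) + ennpowr V (1 / q) + ennreal e" .
  qed
qed

lemma Minkowski_nn_integral:
  assumes q: "1 \<le> q" and [measurable]: "f \<in> borel_measurable M" "g \<in> borel_measurable M"
  shows "ennpowr (\<integral>\<^sup>+t. ennpowr (f t + g t) q \<partial>M) (1 / q)
    \<le> ennpowr (\<integral>\<^sup>+t. ennpowr (f t) q \<partial>M) (1 / q) + ennpowr (\<integral>\<^sup>+t. ennpowr (g t) q \<partial>M) (1 / q)"
proof (rule ennpowr_triangleI[OF q])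
  fix A B :: real
  assume AB: "0 < A" "0 < B" and f: "(\<integral>\<^sup>+t. ennpowr (f t) q \<partial>M) \<le> ennreal (A powr q)"
    and g: "(\<integral>\<^sup>+t. ennpowr (g t) q \<partial>M) \<le> ennreal (B powr q)"
  let ?cA = "ennreal ((A + B) powr q * (A / (A + B)) / A powr q)"
  let ?cB = "ennreal ((A + B) powr q * (B / (A + B)) / B powr q)"
  have "(\<integral>\<^sup>+t. ennpowr (f t + g t) q \<partial>M) \<le> (\<integral>\<^sup>+t. ?cA * ennpowr (f t) q + ?cB * ennpowr (g t) q \<partial>M)"
    by (intro nn_integral_mono ennpowr_add_le q AB)
  also have "\<dots> = ?cA * (\<integral>\<^sup>+t. ennpowr (f t) q \<partial>M) + ?cB * (\<integral>\<^sup>+t. ennpowr (g t) q \<partial>M)"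
    by (simp add: nn_integral_add nn_integral_cmult)
  also have "\<dots> \<le> ?cA * ennreal (A powr q) + ?cB * ennreal (B powr q)"
    by (intro add_mono mult_left_mono f g) auto
  also have "\<dots> = ennreal ((A + B) powr q)" by (rule ennpowr_add_le(2)[OF q AB])
  finally show "(\<integral>\<^sup>+t. ennpowr (f t + g t) q \<partial>M) \<le> ennreal ((A + B) powr q)" .
qed

text \<open>Minkowski's inequality on a space of two points.\<close>

lemma boxplus_triangle:
  assumes q: "1 \<le> q"
  shows "boxplus q (a + c) (b + d) \<le> boxplus q a b + boxplus q c d"
  unfolding boxplus_def
proof (rule ennpowr_triangleI[OF q])
  fix A B :: real
  assume AB: "0 < A" "0 < B" and f: "ennpowr a q + ennpowr b q \<le> ennreal (A powr q)"
    and g: "ennpowr c q + ennpowr d q \<le> ennreal (B powr q)"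
  let ?cA = "ennreal ((A + B) powr q * (A / (A + B)) / A powr q)"
  let ?cB = "ennreal ((A + B) powr q * (B / (A + B)) / B powr q)"
  have "ennpowr (a + c) q + ennpowr (b + d) q
      \<le> (?cA * ennpowr a q + ?cB * ennpowr c q) + (?cA * ennpowr b q + ?cB * ennpowr d q)"
    by (intro add_mono ennpowr_add_le q AB)
  also have "\<dots> = ?cA * (ennpowr a q + ennpowr b q) + ?cB * (ennpowr c q + ennpowr d q)"
    by (simp add: distrib_left add_ac)
  also have "\<dots> \<le> ?cA * ennreal (A powr q) + ?cB * ennreal (B powr q)"
    by (intro add_mono mult_left_mono f g) auto
  also have "\<dots> = ennreal ((A + B) powr q)" by (rule ennpowr_add_le(2)[OF q AB])
  finally show "ennpowr (a + c) q + ennpowr (b + d) q \<le> ennreal ((A + B) powr q)" .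
qed

lemma boxplus_mono: "1 \<le> q \<Longrightarrow> a \<le> c \<Longrightarrow> b \<le> d \<Longrightarrow> boxplus q a b \<le> boxplus q c d"
  unfolding boxplus_def by (intro ennpowr_mono add_mono) auto

lemma boxplus_0 [simp]: "1 \<le> q \<Longrightarrow> boxplus q 0 b = b" "1 \<le> q \<Longrightarrow> boxplus q b 0 = b"
  by (simp_all add: boxplus_def)

lemma boxplus_cmult: "1 \<le> q \<Longrightarrow> boxplus q (c * a) (c * b) = c * boxplus q a b"
  by (simp add: boxplus_def ennpowr_mult flip: distrib_left)

lemma boxplus_SUP:
  assumes "1 \<le> q" "incseq a" "incseq b"
  shows "boxplus q (SUP k. a k) (SUP k. b k) = (SUP k. boxplus q (a k) (b k))"
proof -
  have "incseq (\<lambda>k. ennpowr (a k) q)" "incseq (\<lambda>k. ennpowr (b k) q)"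
    using assms by (auto simp: incseq_def intro!: ennpowr_mono)
  then have "(SUP k. ennpowr (a k) q) + (SUP k. ennpowr (b k) q) = (SUP k. ennpowr (a k) q + ennpowr (b k) q)"
    by (rule ennreal_SUP_add[symmetric])
  then show ?thesis using assms by (simp add: boxplus_def ennpowr_SUP)
qed

section \<open>Semi-norms of nonnegative extended functions\<close>

definition Lp_norm :: "real \<Rightarrow> real set \<Rightarrow> (real \<Rightarrow> ennreal) \<Rightarrow> ennreal" where
  "Lp_norm q K h = ennpowr (\<integral>\<^sup>+t. ennpowr (h t * indicator K t) q \<partial>unit_leb) (1 / q)"

text \<open>\<open>simple_norm\<close> for functions with values in \<open>ennreal\<close>, which
  admits suprema and limits inferior inside. The initial value \<open>a\<close> is the norm
  accumulated so far in an induction over the list, and it plays the role of the initial value of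
  the equation.\<close>

definition fold_norm :: "ennreal \<Rightarrow> simple_seminorm \<Rightarrow> (real \<Rightarrow> ennreal) \<Rightarrow> ennreal" where
  "fold_norm a N h = foldl (\<lambda>a (K, q). boxplus q a (Lp_norm q K h)) a N"

lemma fold_norm_simps [simp]:
  "fold_norm a [] h = a"
  "fold_norm a ((K, q) # N) h = fold_norm (boxplus q a (Lp_norm q K h)) N h"
  by (simp_all add: fold_norm_def)

text \<open>Unlike \<open>standard_form\<close> it holds for the empty list, hence for every tail,
  so it serves inductions over the list.\<close>

definition admissible :: "simple_seminorm \<Rightarrow> bool" where
  "admissible N \<longleftrightarrow> (\<forall>(K, q)\<in>set N. compact K \<and> 1 \<le> q)"

lemma admissible_simps [simp]:
  "admissible []" "admissible ((K, q) # N) \<longleftrightarrow> compact K \<and> 1 \<le> q \<and> admissible N"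
  by (auto simp: admissible_def)

lemma indicator_compact_measurable [measurable]:
  "compact K \<Longrightarrow> (indicator K :: real \<Rightarrow> ennreal) \<in> borel_measurable unit_leb"
  by (rule indicator_measurable_unit_leb) (simp add: borel_compact)

lemma Lp_norm_mono:
  assumes "1 \<le> q" "AE t in unit_leb. h t \<le> h' t"
  shows "Lp_norm q K h \<le> Lp_norm q K h'"
  unfolding Lp_norm_def
proof (intro ennpowr_mono nn_integral_mono_AE)
  show "AE t in unit_leb. ennpowr (h t * indicator K t) q \<le> ennpowr (h' t * indicator K t) q"
    using assms(2) by eventually_elim (use assms(1) in \<open>auto intro!: ennpowr_mono mult_right_mono\<close>)
qed (use assms in auto)

lemma Lp_norm_triangle:
  assumes "1 \<le> q" "compact K" and [measurable]: "h \<in> borel_measurable unit_leb" "k \<in> borel_measurable unit_leb"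
  shows "Lp_norm q K (\<lambda>t. h t + k t) \<le> Lp_norm q K h + Lp_norm q K k"
  unfolding Lp_norm_def distrib_right
  by (intro Minkowski_nn_integral assms borel_measurable_times_ennreal indicator_compact_measurable)

lemma Lp_norm_cmult:
  assumes "1 \<le> q" "compact K" and [measurable]: "h \<in> borel_measurable unit_leb"
  shows "Lp_norm q K (\<lambda>t. c * h t) = c * Lp_norm q K h"
proof -
  note [measurable] = indicator_compact_measurable[OF assms(2)]
  have "(\<integral>\<^sup>+t. ennpowr (c * h t * indicator K t) q \<partial>unit_leb) = (\<integral>\<^sup>+t. ennpowr c q * ennpowr (h t * indicator K t) q \<partial>unit_leb)"
    using assms by (intro nn_integral_cong) (simp add: ennpowr_mult mult.assoc)
  also have "\<dots> = ennpowr c q * (\<integral>\<^sup>+t. ennpowr (h t * indicator K t) q \<partial>unit_leb)"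
    by (rule nn_integral_cmult) measurable
  finally show ?thesis using assms(1) by (simp add: Lp_norm_def ennpowr_mult)
qed

lemma Lp_norm_SUP:
  assumes "1 \<le> q" "compact K" and m: "\<And>k. h k \<in> borel_measurable unit_leb" and inc: "incseq h"
  shows "Lp_norm q K (\<lambda>t. SUP k. h k t) = (SUP k. Lp_norm q K (h k))"
proof -
  note [measurable] = indicator_compact_measurable[OF assms(2)] m
  have "(\<integral>\<^sup>+t. ennpowr ((SUP k. h k t) * indicator K t) q \<partial>unit_leb) = (\<integral>\<^sup>+t. (SUP k. ennpowr (h k t * indicator K t) q) \<partial>unit_leb)"
    using assms(1) by (intro nn_integral_cong) (simp add: SUP_mult_right_ennreal ennpowr_SUP)
  also have "\<dots> = (SUP k. \<integral>\<^sup>+t. ennpowr (h k t * indicator K t) q \<partial>unit_leb)"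
  proof (rule nn_integral_monotone_convergence_SUP)
    show "incseq (\<lambda>k t. ennpowr (h k t * indicator K t) q)"
      using inc assms(1) by (auto simp: incseq_def le_fun_def intro!: ennpowr_mono mult_right_mono)
  qed measurable
  finally show ?thesis using assms(1) by (simp add: Lp_norm_def ennpowr_SUP)
qed

lemma fold_norm_mono:
  "admissible N \<Longrightarrow> a \<le> b \<Longrightarrow> AE t in unit_leb. h t \<le> k t \<Longrightarrow> fold_norm a N h \<le> fold_norm b N k"
proof (induction N arbitrary: a b)
  case (Cons Kq N)
  obtain K q where Kq: "Kq = (K, q)" by (cases Kq)
  have *: "1 \<le> q" "admissible N" using Cons.prems(1) by (auto simp: Kq)
  show ?case unfolding Kq fold_norm_simps
    by (intro Cons.IH boxplus_mono Lp_norm_mono Cons.prems *)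
qed simp

text \<open>Subadditivity holds jointly in the initial value and the function: each step of the fold
  is Minkowski's inequality for the integral followed by that for \<open>boxplus\<close>.\<close>

lemma fold_norm_triangle:
  assumes "h \<in> borel_measurable unit_leb" "k \<in> borel_measurable unit_leb"
  shows "admissible N \<Longrightarrow> fold_norm (a + b) N (\<lambda>t. h t + k t) \<le> fold_norm a N h + fold_norm b N k"
proof (induction N arbitrary: a b)
  case (Cons Kq N)
  obtain K q where Kq: "Kq = (K, q)" by (cases Kq)
  have *: "compact K" "1 \<le> q" "admissible N" using Cons.prems by (auto simp: Kq)
  have "boxplus q (a + b) (Lp_norm q K (\<lambda>t. h t + k t)) \<le> boxplus q (a + b) (Lp_norm q K h + Lp_norm q K k)"
    by (intro boxplus_mono Lp_norm_triangle assms * order_refl)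
  also have "\<dots> \<le> boxplus q a (Lp_norm q K h) + boxplus q b (Lp_norm q K k)"
    by (rule boxplus_triangle[OF *(2)])
  finally have "fold_norm (a + b) (Kq # N) (\<lambda>t. h t + k t)
      \<le> fold_norm (boxplus q a (Lp_norm q K h) + boxplus q b (Lp_norm q K k)) N (\<lambda>t. h t + k t)"
    unfolding Kq fold_norm_simps by (intro fold_norm_mono *) auto
  also have "\<dots> \<le> fold_norm a (Kq # N) h + fold_norm b (Kq # N) k"
    unfolding Kq fold_norm_simps by (rule Cons.IH[OF *(3)])
  finally show ?case .
qed simp

lemma fold_norm_cmult:
  "h \<in> borel_measurable unit_leb \<Longrightarrow> admissible N \<Longrightarrow> fold_norm (c * a) N (\<lambda>t. c * h t) = c * fold_norm a N h"
  by (induction N arbitrary: a) (auto simp: Lp_norm_cmult boxplus_cmult)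

text \<open>Monotone convergence in every step. The initial values vary with \<open>k\<close>
  because the induction hypothesis is applied to the norms accumulated from
  \<open>h k\<close>.\<close>

lemma fold_norm_SUP:
  assumes "\<And>k. h k \<in> borel_measurable unit_leb" "incseq h"
  shows "admissible N \<Longrightarrow> incseq a \<Longrightarrow> fold_norm (SUP k. a k) N (\<lambda>t. SUP k. h k t) = (SUP k. fold_norm (a k) N (h k))"
proof (induction N arbitrary: a)
  case (Cons Kq N)
  obtain K q where Kq: "Kq = (K, q)" by (cases Kq)
  have *: "compact K" "1 \<le> q" "admissible N" using Cons.prems by (auto simp: Kq)
  have inc: "incseq (\<lambda>k. Lp_norm q K (h k))"
    using assms(2) * by (auto simp: incseq_def le_fun_def intro!: Lp_norm_mono)
  then have "incseq (\<lambda>k. boxplus q (a k) (Lp_norm q K (h k)))"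
    using Cons.prems(2) * by (auto simp: incseq_def intro!: boxplus_mono)
  then show ?case
    unfolding Kq fold_norm_simps
    by (simp add: Lp_norm_SUP[OF *(2,1) assms] boxplus_SUP[OF *(2) Cons.prems(2) inc] Cons.IH[OF *(3)])
qed simp

text \<open>Fatou's lemma, from \<open>fold_norm_SUP\<close> for the increasing infima over tails.
  It later serves both completeness and the lower bound for the limit superior.\<close>

lemma fold_norm_liminf:
  assumes m: "\<And>k. h k \<in> borel_measurable unit_leb" and N: "admissible N"
  shows "fold_norm a N (\<lambda>t. liminf (\<lambda>k. h k t)) \<le> liminf (\<lambda>k. fold_norm a N (h k))"
proof -
  define H where "H = (\<lambda>k t. INF j\<in>{k..}. h j t)"
  have Hm: "H k \<in> borel_measurable unit_leb" for k
    unfolding H_def by (intro borel_measurable_INF m) auto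
  have inc: "incseq H" unfolding H_def incseq_def le_fun_def
    by (auto intro!: INF_superset_mono)
  have "fold_norm a N (\<lambda>t. liminf (\<lambda>k. h k t)) = fold_norm (SUP k::nat. a) N (\<lambda>t. SUP k. H k t)"
    by (simp add: H_def liminf_SUP_INF)
  also have "\<dots> = (SUP k. fold_norm a N (H k))"
    by (rule fold_norm_SUP[OF Hm inc N]) (simp add: incseq_def)
  also have "\<dots> \<le> (SUP k. INF j\<in>{k..}. fold_norm a N (h j))"
  proof (intro SUP_mono' INF_greatest fold_norm_mono N order_refl AE_I2)
    fix k j :: nat and t assume "j \<in> {k..}" then show "H k t \<le> h j t" unfolding H_def by (rule INF_lower)
  qed
  finally show ?thesis by (simp add: liminf_SUP_INF)
qed

lemma fold_norm_zero: "admissible N \<Longrightarrow> fold_norm a N (\<lambda>_. 0) = a"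
  by (induction N arbitrary: a) (auto simp: Lp_norm_def)

text \<open>The pair of initial value and function is split into \<open>(a, 0)\<close> and
  \<open>(0, h)\<close>.\<close>

lemma fold_norm_le_add:
  assumes "h \<in> borel_measurable unit_leb" "admissible N"
  shows "fold_norm a N h \<le> a + fold_norm 0 N h"
  using fold_norm_triangle[of "\<lambda>_. 0" h N a 0] assms by (simp add: fold_norm_zero)

section \<open>Simple semi-norms as solutions\<close>

definition support :: "simple_seminorm \<Rightarrow> real set" where
  "support N = (\<Union>(K, q)\<in>set N. K)"

lemma support_simps [simp]:
  "support [] = {}" "support ((K, q) # N) = K \<union> support N"
  by (auto simp: support_def)

text \<open>Induction invariant: the supports still to be processed lie to the right of the time
  \<open>s\<close> reached so far, and the list may be exhausted.\<close>

definition ordered_from :: "real \<Rightarrow> simple_seminorm \<Rightarrow> bool" where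
  "ordered_from s N \<longleftrightarrow> (\<forall>(K, q)\<in>set N. compact K \<and> K \<noteq> {} \<and> K \<subseteq> {s..1} \<and> 1 \<le> q)
     \<and> successively (\<lambda>(K, _) (K', _). Sup K \<le> Inf K') N"

lemma standard_form_ordered: "standard_form N \<Longrightarrow> ordered_from 0 N"
  by (auto simp: standard_form_def ordered_from_def)

lemma ordered_from_admissible: "ordered_from s N \<Longrightarrow> admissible N"
  by (auto simp: ordered_from_def admissible_def)

lemma compact_Inf_Sup_in:
  fixes K :: "real set"
  assumes "compact K" "K \<noteq> {}"
  shows "Inf K \<in> K" "Sup K \<in> K" "\<And>t. t \<in> K \<Longrightarrow> Inf K \<le> t" "\<And>t. t \<in> K \<Longrightarrow> t \<le> Sup K"
  using assms closed_contains_Inf[of K] closed_contains_Sup[of K]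
  by (auto simp: compact_eq_bounded_closed bounded_imp_bdd_below bounded_imp_bdd_above intro!: cInf_lower cSup_upper)

text \<open>\<open>successively\<close> compares only neighbours; that all later supports lie to the
  right of \<open>Sup K\<close> takes an induction through \<open>Sup K \<le> Inf K'\<close> and
  \<open>Inf K' \<le> Sup K'\<close>.\<close>

lemma ordered_from_Cons:
  assumes "ordered_from s ((K, q) # N)"
  shows "ordered_from (Sup K) N"
  using assms
proof (induction N arbitrary: s K q)
  case Nil
  then show ?case by (simp add: ordered_from_def)
next
  case (Cons Kq N)
  obtain K' q' where Kq: "Kq = (K', q')" by (cases Kq)
  have K': "compact K'" "K' \<noteq> {}" "K' \<subseteq> {s..1}" "1 \<le> q'" "Sup K \<le> Inf K'"
    using Cons.prems by (auto simp: ordered_from_def Kq)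
  have "ordered_from s ((K', q') # N)"
    using Cons.prems by (auto simp: ordered_from_def Kq)
  from Cons.IH[OF this] have N: "ordered_from (Sup K') N" .
  have "Sup K \<le> Sup K'" using K'(5) compact_Inf_Sup_in[OF K'(1,2)] by (meson order_trans)
  then have "\<forall>(L, q)\<in>set N. L \<subseteq> {Sup K..1}" using N by (fastforce simp: ordered_from_def)
  moreover have "K' \<subseteq> {Sup K..1}"
  proof
    fix t assume t: "t \<in> K'"
    then have "Sup K \<le> t" using K'(5) compact_Inf_Sup_in(3)[OF K'(1,2) t] by simp
    with t K'(3) show "t \<in> {Sup K..1}" by auto
  qed
  ultimately show ?case using Cons.prems by (fastforce simp: ordered_from_def Kq)
qed

lemma exponent_fun_notin: "t \<notin> support N \<Longrightarrow> exponent_fun N t = 1"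
  by (induction N t rule: exponent_fun.induct) auto

text \<open>On a support \<open>K\<close> with exponent \<open>q\<close> the equation says that
  \<open>\<psi> powr q\<close> has density \<open>\<bar>g\<bar> powr q\<close>. So from
  \<open>s\<close> to \<open>Sup K\<close> it gains the integral of
  \<open>\<bar>g\<bar> powr q\<close> over \<open>K\<close>, which is one step of
  \<open>boxplus\<close>. The equation for \<open>u\<close> is assumed for \<open>s < t\<close>
  only, because the tail of the list describes it only after \<open>Sup K\<close>.\<close>

lemma fold_norm_path_aux:
  assumes ps: "primitive u c \<psi>" and c: "0 < c"
  shows "ordered_from s N \<Longrightarrow> 0 \<le> s \<Longrightarrow> s \<le> 1
    \<Longrightarrow> AE t in unit_leb. s < t \<longrightarrow> u t = indicator (support N) t * ode_rhs (exponent_fun N) g \<psi> t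
    \<Longrightarrow> fold_norm (ennreal (\<psi> s)) N (\<lambda>t. ennreal \<bar>g t\<bar>) = ennreal (\<psi> 1)"
proof (induction N arbitrary: s)
  case Nil
  have "(\<integral>t. indicator {s<..1} t * u t \<partial>unit_leb) = 0"
    by (rule integral_eq_zero_AE) (use Nil.prems(4) in eventually_elim, auto)
  then show ?case using primitive_diff[OF ps, of s 1] Nil.prems by simp
next
  case (Cons Kq N)
  obtain K q where Kq: "Kq = (K, q)" by (cases Kq)
  define s' where "s' = Sup K"
  have K: "compact K" "K \<noteq> {}" "K \<subseteq> {s..1}" "1 \<le> q"
    using Cons.prems(1) by (auto simp: Kq ordered_from_def)
  have s': "s \<le> s'" "s' \<le> 1" "\<And>t. t \<in> K \<Longrightarrow> t \<le> s'"
    using compact_Inf_Sup_in[OF K(1,2)] K(3) by (auto simp: s'_def)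
  have ord: "ordered_from s' N" unfolding s'_def by (rule ordered_from_Cons[OF Cons.prems(1)[unfolded Kq]])
  then have supp: "support N \<subseteq> {s'..1}" by (auto simp: support_def ordered_from_def)
  have pos: "0 < \<psi> t" if "t \<in> {0..1}" for t using primitive_ge[OF ps that] c by simp
  have "fold_norm (ennreal (\<psi> s')) N (\<lambda>t. ennreal \<bar>g t\<bar>) = ennreal (\<psi> 1)"
  proof (rule Cons.IH[OF ord])
    show "AE t in unit_leb. s' < t \<longrightarrow> u t = indicator (support N) t * ode_rhs (exponent_fun N) g \<psi> t"
      using Cons.prems(4)
    proof eventually_elim
      case (elim t)
      have "t \<notin> K" if "s' < t" using s'(3) that by force
      then show ?case using elim s'(1) by (auto simp: Kq indicator_def ode_rhs_def)
    qed
  qed (use s' Cons.prems in auto)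
  moreover have "boxplus q (ennreal (\<psi> s)) (Lp_norm q K (\<lambda>t. ennreal \<bar>g t\<bar>)) = ennreal (\<psi> s')"
  proof -
    define v where "v = (\<lambda>t. q * \<psi> t powr (q - 1) * u t)"
    have pv: "primitive v (c powr q) (\<lambda>t. \<psi> t powr q)" unfolding v_def
    proof (rule primitive_chain[OF ps, where G'="\<lambda>y. q * y powr (q - 1)" and G="\<lambda>y. y powr q"])
      show "((\<lambda>y. y powr q) has_real_derivative q * y powr (q - 1)) (at y)" if "y \<in> {c..\<psi> 1}" for y
        using that c by (intro has_real_derivative_powr) auto
    qed (use K in auto)
    have "(\<integral>\<^sup>+t. ennpowr (ennreal \<bar>g t\<bar> * indicator K t) q \<partial>unit_leb) = (\<integral>\<^sup>+t. ennreal (indicator {s<..s'} t * v t) \<partial>unit_leb)"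
    proof (rule nn_integral_cong_AE)
      \<comment> \<open>The endpoints are left out: \<open>K\<close> may contain \<open>s\<close>,
        and a later support may share \<open>s'\<close> with \<open>K\<close>.\<close>
      show "AE t in unit_leb. ennpowr (ennreal \<bar>g t\<bar> * indicator K t) q = ennreal (indicator {s<..s'} t * v t)"
        using Cons.prems(4) AE_unit_leb_neq[of s] AE_unit_leb_neq[of s'] AE_in_unit_interval
      proof eventually_elim
        case (elim t)
        then have t: "t \<in> {0..1}" by simp
        show ?case
        proof (cases "t \<in> K")
          case True
          then have "s < t" "t \<le> s'" using K(3) elim(2) s'(3)[of t] by force+
          then have "u t = \<bar>g t\<bar> powr q / q * \<psi> t powr (1 - q)"
            using elim(1) True by (simp add: Kq ode_rhs_def)
          then have "v t = \<bar>g t\<bar> powr q * (\<psi> t powr (q - 1) * \<psi> t powr (1 - q))"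
            using K(4) by (simp add: v_def)
          also have "\<psi> t powr (q - 1) * \<psi> t powr (1 - q) = 1"
            using pos[OF t] by (simp flip: powr_add)
          finally show ?thesis using True \<open>s < t\<close> \<open>t \<le> s'\<close> by simp
        next
          case False
          have "v t = 0" if "s < t" "t \<le> s'"
          proof -
            have "t \<notin> support N" using supp that elim(3) by force
            then show ?thesis using elim(1) that False by (simp add: Kq v_def)
          qed
          then show ?thesis using False by (auto simp: indicator_def)
        qed
      qed
    qed
    also have "\<dots> = ennreal (\<integral>t. indicator {s<..s'} t * v t \<partial>unit_leb)"
      using pv by (intro nn_integral_indicator_eq) (auto simp: primitive_def)
    also have "(\<integral>t. indicator {s<..s'} t * v t \<partial>unit_leb) = \<psi> s' powr q - \<psi> s powr q"
      using primitive_diff[OF pv, of s s'] s' Cons.prems(2) by simp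
    finally have "Lp_norm q K (\<lambda>t. ennreal \<bar>g t\<bar>) = ennpowr (ennreal (\<psi> s' powr q - \<psi> s powr q)) (1 / q)"
      by (simp add: Lp_norm_def)
    moreover have "\<psi> s powr q \<le> \<psi> s' powr q"
      using primitive_mono[OF pv, of s s'] s' Cons.prems(2) by simp
    moreover have "0 < \<psi> s" "0 < \<psi> s'" using pos s' Cons.prems(2) by auto
    ultimately have "ennpowr (ennreal (\<psi> s)) q + ennpowr (Lp_norm q K (\<lambda>t. ennreal \<bar>g t\<bar>)) q = ennreal (\<psi> s' powr q)"
      using K(4) by (simp add: powr_powr flip: ennreal_plus)
    then show ?thesis using K(4) \<open>0 < \<psi> s'\<close> by (simp add: boxplus_def powr_powr)
  qed
  ultimately show ?case by (simp add: Kq)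
qed

text \<open>Off its support a semi-norm ignores \<open>g\<close>, whereas
  \<open>exponent_fun\<close> is 1 there and the equation would add \<open>\<bar>g\<bar>\<close>;
  hence \<open>g\<close> has to vanish off the support.\<close>

lemma fold_norm_path:
  assumes N: "standard_form N" and x: "0 < x"
    and ps: "solves_ode (exponent_fun N) g x \<psi>"
    and g: "\<And>t. t \<in> {0..1} \<Longrightarrow> t \<notin> support N \<Longrightarrow> g t = 0"
  shows "fold_norm (ennreal x) N (\<lambda>t. ennreal \<bar>g t\<bar>) = ennreal (\<psi> 1)"
proof -
  have p: "primitive (ode_rhs (exponent_fun N) g \<psi>) x \<psi>" using ps by (simp add: solves_ode_def)
  have "fold_norm (ennreal (\<psi> 0)) N (\<lambda>t. ennreal \<bar>g t\<bar>) = ennreal (\<psi> 1)"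
  proof (rule fold_norm_path_aux[OF p x standard_form_ordered[OF N]])
    show "AE t in unit_leb. 0 < t \<longrightarrow> ode_rhs (exponent_fun N) g \<psi> t
        = indicator (support N) t * ode_rhs (exponent_fun N) g \<psi> t"
      using AE_in_unit_interval by eventually_elim (use g in \<open>auto simp: indicator_def ode_rhs_def\<close>)
  qed simp_all
  then show ?thesis using primitive_0[OF p] by simp
qed

section \<open>Exponent functions, truncation and comparison with solutions\<close>

lemma standard_form_admissible: "standard_form N \<Longrightarrow> admissible N"
  by (rule ordered_from_admissible[OF standard_form_ordered])

lemma support_measurable: "admissible N \<Longrightarrow> support N \<in> sets borel"
  unfolding support_def admissible_def
  by (intro sets.finite_UN) (auto simp: borel_compact)

lemma exponent_fun_measurable: "admissible N \<Longrightarrow> exponent_fun N \<in> borel_measurable borel"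
proof (induction N)
  case (Cons Kq N)
  obtain K q where Kq: "Kq = (K, q)" by (cases Kq)
  have [measurable]: "K \<in> sets borel" "exponent_fun N \<in> borel_measurable borel"
    using Cons by (auto simp: Kq borel_compact)
  have "(\<lambda>t. if t \<in> K then q else exponent_fun N t) \<in> borel_measurable borel" by measurable
  then show ?case by (simp add: Kq)
next
  case Nil
  have "(\<lambda>t. 1::real) \<in> borel_measurable borel" by simp
  then show ?case by simp
qed

lemma exponent_fun_measurable' [measurable]:
  "admissible N \<Longrightarrow> exponent_fun N \<in> borel_measurable unit_leb"
  by (intro borel_measurable_unit_leb exponent_fun_measurable)

lemma exponent_fun_ge1: "admissible N \<Longrightarrow> 1 \<le> exponent_fun N t"
  by (induction N t rule: exponent_fun.induct) auto

lemma exponent_fun_bounded: "\<exists>n. \<forall>t. exponent_fun N t \<le> n"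
proof (induction N)
  case (Cons Kq N)
  then obtain n where "\<forall>t. exponent_fun N t \<le> n" by auto
  then have "\<forall>t. exponent_fun (Kq # N) t \<le> max n (snd Kq)" by (cases Kq) (auto intro: le_max_iff_disj[THEN iffD2])
  then show ?case by blast
qed auto

lemma bounded_powr_integrable:
  fixes g p :: "real \<Rightarrow> real"
  assumes pm: "p \<in> borel_measurable unit_leb" "\<And>t. t \<in> {0..1} \<Longrightarrow> 1 \<le> p t"
    and gm: "g \<in> borel_measurable unit_leb" and gb: "\<And>t. t \<in> {0..1} \<Longrightarrow> \<bar>g t\<bar> \<le> B"
    and bnd: "\<And>t. t \<in> {0..1} \<Longrightarrow> g t \<noteq> 0 \<Longrightarrow> p t \<le> n"
  shows "integrable unit_leb (\<lambda>t. \<bar>g t\<bar> powr p t)"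
proof -
  note [measurable] = pm(1) gm
  have "AE t in unit_leb. norm (\<bar>g t\<bar> powr p t) \<le> (1 + B) powr n"
  proof (rule AE_I2)
    fix t assume "t \<in> space unit_leb"
    then have t: "t \<in> {0..1}" by simp
    show "norm (\<bar>g t\<bar> powr p t) \<le> (1 + B) powr n"
    proof (cases "g t = 0")
      case False
      have "\<bar>g t\<bar> powr p t \<le> (1 + B) powr p t" using gb[OF t] pm(2)[OF t] by (intro powr_mono2) auto
      also have "\<dots> \<le> (1 + B) powr n" using gb[OF t] bnd[OF t False] by (intro powr_mono) auto
      finally show ?thesis by simp
    qed simp
  qed
  then show ?thesis
    by (rule finite_measure.integrable_const_bound[OF finite_measure_unit_leb]) measurable
qed

lemma SUP_truncate:
  "(SUP k::nat. ennreal \<bar>y * (if \<bar>y\<bar> \<le> real k then 1 else 0)\<bar>) = ennreal \<bar>y\<bar>"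
proof (rule antisym)
  show "(SUP k::nat. ennreal \<bar>y * (if \<bar>y\<bar> \<le> real k then 1 else 0)\<bar>) \<le> ennreal \<bar>y\<bar>"
    by (rule SUP_least) auto
  obtain k :: nat where "\<bar>y\<bar> \<le> real k" using real_arch_simple by blast
  then show "ennreal \<bar>y\<bar> \<le> (SUP k::nat. ennreal \<bar>y * (if \<bar>y\<bar> \<le> real k then 1 else 0)\<bar>)"
    by (intro SUP_upper2[of k]) auto
qed

text \<open>Solutions are available for bounded functions, whose powers are integrable; monotone
  convergence carries estimates over to \<open>g\<close>.\<close>

lemma fold_norm_truncate:
  fixes g :: "real \<Rightarrow> real"
  assumes N: "admissible N" and gm: "g \<in> borel_measurable unit_leb"
  shows "fold_norm a N (\<lambda>t. ennreal \<bar>g t\<bar>)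
    = (SUP k::nat. fold_norm a N (\<lambda>t. ennreal \<bar>g t * (if \<bar>g t\<bar> \<le> real k then 1 else 0)\<bar>))"
proof -
  note [measurable] = gm
  have "fold_norm (SUP k::nat. a) N (\<lambda>t. SUP k::nat. ennreal \<bar>g t * (if \<bar>g t\<bar> \<le> real k then 1 else 0)\<bar>)
    = (SUP k::nat. fold_norm a N (\<lambda>t. ennreal \<bar>g t * (if \<bar>g t\<bar> \<le> real k then 1 else 0)\<bar>))"
  proof (rule fold_norm_SUP[OF _ _ N])
    show "(\<lambda>t. ennreal \<bar>g t * (if \<bar>g t\<bar> \<le> real k then 1 else 0)\<bar>) \<in> borel_measurable unit_leb" for k :: nat
      by measurable
    show "incseq (\<lambda>(k::nat) t. ennreal \<bar>g t * (if \<bar>g t\<bar> \<le> real k then 1 else 0)\<bar>)"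
      by (auto simp: incseq_def le_fun_def)
  qed (simp add: incseq_def)
  then show ?thesis by (simp add: SUP_truncate)
qed

lemma fold_norm_cong_support:
  assumes "admissible N" "AE t in unit_leb. t \<in> support N \<longrightarrow> h t = k t"
  shows "fold_norm a N h = fold_norm a N k"
proof -
  have "admissible M \<Longrightarrow> support M \<subseteq> support N \<Longrightarrow> fold_norm a M h = fold_norm a M k" for M
  proof (induction M arbitrary: a)
    case (Cons Kq M)
    obtain K q where Kq: "Kq = (K, q)" by (cases Kq)
    have "Lp_norm q K h = Lp_norm q K k" unfolding Lp_norm_def
    proof (intro arg_cong2[where f=ennpowr] refl nn_integral_cong_AE)
      show "AE t in unit_leb. ennpowr (h t * indicator K t) q = ennpowr (k t * indicator K t) q"
        using assms(2) by eventually_elim (use Cons.prems in \<open>auto simp: Kq indicator_def\<close>)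
    qed
    then show ?case using Cons by (simp add: Kq)
  qed simp
  with assms(1) show ?thesis by blast
qed

text \<open>The solution for \<open>N\<close> and the truncated \<open>g\<close> is compared with
  \<open>\<phi>\<close>. The auxiliary \<open>q\<close> has to agree with
  \<open>exponent_fun N\<close> only where the semi-norm sees \<open>g\<close>; elsewhere it may be
  chosen so as to meet \<open>q \<le> p\<close>.\<close>

lemma fold_norm_le_ode:
  assumes N: "standard_form N" and f: "solves_ode p f x \<phi>" and x: "0 < x"
    and pm: "p \<in> borel_measurable unit_leb" "\<And>t. t \<in> {0..1} \<Longrightarrow> 1 \<le> p t"
    and qm: "q \<in> borel_measurable unit_leb" "\<And>t. t \<in> {0..1} \<Longrightarrow> 1 \<le> q t"
    and gm: "g \<in> borel_measurable unit_leb"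
    and qp: "AE t in unit_leb. q t \<le> p t"
    and q: "\<And>t. t \<in> {0..1} \<Longrightarrow> t \<in> support N \<Longrightarrow> g t \<noteq> 0 \<Longrightarrow> q t = exponent_fun N t"
    and gf: "AE t in unit_leb. t \<in> support N \<longrightarrow> \<bar>g t\<bar> \<le> \<bar>f t\<bar>"
  shows "fold_norm 0 N (\<lambda>t. ennreal \<bar>g t\<bar>) \<le> ennreal (exp (\<integral>t. 1 / q t - 1 / p t \<partial>unit_leb) * \<phi> 1)"
proof -
  note adm = standard_form_admissible[OF N]
  note [measurable] = gm exponent_fun_measurable'[OF adm] indicator_measurable_unit_leb[OF support_measurable[OF adm]]
  obtain n where n: "\<And>t. exponent_fun N t \<le> n" using exponent_fun_bounded[of N] by blast
  show ?thesis unfolding fold_norm_truncate[OF adm gm]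
  proof (rule SUP_least)
    fix k :: nat
    \<comment> \<open>Truncation makes the powers integrable; the indicator makes the function
      vanish off the support, as \<open>fold_norm_path\<close> requires.\<close>
    define gk where "gk = (\<lambda>t. (g t * (if \<bar>g t\<bar> \<le> real k then 1 else 0)) * indicator (support N) t)"
    have gkm: "gk \<in> borel_measurable unit_leb" unfolding gk_def by measurable
    have gkb: "\<bar>gk t\<bar> \<le> real k" for t by (auto simp: gk_def indicator_def)
    have "integrable unit_leb (\<lambda>t. \<bar>gk t\<bar> powr exponent_fun N t)"
      by (rule bounded_powr_integrable[OF _ _ gkm gkb n]) (use adm exponent_fun_ge1 in auto)
    then obtain \<psi> where \<psi>: "solves_ode (exponent_fun N) gk x \<psi>"
      using solves_ode_exists[OF exponent_fun_measurable'[OF adm] exponent_fun_ge1[OF adm] gkm n _ x] by blast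
    have \<psi>': "solves_ode q gk x \<psi>"
      using \<psi> unfolding solves_ode_def
    proof (rule primitive_cong)
      fix t :: real assume t: "t \<in> {0..1}"
      show "ode_rhs (exponent_fun N) gk \<psi> t = ode_rhs q gk \<psi> t"
      proof (cases "gk t = 0")
        case False
        then have "q t = exponent_fun N t" using q[OF t] by (auto simp: gk_def indicator_def split: if_splits)
        then show ?thesis by (simp add: ode_rhs_def)
      qed (simp add: ode_rhs_def)
    qed simp
    have "fold_norm 0 N (\<lambda>t. ennreal \<bar>g t * (if \<bar>g t\<bar> \<le> real k then 1 else 0)\<bar>) = fold_norm 0 N (\<lambda>t. ennreal \<bar>gk t\<bar>)"
      by (rule fold_norm_cong_support[OF adm AE_I2]) (auto simp: gk_def)
    also have "\<dots> \<le> fold_norm (ennreal x) N (\<lambda>t. ennreal \<bar>gk t\<bar>)"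
      by (rule fold_norm_mono[OF adm]) auto
    also have "\<dots> = ennreal (\<psi> 1)"
      by (rule fold_norm_path[OF N x \<psi>]) (simp add: gk_def)
    also have "\<dots> \<le> ennreal (exp (\<integral>t. 1 / q t - 1 / p t \<partial>unit_leb) * \<phi> 1)"
    proof (intro ennreal_leI solves_ode_compare[OF f \<psi>' pm qm qp _ x order_refl])
      show "AE t in unit_leb. \<bar>gk t\<bar> \<le> \<bar>f t\<bar>"
        using gf by eventually_elim (auto simp: gk_def indicator_def)
    qed auto
    finally show "fold_norm 0 N (\<lambda>t. ennreal \<bar>g t * (if \<bar>g t\<bar> \<le> real k then 1 else 0)\<bar>)
       \<le> ennreal (exp (\<integral>t. 1 / q t - 1 / p t \<partial>unit_leb) * \<phi> 1)" .
  qed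
qed

section \<open>Approximation of measurable exponents\<close>

text \<open>The solution for \<open>M\<close> mediates: by \<open>fold_norm_le_ode\<close> it bounds
  the semi-norm \<open>N\<close>, and by \<open>fold_norm_path\<close> its value at 1 is at most
  \<open>x\<close> plus the semi-norm \<open>M\<close> of \<open>f\<close>. Then \<open>x\<close>
  tends to 0.\<close>

lemma fold_norm_compare:
  assumes N: "standard_form N" and M: "standard_form M"
    and qm: "q \<in> borel_measurable unit_leb" "\<And>t. t \<in> {0..1} \<Longrightarrow> 1 \<le> q t"
    and gm: "g \<in> borel_measurable unit_leb"
    and qp: "AE t in unit_leb. q t \<le> exponent_fun M t"
    and q: "\<And>t. t \<in> {0..1} \<Longrightarrow> t \<in> support N \<Longrightarrow> g t \<noteq> 0 \<Longrightarrow> t \<in> support M \<and> q t = exponent_fun N t"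
    and gf: "AE t in unit_leb. \<bar>g t\<bar> \<le> \<bar>f t\<bar>"
  shows "fold_norm 0 N (\<lambda>t. ennreal \<bar>g t\<bar>)
    \<le> ennreal (exp (\<integral>t. 1 / q t - 1 / exponent_fun M t \<partial>unit_leb)) * fold_norm 0 M (\<lambda>t. ennreal \<bar>f t\<bar>)"
proof -
  note admN = standard_form_admissible[OF N] and admM = standard_form_admissible[OF M]
  note [measurable] = gm indicator_measurable_unit_leb[OF support_measurable[OF admM]]
  define E where "E = exp (\<integral>t. 1 / q t - 1 / exponent_fun M t \<partial>unit_leb)"
  obtain n where n: "\<And>t. exponent_fun M t \<le> n" using exponent_fun_bounded[of M] by blast
  show ?thesis unfolding fold_norm_truncate[OF admN gm] E_def[symmetric]
  proof (rule SUP_least)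
    fix k :: nat
    define gj where "gj = (\<lambda>t. g t * (if \<bar>g t\<bar> \<le> real k then 1 else 0))"
    define gk where "gk = (\<lambda>t. gj t * indicator (support M) t)"
    have gjm: "gj \<in> borel_measurable unit_leb" unfolding gj_def by measurable
    note [measurable] = gjm
    have gkm: "gk \<in> borel_measurable unit_leb" unfolding gk_def by measurable
    have gkb: "\<bar>gk t\<bar> \<le> real k" for t by (auto simp: gk_def gj_def indicator_def)
    have int: "integrable unit_leb (\<lambda>t. \<bar>gk t\<bar> powr exponent_fun M t)"
      by (rule bounded_powr_integrable[OF _ _ gkm gkb n]) (use admM exponent_fun_ge1 in auto)
    have *: "fold_norm 0 N (\<lambda>t. ennreal \<bar>gj t\<bar>) \<le> ennreal E * (ennreal x + fold_norm 0 M (\<lambda>t. ennreal \<bar>f t\<bar>))"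
      if x: "0 < x" for x
    proof -
      obtain \<phi> where \<phi>: "solves_ode (exponent_fun M) gk x \<phi>"
        using solves_ode_exists[OF exponent_fun_measurable'[OF admM] exponent_fun_ge1[OF admM] gkm n int x] by blast
      have \<phi>0: "0 \<le> \<phi> 1" using solves_ode_pos[OF \<phi> x, of 1] by simp
      have "fold_norm 0 N (\<lambda>t. ennreal \<bar>gj t\<bar>) \<le> ennreal (E * \<phi> 1)"
        unfolding E_def
      proof (rule fold_norm_le_ode[OF N \<phi> x exponent_fun_measurable'[OF admM] exponent_fun_ge1[OF admM] qm gjm qp])
        show "q t = exponent_fun N t" if "t \<in> {0..1}" "t \<in> support N" "gj t \<noteq> 0" for t
          using q[OF that(1,2)] that(3) by (simp add: gj_def)
        show "AE t in unit_leb. t \<in> support N \<longrightarrow> \<bar>gj t\<bar> \<le> \<bar>gk t\<bar>"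
        proof (rule AE_I2, rule impI)
          fix t assume "t \<in> space unit_leb" "t \<in> support N"
          then show "\<bar>gj t\<bar> \<le> \<bar>gk t\<bar>" using q[of t] by (cases "g t = 0") (auto simp: gj_def gk_def)
        qed
      qed
      also have "\<dots> = ennreal E * ennreal (\<phi> 1)" using \<phi>0 by (simp add: ennreal_mult E_def)
      also have "ennreal (\<phi> 1) = fold_norm (ennreal x) M (\<lambda>t. ennreal \<bar>gk t\<bar>)"
        by (rule fold_norm_path[OF M x \<phi>, symmetric]) (simp add: gk_def)
      also have "\<dots> \<le> ennreal x + fold_norm 0 M (\<lambda>t. ennreal \<bar>gk t\<bar>)"
        by (rule fold_norm_le_add[OF _ admM]) (use gkm in measurable)
      also have "\<dots> \<le> ennreal x + fold_norm 0 M (\<lambda>t. ennreal \<bar>f t\<bar>)"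
      proof (intro add_left_mono fold_norm_mono admM order_refl)
        show "AE t in unit_leb. ennreal \<bar>gk t\<bar> \<le> ennreal \<bar>f t\<bar>"
          using gf by eventually_elim (auto simp: gk_def gj_def indicator_def intro!: ennreal_leI)
      qed
      finally show ?thesis by (simp add: mult_left_mono)
    qed
    have "fold_norm 0 N (\<lambda>t. ennreal \<bar>gj t\<bar>) \<le> ennreal E * fold_norm 0 M (\<lambda>t. ennreal \<bar>f t\<bar>)"
    proof (rule ennreal_le_epsilon)
      fix e :: real assume e: "0 < e"
      have E: "0 < E" by (simp add: E_def)
      \<comment> \<open>The initial value \<open>e / E\<close> makes the error exactly
        \<open>e\<close>.\<close>
      have "ennreal E * (ennreal (e / E) + fold_norm 0 M (\<lambda>t. ennreal \<bar>f t\<bar>))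
        = ennreal E * fold_norm 0 M (\<lambda>t. ennreal \<bar>f t\<bar>) + ennreal e"
        using E e by (simp add: distrib_left add.commute flip: ennreal_mult)
      with *[of "e / E"] E e show "fold_norm 0 N (\<lambda>t. ennreal \<bar>gj t\<bar>)
        \<le> ennreal E * fold_norm 0 M (\<lambda>t. ennreal \<bar>f t\<bar>) + ennreal e" by simp
    qed
    then show "fold_norm 0 N (\<lambda>t. ennreal \<bar>g t * (if \<bar>g t\<bar> \<le> real k then 1 else 0)\<bar>)
      \<le> ennreal E * fold_norm 0 M (\<lambda>t. ennreal \<bar>f t\<bar>)" by (simp add: gj_def)
  qed
qed

lemma unit_leb_sets_lebesgue: "A \<in> sets unit_leb \<Longrightarrow> A \<in> sets lebesgue"
  by (auto simp: sets_restrict_space)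

lemma measure_unit_leb: "A \<subseteq> {0..1} \<Longrightarrow> measure unit_leb A = measure lebesgue A"
  by (rule measure_restrict_space) auto

text \<open>Direct for a finite range: every level set contains a closed set that nearly fills it,
  and on the union of these finitely many disjoint closed sets \<open>r\<close> is locally
  constant.\<close>

lemma Lusin_finite_range:
  fixes r :: "real \<Rightarrow> real"
  assumes rm: "r \<in> borel_measurable unit_leb" and G: "finite G" "r ` {0..1} \<subseteq> G" and \<delta>: "0 < \<delta>"
  obtains C where "compact C" "C \<subseteq> {0..1}" "continuous_on C r" "measure unit_leb ({0..1} - C) < \<delta>"
proof -
  define A where "A = (\<lambda>g. r -` {g} \<inter> {0..1})"
  \<comment> \<open>The \<open>+ 1\<close> makes the sum of the errors over \<open>G\<close>
    strictly smaller than \<open>\<delta>\<close>.\<close>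
  define e where "e = \<delta> / (real (card G) + 1)"
  have e: "0 < e" using \<delta> by (simp add: e_def)
  have As: "A g \<in> sets lebesgue" for g
    using measurable_sets[OF rm, of "{g}"] by (auto simp: A_def intro!: unit_leb_sets_lebesgue)
  have "\<exists>T. closed T \<and> T \<subseteq> A g \<and> A g - T \<in> lmeasurable \<and> emeasure lebesgue (A g - T) < ennreal e" for g
    using sets_lebesgue_inner_closed[OF As e] by metis
  then obtain T where T: "\<And>g. closed (T g)" "\<And>g. T g \<subseteq> A g" "\<And>g. A g - T g \<in> lmeasurable"
    "\<And>g. emeasure lebesgue (A g - T g) < ennreal e" by metis
  define C where "C = (\<Union>g\<in>G. T g)"
  show ?thesis
  proof
    have "closed C" unfolding C_def using G T by auto
    moreover show C01: "C \<subseteq> {0..1}" using T(2) by (force simp: C_def A_def)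
    ultimately show "compact C" by (meson bounded_closed_interval bounded_subset compact_eq_bounded_closed)
    show "continuous_on C r" unfolding C_def
    proof (rule continuous_on_closed_Union[OF G(1) T(1)])
      fix g
      have "continuous_on (T g) r = continuous_on (T g) (\<lambda>_. g)"
        using T(2)[of g] by (intro continuous_on_cong) (auto simp: A_def)
      then show "continuous_on (T g) r" by simp
    qed
    have "measure unit_leb ({0..1} - C) = measure lebesgue ({0..1} - C)" by (rule measure_unit_leb) auto
    also have "\<dots> \<le> measure lebesgue (\<Union>g\<in>G. A g - T g)"
    proof (rule measure_mono_fmeasurable)
      show "{0..1} - C \<subseteq> (\<Union>g\<in>G. A g - T g)" using G(2) by (auto simp: A_def C_def)
      show "{0..1} - C \<in> sets lebesgue" using \<open>closed C\<close> by (intro sets.Diff) auto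
      show "(\<Union>g\<in>G. A g - T g) \<in> fmeasurable lebesgue" using T(3) G(1) by (intro fmeasurable.finite_UN) auto
    qed
    also have "\<dots> \<le> (\<Sum>g\<in>G. measure lebesgue (A g - T g))"
      using T(3) G(1) by (intro measure_UNION_le) (auto dest: fmeasurableD)
    also have "\<dots> \<le> (\<Sum>g\<in>G. e)"
      using T(3,4) by (intro sum_mono) (metis e emeasure_eq_measure2 ennreal_less_iff less_eq_real_def measure_nonneg)
    also have "\<dots> < \<delta>" using \<delta> by (simp add: e_def field_simps)
    finally show "measure unit_leb ({0..1} - C) < \<delta>" .
  qed
qed

lemma exponent_fun_in:
  "t \<in> support N \<Longrightarrow> \<exists>(K, q)\<in>set N. t \<in> K \<and> exponent_fun N t = q"
  by (induction N t rule: exponent_fun.induct) auto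

lemma finite_gap:
  fixes G :: "real set"
  assumes "finite G"
  obtains e where "0 < e" "\<And>a b. a \<in> G \<Longrightarrow> b \<in> G \<Longrightarrow> \<bar>a - b\<bar> < e \<Longrightarrow> a = b"
proof -
  \<comment> \<open>The element 1 keeps \<open>D\<close> nonempty when \<open>G\<close> has at most
    one point.\<close>
  define D where "D = insert 1 ((\<lambda>(a, b). \<bar>a - b\<bar>) ` (G \<times> G) - {0})"
  have D: "finite D" "\<And>d. d \<in> D \<Longrightarrow> 0 < d" using assms by (auto simp: D_def)
  have "0 < Min D" using D by (subst Min_gr_iff) (auto simp: D_def)
  moreover have "a = b" if "a \<in> G" "b \<in> G" "\<bar>a - b\<bar> < Min D" for a b
  proof (rule ccontr)
    assume "a \<noteq> b"
    then have "\<bar>a - b\<bar> \<in> D" using that by (auto simp: D_def)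
    then have "Min D \<le> \<bar>a - b\<bar>" using D by simp
    then show False using that by simp
  qed
  ultimately show ?thesis using that by blast
qed

text \<open>A measurable function of finite range is locally constant on a compact set of nearly full
  measure, hence constant on the trace of each cell of a fine partition.\<close>

lemma simple_seminorm_approx:
  fixes r :: "real \<Rightarrow> real"
  assumes rm: "r \<in> borel_measurable unit_leb" and G: "finite G" "r ` {0..1} \<subseteq> G"
    and r1: "\<And>t. t \<in> {0..1} \<Longrightarrow> 1 \<le> r t" and \<delta>: "0 < \<delta>" "\<delta> \<le> 1"
  obtains M where "standard_form M" "support M \<subseteq> {0..1}" "measure unit_leb ({0..1} - support M) < \<delta>"
    "\<And>t. t \<in> support M \<Longrightarrow> exponent_fun M t = r t"
proof -
  obtain C where C: "compact C" "C \<subseteq> {0..1}" "continuous_on C r" "measure unit_leb ({0..1} - C) < \<delta>"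
    using Lusin_finite_range[OF rm G \<delta>(1)] .
  obtain e where e: "0 < e" "\<And>a b. a \<in> G \<Longrightarrow> b \<in> G \<Longrightarrow> \<bar>a - b\<bar> < e \<Longrightarrow> a = b"
    using finite_gap[OF G(1)] by metis
  have "uniformly_continuous_on C r" by (rule compact_uniformly_continuous[OF C(3,1)])
  then obtain d where d: "0 < d" "\<And>s t. s \<in> C \<Longrightarrow> t \<in> C \<Longrightarrow> dist s t < d \<Longrightarrow> dist (r s) (r t) < e"
    using e(1) unfolding uniformly_continuous_on_def by metis
  have const: "r s = r t" if "s \<in> C" "t \<in> C" "\<bar>s - t\<bar> < d" for s t
    by (rule e(2)) (use that C(2) G(2) d(2)[of s t] in \<open>auto simp: dist_real_def\<close>)
  obtain n :: nat where n: "n \<noteq> 0" "1 / real n < d" using d(1) by (metis nat_approx_posE nat.distinct(1))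
  define I where "I = (\<lambda>j::nat. C \<inter> {real j / n..(real j + 1) / n})"
  \<comment> \<open>\<open>Sup (I j)\<close> is merely a sample point of the cell, on which
    \<open>r\<close> is constant; empty cells are filtered out below.\<close>
  define f where "f = (\<lambda>j. (I j, r (Sup (I j))))"
  define M where "M = map f (filter (\<lambda>j. I j \<noteq> {}) [0..<n])"
  have Ic: "compact (I j)" "I j \<subseteq> {0..1}" for j using C(1,2) by (auto simp: I_def)
  have rI: "r s = r t" if "s \<in> I j" "t \<in> I j" for s t j
  proof (rule const)
    have "\<bar>s - t\<bar> \<le> (real j + 1) / n - real j / n" using that by (auto simp: I_def)
    also have "\<dots> = 1 / n" by (simp add: add_divide_distrib)
    finally show "\<bar>s - t\<bar> < d" using n by simp
  qed (use that in \<open>auto simp: I_def\<close>)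
  have cover: "\<exists>j<n. t \<in> I j" if t: "t \<in> C" for t
  proof -
    have t01: "0 \<le> t" "t \<le> 1" using t C(2) by auto
    show ?thesis
    proof (cases "t = 1")
      case True
      then show ?thesis using n t by (intro exI[of _ "n - 1"]) (auto simp: I_def of_nat_diff)
    next
      case False
      define j where "j = nat \<lfloor>t * n\<rfloor>"
      have j: "real j \<le> t * n" "t * n < real j + 1" using t01 by (auto simp: j_def)
      have "real j < n" using j(1) False t01 n by (smt (verit) mult_less_cancel_right2 of_nat_0_less_iff not_gr_zero)
      then show ?thesis using j n t by (intro exI[of _ j]) (auto simp: I_def field_simps)
    qed
  qed
  have supp: "support M = C"
  proof
    show "support M \<subseteq> C" by (auto simp: support_def M_def f_def I_def)
    show "C \<subseteq> support M" using cover by (fastforce simp: support_def M_def f_def)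
  qed
  \<comment> \<open>\<open>standard_form\<close> excludes the empty list;
    \<open>\<delta> \<le> 1\<close> excludes an empty \<open>C\<close>.\<close>
  have "C \<noteq> {}"
  proof
    assume "C = {}"
    then have "measure unit_leb ({0..1} - C) = 1" by (simp add: measure_def emeasure_unit_leb_UNIV)
    then show False using C(4) \<delta> by simp
  qed
  have std: "standard_form M"
    unfolding standard_form_def
  proof (intro conjI ballI)
    show "M \<noteq> []" using \<open>C \<noteq> {}\<close> supp by (auto simp: support_def)
    show "successively (\<lambda>(K, _) (K', _). Sup K \<le> Inf K') M"
      unfolding M_def
    proof (intro successively_if_sorted_wrt, unfold sorted_wrt_map, rule sorted_wrt_mono_rel)
      show "sorted_wrt (<) (filter (\<lambda>j. I j \<noteq> {}) [0..<n])" by (intro sorted_wrt_filter) simp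
      fix i j assume "i \<in> set (filter (\<lambda>j. I j \<noteq> {}) [0..<n])" "j \<in> set (filter (\<lambda>j. I j \<noteq> {}) [0..<n])" and ij: "i < j"
      then have ne: "I i \<noteq> {}" "I j \<noteq> {}" by auto
      have "Sup (I i) \<le> (real i + 1) / n" using compact_Inf_Sup_in(2)[OF Ic(1) ne(1)] by (auto simp: I_def)
      also have "\<dots> \<le> real j / n" using ij by (intro divide_right_mono) auto
      also have "\<dots> \<le> Inf (I j)" using compact_Inf_Sup_in(1)[OF Ic(1) ne(2)] by (auto simp: I_def)
      finally have "Sup (I i) \<le> Inf (I j)" .
      then show "(case f i of (K, uu) \<Rightarrow> \<lambda>(K', uu). Sup K \<le> Inf K') (f j)" by (simp add: f_def)
    qed
    fix Kq assume "Kq \<in> set M"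
    then obtain j where j: "Kq = f j" "I j \<noteq> {}" by (auto simp: M_def)
    have "Sup (I j) \<in> {0..1}" using compact_Inf_Sup_in(2)[OF Ic(1) j(2)] Ic(2) by blast
    then show "case Kq of (K, q) \<Rightarrow> compact K \<and> K \<noteq> {} \<and> K \<subseteq> {0..1} \<and> 1 \<le> q"
      using j Ic[of j] r1 by (auto simp: f_def)
  qed
  show ?thesis
  proof (rule that[OF std])
    show "support M \<subseteq> {0..1}" "measure unit_leb ({0..1} - support M) < \<delta>" using C supp by auto
    fix t assume "t \<in> support M"
    then obtain K q where Kq: "(K, q) \<in> set M" "t \<in> K" "exponent_fun M t = q" using exponent_fun_in[of t M] by auto
    then obtain j where j: "K = I j" "q = r (Sup (I j))" "I j \<noteq> {}" by (auto simp: M_def f_def)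
    have "Sup (I j) \<in> I j" using compact_Inf_Sup_in(2)[OF Ic(1) j(3)] .
    then show "exponent_fun M t = r t" using rI[of "Sup (I j)" j t] Kq j by simp
  qed
qed

text \<open>\<open>p\<close> is rounded down to a finite grid \<open>G k\<close>, which makes the
  range finite for \<open>simple_seminorm_approx\<close>. The uncovered sets have measure below
  \<open>(1/2)^k\<close>, so by Borel-Cantelli almost every point is eventually covered. The finite
  set \<open>G0\<close> contributes to every grid: rounding \<open>p t\<close> down then never falls
  below an element of \<open>G0\<close> between 1 and \<open>p t\<close>.\<close>

lemma approximating_sequence:
  fixes p :: "real \<Rightarrow> real"
  assumes pm: "p \<in> borel_measurable unit_leb" and p1: "\<And>t. t \<in> {0..1} \<Longrightarrow> 1 \<le> p t"
    and G0: "finite G0"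
  obtains M :: "nat \<Rightarrow> simple_seminorm" where "\<And>k. M k \<in> simple_below p"
    "AE t in unit_leb. \<forall>\<^sub>F k in sequentially. t \<in> support (M k)"
    "AE t in unit_leb. (\<lambda>k. exponent_fun (M k) t) \<longlonglongrightarrow> p t"
    "\<And>k t g. t \<in> support (M k) \<Longrightarrow> g \<in> G0 \<Longrightarrow> 1 \<le> g \<Longrightarrow> g \<le> p t \<Longrightarrow> g \<le> exponent_fun (M k) t"
proof -
  \<comment> \<open>Mesh \<open>1 / Suc k\<close> from 1 up to \<open>1 + Suc k\<close>: the height
    has to grow along with the refinement, as \<open>p\<close> may be unbounded.\<close>
  define G where "G = (\<lambda>k::nat. insert 1 ({g\<in>G0. 1 \<le> g} \<union> (\<lambda>i. 1 + real i / real (Suc k)) ` {..Suc k * Suc k}))"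
  \<comment> \<open>\<open>max 1 x\<close> makes the set nonempty for every real \<open>x\<close>,
    since 1 is in \<open>G k\<close>; \<open>\<rho> k\<close> is then monotone on the whole line and
    hence measurable.\<close>
  define \<rho> where "\<rho> = (\<lambda>k x. Max {g \<in> G k. g \<le> max 1 x})"
  define r where "r = (\<lambda>k t. \<rho> k (p t))"
  have Gf: "finite (G k)" and G1: "1 \<in> G k" and Gge: "\<And>g. g \<in> G k \<Longrightarrow> 1 \<le> g" for k
    using G0 by (auto simp: G_def)
  have fin: "finite {g \<in> G k. g \<le> max 1 x}" and ne: "{g \<in> G k. g \<le> max 1 x} \<noteq> {}" for k x
    using Gf G1[of k] by auto
  have \<rho>: "\<rho> k x \<in> G k" "\<rho> k x \<le> max 1 x" for k x
    using Max_in[OF fin ne, of k x] by (auto simp: \<rho>_def)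
  have \<rho>ge: "g \<le> \<rho> k x" if "g \<in> G k" "g \<le> max 1 x" for g k x
    unfolding \<rho>_def using that fin by (intro Max_ge) auto
  have "mono (\<rho> k)" for k
  proof (rule monoI)
    fix x y :: real assume "x \<le> y"
    then show "\<rho> k x \<le> \<rho> k y" using \<rho>[of k x] by (intro \<rho>ge) auto
  qed
  then have \<rho>m: "\<rho> k \<in> borel_measurable borel" for k by (rule borel_measurable_mono)
  have rm: "r k \<in> borel_measurable unit_leb" for k
    unfolding r_def by (rule measurable_compose[OF pm \<rho>m])
  have rG: "r k ` {0..1} \<subseteq> G k" for k using \<rho> by (auto simp: r_def)
  have r1: "1 \<le> r k t" for k t using Gge[OF \<rho>(1)] by (simp add: r_def)
  have "\<exists>M. standard_form M \<and> support M \<subseteq> {0..1} \<and> measure unit_leb ({0..1} - support M) < (1/2)^k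
      \<and> (\<forall>t\<in>support M. exponent_fun M t = r k t)" for k :: nat
  proof -
    have "(1/2)^k \<le> (1::real)" by (simp add: power_le_one)
    then obtain M where "standard_form M" "support M \<subseteq> {0..1}" "measure unit_leb ({0..1} - support M) < (1/2)^k"
      "\<And>t. t \<in> support M \<Longrightarrow> exponent_fun M t = r k t"
      using simple_seminorm_approx[OF rm Gf rG r1, of "(1/2)^k" k] by auto
    then show ?thesis by blast
  qed
  then obtain M where M: "\<And>k. standard_form (M k)" "\<And>k. support (M k) \<subseteq> {0..1}"
    "\<And>k. measure unit_leb ({0..1} - support (M k)) < (1/2)^k"
    "\<And>k t. t \<in> support (M k) \<Longrightarrow> exponent_fun (M k) t = r k t" by metis
  have ev: "AE t in unit_leb. \<forall>\<^sub>F k in sequentially. t \<in> support (M k)"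
  proof -
    have "AE t in unit_leb. \<forall>\<^sub>F k in sequentially. t \<in> space unit_leb - ({0..1} - support (M k))"
    proof (rule borel_cantelli_AE1)
      fix k
      have "support (M k) \<inter> {0..1} \<in> sets unit_leb"
        by (intro sets_unit_leb_borel support_measurable standard_form_admissible M)
      then have "space unit_leb - support (M k) \<inter> {0..1} \<in> sets unit_leb" by (rule sets.compl_sets)
      moreover have "space unit_leb - support (M k) \<inter> {0..1} = {0..1} - support (M k)" by auto
      ultimately show s: "{0..1} - support (M k) \<in> sets unit_leb" by simp
      show "emeasure unit_leb ({0..1} - support (M k)) < \<infinity>"
        using finite_measure.emeasure_finite[OF finite_measure_unit_leb] by (simp add: less_top)
    next
      show "summable (\<lambda>k. measure unit_leb ({0..1} - support (M k)))"
        by (rule summable_comparison_test[of _ "\<lambda>k. (1/2)^k"])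
          (use M(3) in \<open>auto intro!: exI[of _ 0] less_imp_le\<close>)
    qed
    then show ?thesis
      by eventually_elim (auto elim: eventually_mono)
  qed
  have below: "M k \<in> simple_below p" for k
  proof -
    have "AE t in unit_leb. exponent_fun (M k) t \<le> p t"
      using AE_in_unit_interval
    proof eventually_elim
      case (elim t)
      then have "1 \<le> p t" using p1 by simp
      then show ?case
        using \<rho>(2)[of k "p t"] M(4)[of t k] exponent_fun_notin[of t "M k"]
        by (cases "t \<in> support (M k)") (auto simp: r_def)
    qed
    then show ?thesis using M(1) by (simp add: simple_below_def)
  qed
  have conv: "AE t in unit_leb. (\<lambda>k. exponent_fun (M k) t) \<longlonglongrightarrow> p t"
    using ev AE_in_unit_interval
  proof eventually_elim
    case (elim t)
    have pt: "1 \<le> p t" using elim p1 by simp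
    obtain k0 :: nat where k0: "p t \<le> real k0" using real_arch_simple by blast
    \<comment> \<open>Once \<open>k0 \<le> k\<close>, the grid reaches above \<open>p t\<close>, so
      the grid point just below \<open>p t\<close> is closer than the mesh.\<close>
    have lower: "p t - 1 / real (Suc k) \<le> r k t" if k: "k0 \<le> k" for k
    proof -
      define i where "i = nat \<lfloor>(p t - 1) * real (Suc k)\<rfloor>"
      have nn: "0 \<le> (p t - 1) * real (Suc k)" using pt by simp
      have i: "real i \<le> (p t - 1) * real (Suc k)" "(p t - 1) * real (Suc k) < real i + 1"
        using nn unfolding i_def by linarith+
      have "(p t - 1) * real (Suc k) \<le> real (Suc k) * real (Suc k)"
        using k0 k pt by (intro mult_right_mono) auto
      then have "real i \<le> real (Suc k * Suc k)" using i(1) unfolding of_nat_mult by linarith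
      then have "i \<le> Suc k * Suc k" unfolding of_nat_le_iff .
      then have inG: "1 + real i / real (Suc k) \<in> G k" by (auto simp: G_def)
      have "real i / real (Suc k) \<le> p t - 1" using i(1) by (simp add: divide_le_eq del: of_nat_Suc)
      then have "1 + real i / real (Suc k) \<le> r k t" unfolding r_def using pt by (intro \<rho>ge inG) auto
      moreover have "p t - 1 < (real i + 1) / real (Suc k)" using i(2) by (simp add: less_divide_eq del: of_nat_Suc)
      ultimately show ?thesis by (simp add: add_divide_distrib del: of_nat_Suc)
    qed
    show ?case
    proof (rule tendsto_sandwich)
      show "\<forall>\<^sub>F k in sequentially. p t - 1 / real (Suc k) \<le> exponent_fun (M k) t"
        using elim(1) eventually_ge_at_top[of k0]
        by eventually_elim (use lower M(4) in auto)
      show "\<forall>\<^sub>F k in sequentially. exponent_fun (M k) t \<le> p t"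
        using elim(1) by eventually_elim (use \<rho>(2)[of _ "p t"] M(4) pt in \<open>auto simp: r_def\<close>)
      show "(\<lambda>k. p t - 1 / real (Suc k)) \<longlonglongrightarrow> p t"
        using tendsto_diff[OF tendsto_const LIMSEQ_inverse_real_of_nat, of "p t"] by (simp add: inverse_eq_divide)
    qed simp
  qed
  show ?thesis
  proof (rule that[OF below ev conv])
    fix k t g assume "t \<in> support (M k)" "g \<in> G0" "1 \<le> g" "g \<le> p t"
    then show "g \<le> exponent_fun (M k) t"
      unfolding M(4)[OF \<open>t \<in> support (M k)\<close>] r_def by (intro \<rho>ge) (auto simp: G_def)
  qed
qed

lemma simple_belowD:
  "N \<in> simple_below p \<Longrightarrow> standard_form N" "N \<in> simple_below p \<Longrightarrow> AE t in unit_leb. exponent_fun N t \<le> p t"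
  "N \<in> simple_below p \<Longrightarrow> admissible N"
  by (auto simp: simple_below_def standard_form_admissible)

text \<open>On a finite measure space convergence almost everywhere implies convergence in measure,
  here by dominated convergence for the indicators of the exceptional sets.\<close>

lemma filterlim_in_measure_filter:
  assumes pm: "p \<in> borel_measurable unit_leb" and M: "\<And>k. M k \<in> simple_below p"
    and conv: "AE t in unit_leb. (\<lambda>k. exponent_fun (M k) t) \<longlonglongrightarrow> p t"
  shows "filterlim M (in_measure_filter p) sequentially"
  unfolding in_measure_filter_def filterlim_INF
proof (intro ballI, clarify)
  fix \<epsilon> \<delta> :: real assume e: "0 < \<epsilon>" "0 < \<delta>"
  define A where "A = (\<lambda>k. {t\<in>{0..1}. \<epsilon> < \<bar>exponent_fun (M k) t - p t\<bar>})"
  have [measurable]: "exponent_fun (M k) \<in> borel_measurable unit_leb" for k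
    using simple_belowD(3)[OF M] by (rule exponent_fun_measurable')
  note [measurable] = pm
  have "{t\<in>space unit_leb. \<epsilon> < \<bar>exponent_fun (M k) t - p t\<bar>} \<in> sets unit_leb" for k by measurable
  then have As: "A k \<in> sets unit_leb" for k by (simp add: A_def)
  have "(\<lambda>k. \<integral>t. indicator (A k) t \<partial>unit_leb) \<longlonglongrightarrow> (\<integral>t. 0 \<partial>unit_leb :: real)"
  proof (rule integral_dominated_convergence[where w="\<lambda>_. 1"])
    show "AE t in unit_leb. (\<lambda>k. indicator (A k) t) \<longlonglongrightarrow> (0::real)"
      using conv
    proof eventually_elim
      case (elim t)
      have "\<forall>\<^sub>F k in sequentially. dist (exponent_fun (M k) t) (p t) < \<epsilon>"
        using tendstoD[OF elim e(1)] .
      then have "\<forall>\<^sub>F k in sequentially. indicator (A k) t = (0::real)"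
        by eventually_elim (auto simp: A_def dist_real_def)
      then show ?case by (rule tendsto_eventually)
    qed
    show "integrable unit_leb (\<lambda>_. 1::real)" by (rule finite_measure.integrable_const[OF finite_measure_unit_leb])
    show "(indicator (A k) :: real \<Rightarrow> real) \<in> borel_measurable unit_leb" for k
      using As by (rule borel_measurable_indicator)
    show "AE t in unit_leb. norm (indicator (A k) t :: real) \<le> 1" for k
      by (rule AE_I2) (simp add: indicator_def)
  qed simp
  moreover have "(\<integral>t. indicator (A k) t \<partial>unit_leb) = measure unit_leb (A k)" for k
  proof -
    have "A k \<inter> {0..1} = A k" by (auto simp: A_def)
    then show ?thesis by simp
  qed
  ultimately have "(\<lambda>k. measure unit_leb (A k)) \<longlonglongrightarrow> 0" by simp
  then have "\<forall>\<^sub>F k in sequentially. measure unit_leb (A k) < \<delta>"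
    using e(2) by (rule order_tendstoD)
  then show "filterlim M (principal {N \<in> simple_below p. measure unit_leb {t \<in> {0..1}. \<epsilon> < \<bar>exponent_fun N t - p t\<bar>} < \<delta>}) sequentially"
    unfolding filterlim_principal by eventually_elim (use M in \<open>simp add: A_def\<close>)
qed

text \<open>Reciprocals of exponents are bounded by 1, so dominated convergence covers unbounded
  \<open>p\<close> as well. This makes the weights continuous along approximations.\<close>

lemma inverse_exponent_tendsto:
  fixes e :: "nat \<Rightarrow> real \<Rightarrow> real"
  assumes em: "\<And>k. e k \<in> borel_measurable unit_leb" and e1: "\<And>k t. t \<in> {0..1} \<Longrightarrow> 1 \<le> e k t"
    and pm: "p \<in> borel_measurable unit_leb" and p1: "\<And>t. t \<in> {0..1} \<Longrightarrow> 1 \<le> p t"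
    and conv: "AE t in unit_leb. (\<lambda>k. e k t) \<longlonglongrightarrow> p t"
  shows "(\<lambda>k. \<integral>t. 1 / e k t \<partial>unit_leb) \<longlonglongrightarrow> (\<integral>t. 1 / p t \<partial>unit_leb)"
proof (rule integral_dominated_convergence[where w="\<lambda>_. 1"])
  note [measurable] = em pm
  show "(\<lambda>t. 1 / p t) \<in> borel_measurable unit_leb" by measurable
  show "(\<lambda>t. 1 / e k t) \<in> borel_measurable unit_leb" for k by measurable
  show "integrable unit_leb (\<lambda>_. 1::real)" by (rule finite_measure.integrable_const[OF finite_measure_unit_leb])
  show "AE t in unit_leb. norm (1 / e k t) \<le> 1" for k
  proof (rule AE_I2)
    fix t assume "t \<in> space unit_leb"
    then have "1 \<le> e k t" using e1 by simp
    then show "norm (1 / e k t) \<le> 1" by simp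
  qed
  show "AE t in unit_leb. (\<lambda>k. 1 / e k t) \<longlonglongrightarrow> 1 / p t"
    using conv AE_in_unit_interval
  proof eventually_elim
    case (elim t)
    then have "1 \<le> p t" using p1 by simp
    then show ?case using elim by (intro tendsto_divide tendsto_const) auto
  qed
qed

section \<open>Representatives of classes of functions\<close>

lemma rep_L0_measurable [measurable]: "rep_L0 f \<in> borel_measurable unit_leb"
  using Quotient_rep_reflp[OF Quotient_L0, of f] by (simp add: ae_eq_rel_def)

lemma rep_abs_L0: "g \<in> borel_measurable unit_leb \<Longrightarrow> AE t in unit_leb. rep_L0 (abs_L0 g) t = g t"
  using Quotient_rep_abs[OF Quotient_L0, of g] by (simp add: ae_eq_rel_def)

lemma abs_rep_L0: "abs_L0 (rep_L0 f) = f"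
  by (rule Quotient_abs_rep[OF Quotient_L0])

lemma L0_eqI: "AE t in unit_leb. rep_L0 f t = rep_L0 g t \<Longrightarrow> f = g"
  using Quotient_rel_rep[OF Quotient_L0, of f g] by (simp add: ae_eq_rel_def rep_L0_measurable)

lemma ae_eq_rel_rep: "ae_eq_rel (rep_L0 f) (rep_L0 f)"
  by (simp add: ae_eq_rel_def)

lemma rep_L0_zero: "AE t in unit_leb. rep_L0 0 t = 0"
  unfolding zero_L0_def by (rule rep_abs_L0) simp

lemma rep_L0_minus: "AE t in unit_leb. rep_L0 (f - g) t = rep_L0 f t - rep_L0 g t"
  using minus_L0.abs_eq[OF ae_eq_rel_rep[of f] ae_eq_rel_rep[of g]] rep_abs_L0[of "\<lambda>t. rep_L0 f t - rep_L0 g t"]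
  by (simp add: abs_rep_L0)

lemma rep_L0_plus: "AE t in unit_leb. rep_L0 (f + g) t = rep_L0 f t + rep_L0 g t"
  using plus_L0.abs_eq[OF ae_eq_rel_rep[of f] ae_eq_rel_rep[of g]] rep_abs_L0[of "\<lambda>t. rep_L0 f t + rep_L0 g t"]
  by (simp add: abs_rep_L0)

lemma rep_L0_scale: "AE t in unit_leb. rep_L0 (c *\<^sub>R f) t = c * rep_L0 f t"
  using scaleR_L0.abs_eq[OF ae_eq_rel_rep[of f], of c] rep_abs_L0[of "\<lambda>t. c * rep_L0 f t"]
  by (simp add: abs_rep_L0)

lemma rep_L0_times_abs:
  assumes "g \<in> borel_measurable unit_leb"
  shows "AE t in unit_leb. rep_L0 (abs_L0 g * f) t = g t * rep_L0 f t"
proof -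
  note [measurable] = assms
  have "ae_eq_rel g g" using assms by (simp add: ae_eq_rel_def)
  from times_L0.abs_eq[OF this ae_eq_rel_rep[of f]] show ?thesis
    using rep_abs_L0[of "\<lambda>t. g t * rep_L0 f t"] by (simp add: abs_rep_L0)
qed

lemma Lp_seminorm_eq: "Lp_seminorm q K f = Lp_norm q K (\<lambda>t. ennreal \<bar>rep_L0 f t\<bar>)"
proof -
  have "Lp_seminorm q K (abs_L0 (rep_L0 f)) = Lp_norm q K (\<lambda>t. ennreal \<bar>rep_L0 f t\<bar>)"
    unfolding Lp_seminorm.abs_eq[OF ae_eq_rel_rep] Lp_norm_def
    by (intro arg_cong2[where f=ennpowr] nn_integral_cong refl) (simp add: indicator_def)
  then show ?thesis by (simp add: abs_rep_L0)
qed

text \<open>Starting the fold at 0 instead of at the first semi-norm changes nothing, because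
  \<open>boxplus q 0 b = b\<close>.\<close>

lemma simple_norm_eq:
  assumes "admissible N"
  shows "simple_norm N f = fold_norm 0 N (\<lambda>t. ennreal \<bar>rep_L0 f t\<bar>)"
proof (cases N)
  case (Cons Kq N')
  then show ?thesis using assms by (cases Kq) (simp add: Lp_seminorm_eq fold_norm_def)
qed simp

section \<open>The limit superior norm as a supremum\<close>

text \<open>The weight makes the semi-norms monotone in their exponent functions and tends to 1 along
  \<open>in_measure_filter p\<close>.\<close>

definition weight :: "(real \<Rightarrow> real) \<Rightarrow> simple_seminorm \<Rightarrow> real" where
  "weight p N = exp (\<integral>t. 1 / p t - 1 / exponent_fun N t \<partial>unit_leb)"

definition rho_sup :: "(real \<Rightarrow> real) \<Rightarrow> (real \<Rightarrow> ennreal) \<Rightarrow> ennreal" where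
  "rho_sup p h = (SUP N\<in>simple_below p. ennreal (weight p N) * fold_norm 0 N h)"

lemma weight_pos: "0 < weight p N" by (simp add: weight_def)

lemma rho_sup_upper: "N \<in> simple_below p \<Longrightarrow> ennreal (weight p N) * fold_norm 0 N h \<le> rho_sup p h"
  unfolding rho_sup_def by (rule SUP_upper)

lemma rho_sup_mono: "AE t in unit_leb. h t \<le> k t \<Longrightarrow> rho_sup p h \<le> rho_sup p k"
  unfolding rho_sup_def
  by (intro SUP_subset_mono order_refl mult_left_mono fold_norm_mono) (auto dest: simple_belowD(3))

lemma rho_sup_cong: "AE t in unit_leb. h t = k t \<Longrightarrow> rho_sup p h = rho_sup p k"
  by (intro antisym rho_sup_mono) (auto elim: eventually_mono)

lemma rho_sup_triangle:
  assumes "h \<in> borel_measurable unit_leb" "k \<in> borel_measurable unit_leb"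
  shows "rho_sup p (\<lambda>t. h t + k t) \<le> rho_sup p h + rho_sup p k"
  unfolding rho_sup_def[of p "\<lambda>t. h t + k t"]
proof (rule SUP_least)
  fix N assume N: "N \<in> simple_below p"
  have "fold_norm 0 N (\<lambda>t. h t + k t) \<le> fold_norm 0 N h + fold_norm 0 N k"
    using fold_norm_triangle[OF assms simple_belowD(3)[OF N], of 0 0] by simp
  then have "ennreal (weight p N) * fold_norm 0 N (\<lambda>t. h t + k t)
      \<le> ennreal (weight p N) * fold_norm 0 N h + ennreal (weight p N) * fold_norm 0 N k"
    by (simp add: mult_left_mono flip: distrib_left)
  also have "\<dots> \<le> rho_sup p h + rho_sup p k" by (intro add_mono rho_sup_upper N)
  finally show "ennreal (weight p N) * fold_norm 0 N (\<lambda>t. h t + k t) \<le> rho_sup p h + rho_sup p k" .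
qed

lemma rho_sup_cmult:
  assumes "h \<in> borel_measurable unit_leb"
  shows "rho_sup p (\<lambda>t. c * h t) = c * rho_sup p h"
proof -
  have "ennreal (weight p N) * fold_norm 0 N (\<lambda>t. c * h t) = c * (ennreal (weight p N) * fold_norm 0 N h)"
    if "N \<in> simple_below p" for N
    using fold_norm_cmult[OF assms simple_belowD(3)[OF that], of c 0] by (simp add: mult_ac)
  then show ?thesis unfolding rho_sup_def by (simp add: SUP_mult_left_ennreal)
qed

text \<open>A supremum of functionals with the Fatou property inherits it.\<close>

lemma rho_sup_liminf:
  assumes m: "\<And>k. h k \<in> borel_measurable unit_leb"
  shows "rho_sup p (\<lambda>t. liminf (\<lambda>k. h k t)) \<le> liminf (\<lambda>k. rho_sup p (h k))"
  unfolding rho_sup_def[of p "\<lambda>t. liminf (\<lambda>k. h k t)"]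
proof (rule SUP_least)
  fix N assume N: "N \<in> simple_below p"
  note adm = simple_belowD(3)[OF N]
  let ?w = "ennreal (weight p N)"
  have lm: "(\<lambda>t. liminf (\<lambda>k. h k t)) \<in> borel_measurable unit_leb" using m by measurable
  have cm: "?w * fold_norm 0 N g = fold_norm 0 N (\<lambda>t. ?w * g t)" if "g \<in> borel_measurable unit_leb" for g
    using fold_norm_cmult[OF that adm, of ?w 0] by simp
  have "?w * fold_norm 0 N (\<lambda>t. liminf (\<lambda>k. h k t)) \<le> ?w * liminf (\<lambda>k. fold_norm 0 N (h k))"
    by (intro mult_left_mono fold_norm_liminf m adm) simp
  also have "\<dots> = (SUP n. ?w * (INF j\<in>{n..}. fold_norm 0 N (h j)))"
    by (simp add: liminf_SUP_INF SUP_mult_left_ennreal)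
  also have "\<dots> \<le> (SUP n. INF j\<in>{n..}. rho_sup p (h j))"
  proof (intro SUP_mono' INF_greatest)
    fix n j :: nat assume j: "j \<in> {n..}"
    have "?w * (INF j\<in>{n..}. fold_norm 0 N (h j)) \<le> ?w * fold_norm 0 N (h j)"
      by (intro mult_left_mono INF_lower j) simp
    also have "\<dots> \<le> rho_sup p (h j)" by (rule rho_sup_upper[OF N])
    finally show "?w * (INF j\<in>{n..}. fold_norm 0 N (h j)) \<le> rho_sup p (h j)" .
  qed
  finally show "?w * fold_norm 0 N (\<lambda>t. liminf (\<lambda>k. h k t)) \<le> liminf (\<lambda>k. rho_sup p (h k))"
    by (simp add: liminf_SUP_INF)
qed

text \<open>The semi-norm with support \<open>{0..1}\<close> and exponent 1 lies below every
  \<open>p\<close>, and its weight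
  \<open>exp ((\<integral>t. 1 / p t \<partial>unit_leb) - 1)\<close> is at least
  \<open>exp (-1)\<close>.\<close>

lemma rho_sup_ge_L1:
  assumes pm: "p \<in> borel_measurable unit_leb" and p1: "\<And>t. t \<in> {0..1} \<Longrightarrow> 1 \<le> p t"
  shows "ennreal (exp (-1)) * (\<integral>\<^sup>+t. h t \<partial>unit_leb) \<le> rho_sup p h"
proof -
  define N :: simple_seminorm where "N = [({0..1}, 1)]"
  have e: "exponent_fun N t = 1" for t by (simp add: N_def)
  have "AE t in unit_leb. exponent_fun N t \<le> p t"
    using AE_in_unit_interval by eventually_elim (use p1 e in auto)
  then have N: "N \<in> simple_below p" by (simp add: simple_below_def N_def standard_form_def)
  have ip: "integrable unit_leb (\<lambda>t. 1 / p t)" by (rule inverse_exponent_integrable[OF pm p1])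
  have i1: "integrable unit_leb (\<lambda>t. 1::real)" by (rule finite_measure.integrable_const[OF finite_measure_unit_leb])
  have "0 \<le> (\<integral>t. 1 / p t \<partial>unit_leb)"
  proof (rule integral_nonneg_AE)
    show "AE t in unit_leb. 0 \<le> 1 / p t" using AE_in_unit_interval by eventually_elim (use p1 in force)
  qed
  moreover have "(\<integral>t. 1 \<partial>unit_leb) = (1::real)" by (simp add: measure_def emeasure_unit_leb_UNIV)
  ultimately have "-1 \<le> (\<integral>t. 1 / p t - 1 / exponent_fun N t \<partial>unit_leb)"
    using Bochner_Integration.integral_diff[OF ip i1] by (simp add: e)
  then have "exp (-1) \<le> weight p N" by (simp add: weight_def)
  moreover have "fold_norm 0 N h = (\<integral>\<^sup>+t. h t \<partial>unit_leb)"
    by (simp add: N_def Lp_norm_def) (rule nn_integral_cong, simp)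
  ultimately have "ennreal (exp (-1)) * (\<integral>\<^sup>+t. h t \<partial>unit_leb) \<le> ennreal (weight p N) * fold_norm 0 N h"
    by (intro mult_mono ennreal_leI) auto
  also have "\<dots> \<le> rho_sup p h" by (rule rho_sup_upper[OF N])
  finally show ?thesis .
qed

lemma integral_inverse_diff:
  fixes p q :: "real \<Rightarrow> real"
  assumes "p \<in> borel_measurable unit_leb" "\<And>t. t \<in> {0..1} \<Longrightarrow> 1 \<le> p t"
    and "q \<in> borel_measurable unit_leb" "\<And>t. t \<in> {0..1} \<Longrightarrow> 1 \<le> q t"
  shows "(\<integral>t. 1 / p t - 1 / q t \<partial>unit_leb) = (\<integral>t. 1 / p t \<partial>unit_leb) - (\<integral>t. 1 / q t \<partial>unit_leb)"
  by (intro Bochner_Integration.integral_diff inverse_exponent_integrable assms)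

lemma weight_eq:
  assumes pm: "p \<in> borel_measurable unit_leb" and p1: "\<And>t. t \<in> {0..1} \<Longrightarrow> 1 \<le> p t" and N: "admissible N"
  shows "weight p N = exp ((\<integral>t. 1 / p t \<partial>unit_leb) - (\<integral>t. 1 / exponent_fun N t \<partial>unit_leb))"
proof -
  have "(\<integral>t. 1 / p t - 1 / exponent_fun N t \<partial>unit_leb) = (\<integral>t. 1 / p t \<partial>unit_leb) - (\<integral>t. 1 / exponent_fun N t \<partial>unit_leb)"
    by (rule integral_inverse_diff[OF pm p1 exponent_fun_measurable'[OF N] exponent_fun_ge1[OF N]])
  then show ?thesis by (simp add: weight_def)
qed

text \<open>The factor in \<open>fold_norm_le_ode\<close> is the reciprocal of the weight, so the
  two cancel for every semi-norm below \<open>p\<close>.\<close>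

lemma rho_sup_le_ode:
  assumes pm: "p \<in> borel_measurable unit_leb" and p1: "\<And>t. t \<in> {0..1} \<Longrightarrow> 1 \<le> p t"
    and f: "solves_ode p f x \<phi>" and x: "0 < x" and fm: "f \<in> borel_measurable unit_leb"
  shows "rho_sup p (\<lambda>t. ennreal \<bar>f t\<bar>) \<le> ennreal (\<phi> 1)"
  unfolding rho_sup_def
proof (rule SUP_least)
  fix N assume N: "N \<in> simple_below p"
  note std = simple_belowD(1)[OF N] and adm = simple_belowD(3)[OF N]
  note em = exponent_fun_measurable'[OF adm] and e1 = exponent_fun_ge1[OF adm]
  have \<phi>0: "0 \<le> \<phi> 1" using solves_ode_pos[OF f x, of 1] by simp
  have "fold_norm 0 N (\<lambda>t. ennreal \<bar>f t\<bar>) \<le> ennreal (exp (\<integral>t. 1 / exponent_fun N t - 1 / p t \<partial>unit_leb) * \<phi> 1)"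
    by (rule fold_norm_le_ode[OF std f x pm p1 em e1 fm simple_belowD(2)[OF N]]) auto
  then have "ennreal (weight p N) * fold_norm 0 N (\<lambda>t. ennreal \<bar>f t\<bar>)
      \<le> ennreal (weight p N) * ennreal (exp (\<integral>t. 1 / exponent_fun N t - 1 / p t \<partial>unit_leb) * \<phi> 1)"
    by (rule mult_left_mono) simp
  also have "\<dots> = ennreal (weight p N * exp (\<integral>t. 1 / exponent_fun N t - 1 / p t \<partial>unit_leb) * \<phi> 1)"
    using \<phi>0 weight_pos[of p N] by (simp add: mult.assoc flip: ennreal_mult)
  also have "weight p N * exp (\<integral>t. 1 / exponent_fun N t - 1 / p t \<partial>unit_leb) = 1"
  proof -
    have "(\<integral>t. 1 / exponent_fun N t - 1 / p t \<partial>unit_leb) = (\<integral>t. 1 / exponent_fun N t \<partial>unit_leb) - (\<integral>t. 1 / p t \<partial>unit_leb)"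
      by (rule integral_inverse_diff[OF em e1 pm p1])
    moreover have w: "weight p N = exp ((\<integral>t. 1 / p t \<partial>unit_leb) - (\<integral>t. 1 / exponent_fun N t \<partial>unit_leb))"
      by (rule weight_eq[OF pm p1 adm])
    ultimately show ?thesis by (simp flip: exp_add)
  qed
  finally show "ennreal (weight p N) * fold_norm 0 N (\<lambda>t. ennreal \<bar>f t\<bar>) \<le> ennreal (\<phi> 1)" by simp
qed

text \<open>Division by the weight; for exponents close to \<open>p\<close> in measure the factor is
  close to 1.\<close>

lemma fold_norm_le_rho_sup:
  assumes pm: "p \<in> borel_measurable unit_leb" and p1: "\<And>t. t \<in> {0..1} \<Longrightarrow> 1 \<le> p t"
    and N: "N \<in> simple_below p"
  shows "fold_norm 0 N h \<le> ennreal (exp ((\<integral>t. 1 / exponent_fun N t \<partial>unit_leb) - (\<integral>t. 1 / p t \<partial>unit_leb))) * rho_sup p h"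
proof -
  note adm = simple_belowD(3)[OF N]
  note em = exponent_fun_measurable'[OF adm] and e1 = exponent_fun_ge1[OF adm]
  let ?E = "exp ((\<integral>t. 1 / exponent_fun N t \<partial>unit_leb) - (\<integral>t. 1 / p t \<partial>unit_leb))"
  have w: "weight p N = exp ((\<integral>t. 1 / p t \<partial>unit_leb) - (\<integral>t. 1 / exponent_fun N t \<partial>unit_leb))"
    by (rule weight_eq[OF pm p1 adm])
  have "?E * weight p N = 1"
    unfolding w by (simp flip: exp_add)
  then have "fold_norm 0 N h = ennreal ?E * (ennreal (weight p N) * fold_norm 0 N h)"
    using weight_pos[of p N] by (simp flip: mult.assoc ennreal_mult)
  also have "\<dots> \<le> ennreal ?E * rho_sup p h" by (intro mult_left_mono rho_sup_upper N) simp
  finally show ?thesis .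
qed

text \<open>If the exponent of \<open>N\<close> is within \<open>\<eta>/2\<close> of
  \<open>p\<close> off a set of measure less than \<open>\<eta>/2\<close>, then the weight of
  \<open>N\<close> is at least \<open>exp (- \<eta>)\<close>, because
  \<open>1 / exponent_fun N t - 1 / p t\<close> is at most the distance of the exponents and at most
  1. Such \<open>N\<close> form a set of the filter, and \<open>\<eta>\<close> tends to 0.\<close>

lemma rho_le_rho_sup:
  assumes pm: "p \<in> borel_measurable unit_leb" and p1: "\<And>t. t \<in> {0..1} \<Longrightarrow> 1 \<le> p t"
  shows "rho p f \<le> rho_sup p (\<lambda>t. ennreal \<bar>rep_L0 f t\<bar>)"
proof -
  let ?S = "rho_sup p (\<lambda>t. ennreal \<bar>rep_L0 f t\<bar>)"
  have *: "rho p f \<le> ennreal (exp \<eta>) * ?S" if \<eta>: "0 < \<eta>" for \<eta>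
    unfolding rho_def
  proof (rule Limsup_bounded)
    let ?A = "{N \<in> simple_below p. measure unit_leb {t\<in>{0..1}. \<eta>/2 < \<bar>exponent_fun N t - p t\<bar>} < \<eta>/2}"
    have "eventually (\<lambda>N. N \<in> ?A) (in_measure_filter p)"
      unfolding in_measure_filter_def
      by (rule eventually_INF1[of "(\<eta>/2, \<eta>/2)"]) (use \<eta> in \<open>auto simp: eventually_principal\<close>)
    then show "\<forall>\<^sub>F N in in_measure_filter p. simple_norm N f \<le> ennreal (exp \<eta>) * ?S"
    proof eventually_elim
      case (elim N)
      define A where "A = {t\<in>{0..1}. \<eta>/2 < \<bar>exponent_fun N t - p t\<bar>}"
      have N: "N \<in> simple_below p" and mA: "measure unit_leb A < \<eta>/2" using elim by (auto simp: A_def)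
      note adm = simple_belowD(3)[OF N]
      note em = exponent_fun_measurable'[OF adm] and e1 = exponent_fun_ge1[OF adm]
      note [measurable] = em pm
      have "{t\<in>space unit_leb. \<eta>/2 < \<bar>exponent_fun N t - p t\<bar>} \<in> sets unit_leb" by measurable
      then have As: "A \<in> sets unit_leb" by (simp add: A_def)
      have iA: "integrable unit_leb (indicator A :: real \<Rightarrow> real)"
        by (rule integrable_real_indicator[OF As])
          (use finite_measure.emeasure_finite[OF finite_measure_unit_leb] in \<open>simp add: less_top\<close>)
      have ic: "integrable unit_leb (\<lambda>t. \<eta>/2)" by (rule finite_measure.integrable_const[OF finite_measure_unit_leb])
      have "(\<integral>t. 1 / exponent_fun N t - 1 / p t \<partial>unit_leb) \<le> (\<integral>t. \<eta>/2 + indicator A t \<partial>unit_leb)"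
      proof (rule integral_mono_AE)
        show "integrable unit_leb (\<lambda>t. 1 / exponent_fun N t - 1 / p t)"
          by (intro Bochner_Integration.integrable_diff inverse_exponent_integrable em e1 pm p1)
        show "integrable unit_leb (\<lambda>t. \<eta>/2 + indicator A t)"
          by (intro Bochner_Integration.integrable_add ic iA)
        show "AE t in unit_leb. 1 / exponent_fun N t - 1 / p t \<le> \<eta>/2 + indicator A t"
          using simple_belowD(2)[OF N] AE_in_unit_interval
        proof eventually_elim
          case (elim t)
          have pt: "1 \<le> p t" using elim p1 by simp
          have et: "1 \<le> exponent_fun N t" by (rule e1)
          show ?case
          proof (cases "t \<in> A")
            case True
            have "1 / exponent_fun N t \<le> 1" "0 \<le> 1 / p t" using pt et by auto
            then have "1 / exponent_fun N t - 1 / p t \<le> 1" by linarith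
            then show ?thesis using True \<eta> by simp
          next
            case False
            have "1 / exponent_fun N t - 1 / p t = (p t - exponent_fun N t) / (exponent_fun N t * p t)"
              using pt et by (simp add: field_simps)
            also have "\<dots> \<le> (p t - exponent_fun N t) / 1"
              using pt et elim mult_mono[OF et pt] by (intro divide_left_mono) auto
            also have "\<dots> \<le> \<eta>/2" using False elim by (auto simp: A_def)
            finally show ?thesis using False by simp
          qed
        qed
      qed
      also have "\<dots> = \<eta>/2 + measure unit_leb A"
      proof -
        have "A \<inter> {0..1} = A" by (auto simp: A_def)
        then show ?thesis using Bochner_Integration.integral_add[OF ic iA]
          by (simp add: measure_def[of unit_leb "{0..1}"] emeasure_unit_leb_UNIV)
      qed
      finally have "(\<integral>t. 1 / exponent_fun N t \<partial>unit_leb) - (\<integral>t. 1 / p t \<partial>unit_leb) \<le> \<eta>"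
        using mA integral_inverse_diff[of "exponent_fun N" p] em e1 pm p1 by simp
      then have "ennreal (exp ((\<integral>t. 1 / exponent_fun N t \<partial>unit_leb) - (\<integral>t. 1 / p t \<partial>unit_leb))) * ?S \<le> ennreal (exp \<eta>) * ?S"
        by (intro mult_right_mono ennreal_leI) auto
      then show "simple_norm N f \<le> ennreal (exp \<eta>) * ?S"
        unfolding simple_norm_eq[OF adm] using fold_norm_le_rho_sup[OF pm p1 N] by (rule order_trans[rotated])
    qed
  qed
  show ?thesis
  proof (cases "?S = top")
    case False
    then obtain s where s: "?S = ennreal s" "0 \<le> s" by (metis ennreal_cases)
    have le: "rho p f \<le> ennreal (exp (inverse (real (Suc n))) * s)" for n
      using *[of "inverse (real (Suc n))"] s by (simp add: ennreal_mult)
    have "(\<lambda>n. ennreal (exp (inverse (real (Suc n))) * s)) \<longlonglongrightarrow> ennreal (exp 0 * s)"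
      by (intro tendsto_ennrealI tendsto_mult tendsto_exp tendsto_const LIMSEQ_inverse_real_of_nat)
    then have "rho p f \<le> ennreal (exp 0 * s)"
      by (rule LIMSEQ_le_const) (use le in blast)
    then show ?thesis using s by simp
  qed simp
qed

text \<open>A semi-norm \<open>N\<close> below \<open>p\<close> is compared with semi-norms
  \<open>M k\<close> that tend to \<open>p\<close>. Their supports may miss parts of
  \<open>f\<close>, so \<open>f\<close> is first cut to \<open>support (M k)\<close>; there the
  exponent of \<open>M k\<close> dominates that of \<open>N\<close>, because the exponents of
  \<open>N\<close> are put into the grids. The comparison factors tend to \<open>weight p N\<close>,
  and Fatou's lemma restores \<open>f\<close>.\<close>

lemma rho_sup_le_rho:
  assumes pm: "p \<in> borel_measurable unit_leb" and p1: "\<And>t. t \<in> {0..1} \<Longrightarrow> 1 \<le> p t"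
  shows "rho_sup p (\<lambda>t. ennreal \<bar>rep_L0 f t\<bar>) \<le> rho p f"
  unfolding rho_sup_def
proof (rule SUP_least)
  fix N assume N: "N \<in> simple_below p"
  note std = simple_belowD(1)[OF N] and adm = simple_belowD(3)[OF N]
  note em = exponent_fun_measurable'[OF adm] and e1 = exponent_fun_ge1[OF adm]
  define g where "g = rep_L0 f"
  have gm: "g \<in> borel_measurable unit_leb" by (simp add: g_def)
  obtain M where M: "\<And>k. M k \<in> simple_below p"
    "AE t in unit_leb. \<forall>\<^sub>F k in sequentially. t \<in> support (M k)"
    "AE t in unit_leb. (\<lambda>k. exponent_fun (M k) t) \<longlonglongrightarrow> p t"
    "\<And>k t q. t \<in> support (M k) \<Longrightarrow> q \<in> snd ` set N \<Longrightarrow> 1 \<le> q \<Longrightarrow> q \<le> p t \<Longrightarrow> q \<le> exponent_fun (M k) t"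
    using approximating_sequence[OF pm p1, of "snd ` set N"] by auto
  note admM = simple_belowD(3)[OF M(1)]
  note eMm = exponent_fun_measurable'[OF admM] and eM1 = exponent_fun_ge1[OF admM]
  have sm: "(indicator (support (M k)) :: real \<Rightarrow> real) \<in> borel_measurable unit_leb" for k
    by (rule indicator_measurable_unit_leb[OF support_measurable[OF admM]])
  note [measurable] = gm em sm
  \<comment> \<open>\<open>exponent_fun N\<close> where \<open>M k\<close> dominates it, and 1 off
    \<open>support (M k)\<close>, where the exponent of \<open>M k\<close> is 1 as well.\<close>
  define q where "q = (\<lambda>k t. indicator (support (M k)) t * exponent_fun N t + (1 - indicator (support (M k)) t))"
  have qm: "q k \<in> borel_measurable unit_leb" for k unfolding q_def by measurable
  have q1: "1 \<le> q k t" for k t using e1 by (auto simp: q_def indicator_def)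
  have qc: "AE t in unit_leb. (\<lambda>k. q k t) \<longlonglongrightarrow> exponent_fun N t"
    using M(2)
  proof eventually_elim
    case (elim t)
    show ?case
      by (rule tendsto_eventually) (use elim in \<open>eventually_elim, simp add: q_def\<close>)
  qed
  define c where "c = (\<lambda>k. exp ((\<integral>t. 1 / exponent_fun (M k) t \<partial>unit_leb) - (\<integral>t. 1 / q k t \<partial>unit_leb)))"
  have c0: "0 < c k" for k by (simp add: c_def)
  have w: "weight p N = exp ((\<integral>t. 1 / p t \<partial>unit_leb) - (\<integral>t. 1 / exponent_fun N t \<partial>unit_leb))"
    by (rule weight_eq[OF pm p1 adm])
  have cc: "c \<longlonglongrightarrow> weight p N"
    unfolding c_def w
    by (intro tendsto_exp tendsto_diff inverse_exponent_tendsto qm q1 eMm eM1 pm p1 M(3) qc em e1)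
  define gk where "gk = (\<lambda>k t. g t * indicator (support (M k)) t)"
  have gkm [measurable]: "gk k \<in> borel_measurable unit_leb" for k unfolding gk_def by measurable
  have le: "fold_norm 0 N (\<lambda>t. ennreal (c k) * ennreal \<bar>gk k t\<bar>) \<le> simple_norm (M k) f" for k
  proof -
    have "fold_norm 0 N (\<lambda>t. ennreal \<bar>gk k t\<bar>)
      \<le> ennreal (exp (\<integral>t. 1 / q k t - 1 / exponent_fun (M k) t \<partial>unit_leb)) * fold_norm 0 (M k) (\<lambda>t. ennreal \<bar>g t\<bar>)"
    proof (rule fold_norm_compare[OF std simple_belowD(1)[OF M(1)] qm q1 gkm])
      show "AE t in unit_leb. q k t \<le> exponent_fun (M k) t"
        using simple_belowD(2)[OF N]
      proof eventually_elim
        case (elim t)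
        show ?case
        proof (cases "t \<in> support (M k)")
          case True
          have "exponent_fun N t \<le> exponent_fun (M k) t"
          proof (cases "t \<in> support N")
            case tN: True
            then have "exponent_fun N t \<in> snd ` set N" using exponent_fun_in[OF tN] by force
            then show ?thesis using M(4)[OF True _ e1 elim] by blast
          next
            case False
            then show ?thesis using eM1 by (simp add: exponent_fun_notin)
          qed
          then show ?thesis using True by (simp add: q_def)
        next
          case False
          then show ?thesis using eM1 by (simp add: q_def)
        qed
      qed
      show "t \<in> support (M k) \<and> q k t = exponent_fun N t" if "gk k t \<noteq> 0" for t
        using that by (auto simp: gk_def q_def indicator_def split: if_splits)
      show "AE t in unit_leb. \<bar>gk k t\<bar> \<le> \<bar>g t\<bar>"
        by (rule AE_I2) (simp add: gk_def indicator_def)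
    qed
    also have "exp (\<integral>t. 1 / q k t - 1 / exponent_fun (M k) t \<partial>unit_leb) = inverse (c k)"
    proof -
      have "(\<integral>t. 1 / q k t - 1 / exponent_fun (M k) t \<partial>unit_leb) = (\<integral>t. 1 / q k t \<partial>unit_leb) - (\<integral>t. 1 / exponent_fun (M k) t \<partial>unit_leb)"
        by (rule integral_inverse_diff[OF qm q1 eMm eM1])
      then show ?thesis by (simp add: c_def flip: exp_minus)
    qed
    also have "fold_norm 0 (M k) (\<lambda>t. ennreal \<bar>g t\<bar>) = simple_norm (M k) f"
      by (simp add: simple_norm_eq[OF admM] g_def)
    finally have "ennreal (c k) * fold_norm 0 N (\<lambda>t. ennreal \<bar>gk k t\<bar>)
       \<le> ennreal (c k) * (ennreal (inverse (c k)) * simple_norm (M k) f)"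
      by (rule mult_left_mono) simp
    also have "\<dots> = simple_norm (M k) f"
      using c0[of k] by (simp flip: mult.assoc ennreal_mult)
    also have "ennreal (c k) * fold_norm 0 N (\<lambda>t. ennreal \<bar>gk k t\<bar>) = fold_norm 0 N (\<lambda>t. ennreal (c k) * ennreal \<bar>gk k t\<bar>)"
      using fold_norm_cmult[OF _ adm, of "\<lambda>t. ennreal \<bar>gk k t\<bar>" "ennreal (c k)" 0] by simp
    finally show ?thesis .
  qed
  have "ennreal (weight p N) * fold_norm 0 N (\<lambda>t. ennreal \<bar>g t\<bar>) = fold_norm 0 N (\<lambda>t. ennreal (weight p N) * ennreal \<bar>g t\<bar>)"
    using fold_norm_cmult[OF _ adm, of "\<lambda>t. ennreal \<bar>g t\<bar>" "ennreal (weight p N)" 0] by simp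
  also have "\<dots> \<le> fold_norm 0 N (\<lambda>t. liminf (\<lambda>k. ennreal (c k) * ennreal \<bar>gk k t\<bar>))"
  proof (rule fold_norm_mono[OF adm order_refl])
    show "AE t in unit_leb. ennreal (weight p N) * ennreal \<bar>g t\<bar> \<le> liminf (\<lambda>k. ennreal (c k) * ennreal \<bar>gk k t\<bar>)"
      using M(2)
    proof eventually_elim
      case (elim t)
      have "(\<lambda>k. ennreal (c k * \<bar>g t\<bar>)) \<longlonglongrightarrow> ennreal (weight p N * \<bar>g t\<bar>)"
        by (intro tendsto_ennrealI tendsto_mult cc tendsto_const)
      moreover have "\<forall>\<^sub>F k in sequentially. ennreal (c k * \<bar>g t\<bar>) = ennreal (c k) * ennreal \<bar>gk k t\<bar>"
        using elim by eventually_elim (use c0 in \<open>simp add: gk_def ennreal_mult less_imp_le\<close>)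
      ultimately have "(\<lambda>k. ennreal (c k) * ennreal \<bar>gk k t\<bar>) \<longlonglongrightarrow> ennreal (weight p N * \<bar>g t\<bar>)"
        by (rule Lim_transform_eventually)
      then have "liminf (\<lambda>k. ennreal (c k) * ennreal \<bar>gk k t\<bar>) = ennreal (weight p N * \<bar>g t\<bar>)"
        by (intro lim_imp_Liminf) auto
      then show ?case using weight_pos[of p N] by (simp add: ennreal_mult less_imp_le)
    qed
  qed
  also have "\<dots> \<le> liminf (\<lambda>k. fold_norm 0 N (\<lambda>t. ennreal (c k) * ennreal \<bar>gk k t\<bar>))"
    by (rule fold_norm_liminf[OF _ adm]) measurable
  also have "\<dots> \<le> liminf (\<lambda>k. simple_norm (M k) f)"
    by (rule Liminf_mono) (use le in simp)
  \<comment> \<open>\<open>M\<close> tends to \<open>in_measure_filter p\<close>, so a limit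
    inferior along \<open>M\<close> is at most the limit superior of the filter.\<close>
  also have "\<dots> \<le> rho p f"
    unfolding rho_def Limsup_def
  proof (rule INF_greatest)
    fix P assume "P \<in> {P. eventually P (in_measure_filter p)}"
    then have "\<forall>\<^sub>F k in sequentially. P (M k)"
      using filterlim_in_measure_filter[OF pm M(1,3)] unfolding filterlim_iff by blast
    then have "\<forall>\<^sub>F k in sequentially. simple_norm (M k) f \<le> (SUP N\<in>Collect P. simple_norm N f)"
      by eventually_elim (auto intro: SUP_upper)
    then show "liminf (\<lambda>k. simple_norm (M k) f) \<le> (SUP N\<in>Collect P. simple_norm N f)"
      by (rule Liminf_le[rotated]) simp
  qed
  finally show "ennreal (weight p N) * fold_norm 0 N (\<lambda>t. ennreal \<bar>rep_L0 f t\<bar>) \<le> rho p f" by (simp add: g_def)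
qed

lemma rho_eq:
  assumes "p \<in> borel_measurable unit_leb" "\<And>t. t \<in> {0..1} \<Longrightarrow> 1 \<le> p t"
  shows "rho p f = rho_sup p (\<lambda>t. ennreal \<bar>rep_L0 f t\<bar>)"
  by (intro antisym rho_le_rho_sup rho_sup_le_rho assms)

section \<open>Existence of solutions\<close>

text \<open>Provides one majorant for the powers with all exponents \<open>e\<close> up to
  \<open>p\<close>.\<close>

lemma powr_le_one_add:
  fixes y e p :: real
  assumes "0 \<le> y" "0 \<le> e" "e \<le> p"
  shows "y powr e \<le> 1 + y powr p"
proof (cases "y \<le> 1")
  case True
  then have "y powr e \<le> 1" using assms by (intro powr_le1) auto
  then show ?thesis by (simp add: add_increasing2)
next
  case False
  then have "y powr e \<le> y powr p" using assms by (intro powr_mono) auto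
  then show ?thesis by simp
qed

text \<open>Integrability of \<open>\<bar>g\<bar> powr p\<close> is not given and has to be
  extracted from \<open>rho_sup\<close>. The solutions \<open>\<psi> k\<close> for approximating
  semi-norms are bounded by one constant \<open>D\<close>; inserting \<open>D\<close> for
  \<open>\<psi> k\<close> only lowers the right-hand sides, and Fatou's lemma bounds the integral of
  \<open>ode_rhs p g (\<lambda>_. D)\<close>. As \<open>p \<le> n\<close> where \<open>g\<close> is
  nonzero, this controls \<open>\<bar>g\<bar> powr p\<close>. The bound \<open>x + C\<close> then
  follows from \<open>solves_ode_stable\<close>, with the error taken along the single function
  \<open>\<phi>\<close>.\<close>

lemma solves_ode_if_bounded_exponent:
  fixes n C :: real
  assumes pm: "p \<in> borel_measurable unit_leb" and p1: "\<And>t. t \<in> {0..1} \<Longrightarrow> 1 \<le> p t"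
    and gm: "g \<in> borel_measurable unit_leb" and bnd: "\<And>t. t \<in> {0..1} \<Longrightarrow> g t \<noteq> 0 \<Longrightarrow> p t \<le> n"
    and rho: "rho_sup p (\<lambda>t. ennreal \<bar>g t\<bar>) \<le> ennreal C" and C: "0 \<le> C" and x: "0 < x"
  obtains \<phi> where "solves_ode p g x \<phi>" "\<phi> 1 \<le> x + C"
proof -
  obtain M :: "nat \<Rightarrow> simple_seminorm" where M: "\<And>k. M k \<in> simple_below p"
    "AE t in unit_leb. \<forall>\<^sub>F k in sequentially. t \<in> support (M k)"
    "AE t in unit_leb. (\<lambda>k. exponent_fun (M k) t) \<longlonglongrightarrow> p t"
    using approximating_sequence[OF pm p1, of "{}"] by auto
  define e where "e = (\<lambda>k. exponent_fun (M k))"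
  note adm = simple_belowD(3)[OF M(1)] and std = simple_belowD(1)[OF M(1)]
  have em: "e k \<in> borel_measurable unit_leb" and e1: "1 \<le> e k t" for k t
    unfolding e_def using exponent_fun_measurable'[OF adm] exponent_fun_ge1[OF adm] by auto
  have ep: "AE t in unit_leb. e k t \<le> p t" for k unfolding e_def by (rule simple_belowD(2)[OF M(1)])
  have sm: "(indicator (support (M k)) :: real \<Rightarrow> real) \<in> borel_measurable unit_leb" for k
    by (rule indicator_measurable_unit_leb[OF support_measurable[OF adm]])
  note [measurable] = gm em sm pm
  define gk where "gk = (\<lambda>k t. (g t * (if \<bar>g t\<bar> \<le> real k then 1 else 0)) * indicator (support (M k)) t)"
  have gkm [measurable]: "gk k \<in> borel_measurable unit_leb" for k unfolding gk_def by measurable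
  have gkb: "\<bar>gk k t\<bar> \<le> real k" for k t by (auto simp: gk_def indicator_def)
  have gkg: "\<bar>gk k t\<bar> \<le> \<bar>g t\<bar>" for k t by (auto simp: gk_def indicator_def)
  have gklim: "AE t in unit_leb. \<forall>\<^sub>F k in sequentially. gk k t = g t"
    using M(2)
  proof eventually_elim
    case (elim t)
    obtain k0 :: nat where k0: "\<bar>g t\<bar> \<le> real k0" using real_arch_simple by blast
    show ?case
      using elim eventually_ge_at_top[of k0] by eventually_elim (use k0 in \<open>simp add: gk_def\<close>)
  qed
  have ex: "\<exists>\<psi>. solves_ode (e k) (gk k) x \<psi>" for k
  proof -
    obtain b where b: "\<And>t. e k t \<le> b" using exponent_fun_bounded[of "M k"] unfolding e_def by blast
    have "integrable unit_leb (\<lambda>t. \<bar>gk k t\<bar> powr e k t)"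
      by (rule bounded_powr_integrable[OF em e1 gkm gkb b])
    then show ?thesis by (rule solves_ode_exists[OF em e1 gkm b _ x])
  qed
  then obtain \<psi> where \<psi>: "\<And>k. solves_ode (e k) (gk k) x (\<psi> k)" by metis
  \<comment> \<open>The reciprocal of \<open>weight p (M k)\<close>, which tends to 1.\<close>
  define E where "E = (\<lambda>k. exp ((\<integral>t. 1 / e k t \<partial>unit_leb) - (\<integral>t. 1 / p t \<partial>unit_leb)))"
  have \<psi>1: "\<psi> k 1 \<le> x + E k * C" for k
  proof -
    have "ennreal (\<psi> k 1) = fold_norm (ennreal x) (M k) (\<lambda>t. ennreal \<bar>gk k t\<bar>)"
      by (rule fold_norm_path[OF std x \<psi>[of k, unfolded e_def], symmetric]) (simp add: gk_def)
    also have "\<dots> \<le> ennreal x + fold_norm 0 (M k) (\<lambda>t. ennreal \<bar>gk k t\<bar>)"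
      by (rule fold_norm_le_add[OF _ adm]) measurable
    also have "fold_norm 0 (M k) (\<lambda>t. ennreal \<bar>gk k t\<bar>) \<le> fold_norm 0 (M k) (\<lambda>t. ennreal \<bar>g t\<bar>)"
      by (rule fold_norm_mono[OF adm order_refl AE_I2]) (use gkg in \<open>auto intro: ennreal_leI\<close>)
    also have "\<dots> \<le> ennreal (E k) * rho_sup p (\<lambda>t. ennreal \<bar>g t\<bar>)"
      unfolding E_def e_def by (rule fold_norm_le_rho_sup[OF pm p1 M(1)])
    also have "\<dots> \<le> ennreal (E k) * ennreal C" by (rule mult_left_mono[OF rho]) simp
    also have "ennreal x + ennreal (E k) * ennreal C = ennreal (x + E k * C)"
      using x C by (simp add: E_def flip: ennreal_mult)
    finally have "ennreal (\<psi> k 1) \<le> ennreal (x + E k * C)" by (simp add: add_left_mono)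
    moreover have "0 \<le> x + E k * C" using x C by (simp add: E_def)
    ultimately show ?thesis by (subst (asm) ennreal_le_iff) auto
  qed
  have Elim: "E \<longlonglongrightarrow> 1"
  proof -
    have "E \<longlonglongrightarrow> exp ((\<integral>t. 1 / p t \<partial>unit_leb) - (\<integral>t. 1 / p t \<partial>unit_leb))"
      unfolding E_def
      by (intro tendsto_exp tendsto_diff tendsto_const inverse_exponent_tendsto em e1 pm p1)
        (assumption, unfold e_def, rule M(3))
    then show ?thesis by simp
  qed
  then have "Bseq E" by (rule convergent_imp_Bseq[OF convergentI])
  then obtain B where B: "0 < B" "\<And>k. \<bar>E k\<bar> \<le> B" by (auto simp: Bseq_def)
  \<comment> \<open>\<open>B\<close> bounds the factors \<open>E k\<close>; the summand 1 gives
    \<open>1 \<le> D\<close>, so that powers of \<open>D\<close> increase with the exponent.\<close>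
  define D where "D = 1 + x + B * C"
  have D1: "1 \<le> D" using x B C by (simp add: D_def)
  have \<psi>D: "\<psi> k t \<le> D" if t: "t \<in> {0..1}" for k t
  proof -
    have "\<psi> k t \<le> \<psi> k 1" using primitive_mono[OF \<psi>[of k, unfolded solves_ode_def], of t 1] t by simp
    also have "\<dots> \<le> x + E k * C" by (rule \<psi>1)
    also have "\<dots> \<le> x + B * C" using B(2)[of k] C by (simp add: mult_right_mono)
    finally show ?thesis by (simp add: D_def)
  qed
  define v where "v = (\<lambda>k t. ode_rhs (e k) (gk k) (\<lambda>_. D) t)"
  have vm [measurable]: "v k \<in> borel_measurable unit_leb" for k unfolding v_def by measurable
  have vint: "(\<integral>\<^sup>+t. ennreal (v k t) \<partial>unit_leb) \<le> ennreal D" for k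
  proof -
    have "(\<integral>\<^sup>+t. ennreal (v k t) \<partial>unit_leb) \<le> (\<integral>\<^sup>+t. ennreal (indicator {0..1} t * ode_rhs (e k) (gk k) (\<psi> k) t) \<partial>unit_leb)"
    proof (rule nn_integral_mono)
      fix t assume "t \<in> space unit_leb"
      then have t: "t \<in> {0..1}" by simp
      then show "ennreal (v k t) \<le> ennreal (indicator {0..1} t * ode_rhs (e k) (gk k) (\<psi> k) t)"
        unfolding v_def using ode_rhs_antimono[of "e k" t "\<psi> k" "\<lambda>_. D" "gk k"] e1 solves_ode_pos[OF \<psi> x t] \<psi>D[OF t]
        by (simp add: ennreal_leI)
    qed
    also have "\<dots> = ennreal (\<psi> k 1 - x)"
      by (rule primitive_nn[OF \<psi>[unfolded solves_ode_def]]) simp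
    also have "\<dots> \<le> ennreal D" using \<psi>D[of 1 k] x by (intro ennreal_leI) auto
    finally show ?thesis .
  qed
  have vlim: "AE t in unit_leb. (\<lambda>k. v k t) \<longlonglongrightarrow> ode_rhs p g (\<lambda>_. D) t"
    using gklim M(3) AE_in_unit_interval
  proof eventually_elim
    case (elim t)
    then have pt: "1 \<le> p t" using p1 by simp
    have "(\<lambda>k. ode_rhs (e k) g (\<lambda>_. D) t) \<longlonglongrightarrow> ode_rhs p g (\<lambda>_. D) t"
    proof (cases "g t = 0")
      case False
      show ?thesis unfolding ode_rhs_def
        by (intro tendsto_mult tendsto_divide tendsto_powr tendsto_const tendsto_diff)
          (use elim False pt D1 in \<open>auto simp: e_def\<close>)
    qed (simp add: ode_rhs_def)
    moreover have "\<forall>\<^sub>F k in sequentially. ode_rhs (e k) g (\<lambda>_. D) t = v k t"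
      using elim(1) by eventually_elim (simp add: v_def ode_rhs_def)
    ultimately show ?case by (rule Lim_transform_eventually)
  qed
  have int_D: "(\<integral>\<^sup>+t. ennreal (ode_rhs p g (\<lambda>_. D) t) \<partial>unit_leb) \<le> ennreal D"
  proof -
    have "(\<integral>\<^sup>+t. ennreal (ode_rhs p g (\<lambda>_. D) t) \<partial>unit_leb) = (\<integral>\<^sup>+t. liminf (\<lambda>k. ennreal (v k t)) \<partial>unit_leb)"
    proof (rule nn_integral_cong_AE)
      show "AE t in unit_leb. ennreal (ode_rhs p g (\<lambda>_. D) t) = liminf (\<lambda>k. ennreal (v k t))"
        using vlim
      proof eventually_elim
        case (elim t)
        then have "(\<lambda>k. ennreal (v k t)) \<longlonglongrightarrow> ennreal (ode_rhs p g (\<lambda>_. D) t)" by (rule tendsto_ennrealI)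
        then show ?case by (intro lim_imp_Liminf[symmetric]) auto
      qed
    qed
    also have "\<dots> \<le> liminf (\<lambda>k. \<integral>\<^sup>+t. ennreal (v k t) \<partial>unit_leb)"
      by (rule nn_integral_liminf) measurable
    also have "\<dots> \<le> ennreal D" by (rule Liminf_le) (use vint in auto)
    finally show ?thesis .
  qed
  have int_g: "integrable unit_leb (\<lambda>t. \<bar>g t\<bar> powr p t)"
  proof (rule Bochner_Integration.integrable_bound)
    have "integrable unit_leb (ode_rhs p g (\<lambda>_. D))"
    proof (rule integrableI_nonneg)
      show "AE t in unit_leb. 0 \<le> ode_rhs p g (\<lambda>_. D) t"
        using AE_in_unit_interval by eventually_elim (use ode_rhs_nonneg p1 in auto)
      show "(\<integral>\<^sup>+t. ennreal (ode_rhs p g (\<lambda>_. D) t) \<partial>unit_leb) < \<infinity>"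
        using int_D by (simp add: le_less_trans)
    qed measurable
    \<comment> \<open>The constant undoes the division by \<open>p\<close> and the power of
      \<open>D\<close> in \<open>ode_rhs\<close>, uniformly for exponents between 1 and
      \<open>n\<close>.\<close>
    then show "integrable unit_leb (\<lambda>t. (n * D powr (n - 1)) * ode_rhs p g (\<lambda>_. D) t)"
      by (rule integrable_mult_right)
    show "AE t in unit_leb. norm (\<bar>g t\<bar> powr p t) \<le> norm ((n * D powr (n - 1)) * ode_rhs p g (\<lambda>_. D) t)"
      using AE_in_unit_interval
    proof eventually_elim
      case (elim t)
      then have t: "t \<in> {0..1}" by simp
      show ?case
      proof (cases "g t = 0")
        case False
        have pn: "1 \<le> p t" "p t \<le> n" using p1[OF t] bnd[OF t False] by auto
        have "\<bar>g t\<bar> powr p t = p t * D powr (p t - 1) * ode_rhs p g (\<lambda>_. D) t"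
          using pn D1 unfolding ode_rhs_def by (simp add: powr_diff)
        also have "\<dots> \<le> n * D powr (n - 1) * ode_rhs p g (\<lambda>_. D) t"
          using pn D1 ode_rhs_nonneg[of p t g "\<lambda>_. D"] by (intro mult_right_mono mult_mono powr_mono) auto
        finally show ?thesis using pn ode_rhs_nonneg[of p t g "\<lambda>_. D"] by simp
      qed simp
    qed
  qed measurable
  obtain \<phi> where \<phi>: "solves_ode p g x \<phi>"
    using solves_ode_exists[OF pm p1 gm bnd int_g x] by blast
  have \<phi>m [measurable]: "\<phi> \<in> borel_measurable unit_leb"
    using \<phi> by (auto simp: solves_ode_def intro: primitive_measurable)
  have \<phi>x: "x \<le> \<phi> t" if "t \<in> {0..1}" for t
    using \<phi> that by (auto simp: solves_ode_def intro: primitive_ge)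
  \<comment> \<open>Common majorant for \<open>p\<close> and all exponents \<open>e k\<close>: as
    \<open>e k \<le> p\<close> almost everywhere, \<open>\<bar>g\<bar> powr e k\<close> is at most
    \<open>1 + \<bar>g\<bar> powr p\<close>.\<close>
  define w where "w = (\<lambda>t. (1 + x powr (1 - n)) * (1 + \<bar>g t\<bar> powr p t))"
  have wi: "integrable unit_leb w" unfolding w_def
    by (intro integrable_mult_right Bochner_Integration.integrable_add int_g
        finite_measure.integrable_const[OF finite_measure_unit_leb])
  have rp: "AE t in unit_leb. \<bar>ode_rhs p g \<phi> t\<bar> \<le> w t"
    using AE_in_unit_interval
  proof eventually_elim
    case (elim t)
    then have t: "t \<in> {0..1}" by simp
    have "ode_rhs p g \<phi> t \<le> (1 + x powr (1 - n)) * \<bar>g t\<bar> powr p t"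
      by (rule ode_rhs_bound) (use x \<phi>x[OF t] p1[OF t] bnd[OF t] in auto)
    also have "\<dots> \<le> w t" unfolding w_def by (intro mult_left_mono) auto
    finally show ?case using ode_rhs_nonneg[of p t g \<phi>] p1[OF t] by simp
  qed
  have rk: "AE t in unit_leb. \<bar>ode_rhs (e k) (gk k) \<phi> t\<bar> \<le> w t" for k
    using AE_in_unit_interval ep[of k]
  proof eventually_elim
    case (elim t)
    then have t: "t \<in> {0..1}" by simp
    have "ode_rhs (e k) (gk k) \<phi> t \<le> (1 + x powr (1 - n)) * \<bar>gk k t\<bar> powr e k t"
    proof (rule ode_rhs_bound)
      show "0 < x" "x \<le> \<phi> t" "1 \<le> e k t" using x \<phi>x[OF t] e1 by auto
      assume "gk k t \<noteq> 0"
      then have "g t \<noteq> 0" using gkg[of k t] by auto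
      then show "e k t \<le> n" using bnd[OF t] elim by simp
    qed
    also have "\<bar>gk k t\<bar> powr e k t \<le> \<bar>g t\<bar> powr e k t"
      using gkg[of k t] e1[of k t] by (intro powr_mono2) auto
    also have "\<bar>g t\<bar> powr e k t \<le> 1 + \<bar>g t\<bar> powr p t"
      using e1[of k t] elim by (intro powr_le_one_add) auto
    finally have "ode_rhs (e k) (gk k) \<phi> t \<le> w t" by (simp add: w_def mult_left_mono)
    then show ?case using ode_rhs_nonneg[of "e k" t "gk k" \<phi>] e1[of k t] by simp
  qed
  have irp: "integrable unit_leb (ode_rhs p g \<phi>)"
    using \<phi> by (simp add: solves_ode_def primitive_def)
  have irk: "integrable unit_leb (ode_rhs (e k) (gk k) \<phi>)" for k
  proof (rule Bochner_Integration.integrable_bound[OF wi])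
    show "AE t in unit_leb. norm (ode_rhs (e k) (gk k) \<phi> t) \<le> norm (w t)"
      using rk[of k] by eventually_elim auto
  qed measurable
  define r where "r = (\<lambda>k t. \<bar>ode_rhs p g \<phi> t - ode_rhs (e k) (gk k) \<phi> t\<bar>)"
  have "(\<lambda>k. \<integral>t. r k t \<partial>unit_leb) \<longlonglongrightarrow> (\<integral>t. 0 \<partial>unit_leb)"
  proof (rule integral_dominated_convergence[where w="\<lambda>t. 2 * w t"])
    show "integrable unit_leb (\<lambda>t. 2 * w t)" by (rule integrable_mult_right[OF wi])
    show "r k \<in> borel_measurable unit_leb" for k unfolding r_def by measurable
    show "AE t in unit_leb. norm (r k t) \<le> 2 * w t" for k
      using rp rk[of k] by eventually_elim (simp add: r_def)
    show "AE t in unit_leb. (\<lambda>k. r k t) \<longlonglongrightarrow> 0"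
      using gklim M(3) AE_in_unit_interval
    proof eventually_elim
      case (elim t)
      then have t: "t \<in> {0..1}" by simp
      have pt: "1 \<le> p t" by (rule p1[OF t])
      have "(\<lambda>k. ode_rhs (e k) g \<phi> t) \<longlonglongrightarrow> ode_rhs p g \<phi> t"
      proof (cases "g t = 0")
        case False
        show ?thesis unfolding ode_rhs_def
          by (intro tendsto_mult tendsto_divide tendsto_powr tendsto_const tendsto_diff)
            (use elim False pt \<phi>x[OF t] x in \<open>auto simp: e_def\<close>)
      qed (simp add: ode_rhs_def)
      then have "(\<lambda>k. \<bar>ode_rhs p g \<phi> t - ode_rhs (e k) g \<phi> t\<bar>) \<longlonglongrightarrow> \<bar>ode_rhs p g \<phi> t - ode_rhs p g \<phi> t\<bar>"
        by (intro tendsto_rabs tendsto_diff tendsto_const)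
      moreover have "\<forall>\<^sub>F k in sequentially. \<bar>ode_rhs p g \<phi> t - ode_rhs (e k) g \<phi> t\<bar> = r k t"
        using elim(1) by eventually_elim (simp add: r_def ode_rhs_def)
      ultimately show ?case by (simp add: Lim_transform_eventually)
    qed
  qed simp
  then have rlim: "(\<lambda>k. \<integral>t. r k t \<partial>unit_leb) \<longlonglongrightarrow> 0" by simp
  have "\<phi> 1 \<le> x + E k * C + (\<integral>t. r k t \<partial>unit_leb)" for k
  proof -
    have "\<phi> 1 \<le> \<psi> k 1 + (\<integral>t. r k t \<partial>unit_leb)" unfolding r_def
      by (rule solves_ode_stable[OF \<phi> \<psi> x order_refl e1 Bochner_Integration.integrable_diff[OF irp irk]]) auto
    then show ?thesis using \<psi>1[of k] by simp
  qed
  moreover have "(\<lambda>k. x + E k * C + (\<integral>t. r k t \<partial>unit_leb)) \<longlonglongrightarrow> x + 1 * C + 0"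
    by (intro tendsto_add tendsto_mult tendsto_const Elim rlim)
  ultimately have "\<phi> 1 \<le> x + 1 * C + 0" by (intro LIMSEQ_le_const) auto
  then show ?thesis using that[OF \<phi>] by simp
qed

text \<open>One half of the equation for the limit is Fatou's lemma. The other half is where the
  tails matter: increments of \<open>\<phi>n m\<close> caused by \<open>{n < p \<le> m}\<close>
  might survive in the limit although the integral of \<open>u\<close> misses them. The hypothesis
  \<open>tail\<close> bounds them uniformly in \<open>m\<close>.\<close>

lemma solves_ode_if_tail_small:
  fixes C :: real
  assumes pm: "p \<in> borel_measurable unit_leb" and p1: "\<And>t. t \<in> {0..1} \<Longrightarrow> 1 \<le> p t"
    and fm: "f \<in> borel_measurable unit_leb" and x: "0 < x"
    and rho: "rho_sup p (\<lambda>t. ennreal \<bar>f t\<bar>) \<le> ennreal C" and C: "0 \<le> C"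
    and tail: "\<And>\<epsilon>. 0 < \<epsilon> \<Longrightarrow> \<exists>n::nat. rho_sup p (\<lambda>t. ennreal \<bar>f t * indicator {t. real n < p t} t\<bar>) \<le> ennreal \<epsilon>"
  shows "\<exists>\<phi>. solves_ode p f x \<phi>"
proof -
  note [measurable] = pm fm
  define fn where "fn = (\<lambda>(n::nat) t. f t * indicator {t. p t \<le> real n} t)"
  have fnm [measurable]: "fn n \<in> borel_measurable unit_leb" for n
  proof -
    have "(\<lambda>t. if p t \<le> real n then f t else 0) \<in> borel_measurable unit_leb" by measurable
    then show ?thesis by (simp add: fn_def indicator_def if_distrib cong: if_cong)
  qed
  have "\<exists>\<phi>. solves_ode p (fn n) x \<phi> \<and> \<phi> 1 \<le> x + C" for n
  proof -
    have "rho_sup p (\<lambda>t. ennreal \<bar>fn n t\<bar>) \<le> ennreal C"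
      by (rule order_trans[OF rho_sup_mono[OF AE_I2] rho]) (simp add: fn_def indicator_def)
    moreover have "p t \<le> real n" if "fn n t \<noteq> 0" for t
      using that by (simp add: fn_def indicator_def split: if_splits)
    ultimately show ?thesis using solves_ode_if_bounded_exponent[OF pm p1 fnm _ _ C x] by metis
  qed
  then obtain \<phi>n where \<phi>n: "\<And>n. solves_ode p (fn n) x (\<phi>n n)" "\<And>n. \<phi>n n 1 \<le> x + C" by metis
  have mono: "\<phi>n n t \<le> \<phi>n m t" if "n \<le> m" "t \<in> {0..1}" for n m t
  proof (rule solves_ode_mono[OF \<phi>n(1) \<phi>n(1) pm p1 _ x order_refl that(2)])
    show "AE t in unit_leb. \<bar>fn n t\<bar> \<le> \<bar>fn m t\<bar>"
      by (rule AE_I2) (use that(1) in \<open>auto simp: fn_def indicator_def\<close>)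
  qed
  have ub: "\<phi>n n t \<le> x + C" if "t \<in> {0..1}" for n t
    using primitive_mono[OF \<phi>n(1)[of n, unfolded solves_ode_def], of t 1] \<phi>n(2)[of n] that by auto
  define \<phi> where "\<phi> = (\<lambda>t. lim (\<lambda>n. \<phi>n n t))"
  have lim: "(\<lambda>n. \<phi>n n t) \<longlonglongrightarrow> \<phi> t" if t: "t \<in> {0..1}" for t
  proof -
    have "incseq (\<lambda>n. \<phi>n n t)" using mono t by (simp add: incseq_def)
    then have "convergent (\<lambda>n. \<phi>n n t)"
      using incseq_convergent[of "\<lambda>n. \<phi>n n t" "x + C"] ub[OF t] unfolding convergent_def by metis
    then show ?thesis unfolding \<phi>_def by (simp add: convergent_LIMSEQ_iff)
  qed
  have ge: "\<phi>n n t \<le> \<phi> t" if t: "t \<in> {0..1}" for n t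
    using incseq_le[OF _ lim[OF t], of n] mono t by (simp add: incseq_def)
  have xn: "x \<le> \<phi>n n t" if "t \<in> {0..1}" for n t
    using primitive_ge[OF \<phi>n(1)[of n, unfolded solves_ode_def] that] .
  have x\<phi>: "x \<le> \<phi> t" if "t \<in> {0..1}" for t using xn[OF that, of 0] ge[OF that, of 0] by simp
  have \<phi>nm [measurable]: "\<phi>n n \<in> borel_measurable unit_leb" for n
    by (rule primitive_measurable[OF \<phi>n(1)[unfolded solves_ode_def]])
  have \<phi>m [measurable]: "\<phi> \<in> borel_measurable unit_leb"
    by (rule borel_measurable_LIMSEQ_real[of _ \<phi>n]) (use lim in auto)
  define u where "u = ode_rhs p f \<phi>"
  have um [measurable]: "u \<in> borel_measurable unit_leb" unfolding u_def by measurable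
  have u0: "0 \<le> u t" if "t \<in> {0..1}" for t unfolding u_def by (rule ode_rhs_nonneg) (rule p1[OF that])
  have rn0: "0 \<le> ode_rhs p (fn n) y t" if "t \<in> {0..1}" for n y t by (rule ode_rhs_nonneg) (rule p1[OF that])
  have ind [measurable]: "(indicator {0..T} :: real \<Rightarrow> real) \<in> borel_measurable unit_leb" for T :: real
    by (rule indicator_measurable_unit_leb) simp
  have "primitive u x \<phi>"
  proof (rule primitive_nnI[OF um u0 x\<phi>])
    fix T :: real assume T: "T \<in> {0..1}"
    have leu: "ode_rhs p (fn n) \<phi> t \<le> u t" if "t \<in> {0..1}" for n t
      using u0[OF that] by (auto simp: u_def ode_rhs_def fn_def indicator_def)
    show "(\<integral>\<^sup>+t. ennreal (indicator {0..T} t * u t) \<partial>unit_leb) = ennreal (\<phi> T - x)"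
    proof (rule antisym)
      have "(\<integral>\<^sup>+t. ennreal (indicator {0..T} t * u t) \<partial>unit_leb)
        = (\<integral>\<^sup>+t. liminf (\<lambda>n. ennreal (indicator {0..T} t * ode_rhs p (fn n) \<phi> t)) \<partial>unit_leb)"
      proof (rule nn_integral_cong)
        fix t
        obtain k0 :: nat where k0: "p t \<le> real k0" using real_arch_simple by blast
        have "\<forall>\<^sub>F n in sequentially. ennreal (indicator {0..T} t * ode_rhs p (fn n) \<phi> t) = ennreal (indicator {0..T} t * u t)"
          using eventually_ge_at_top[of k0] by eventually_elim (use k0 in \<open>simp add: u_def ode_rhs_def fn_def\<close>)
        then have "(\<lambda>n. ennreal (indicator {0..T} t * ode_rhs p (fn n) \<phi> t)) \<longlonglongrightarrow> ennreal (indicator {0..T} t * u t)"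
          by (rule tendsto_eventually)
        then show "ennreal (indicator {0..T} t * u t) = liminf (\<lambda>n. ennreal (indicator {0..T} t * ode_rhs p (fn n) \<phi> t))"
          by (intro lim_imp_Liminf[symmetric]) auto
      qed
      also have "\<dots> \<le> liminf (\<lambda>n. \<integral>\<^sup>+t. ennreal (indicator {0..T} t * ode_rhs p (fn n) \<phi> t) \<partial>unit_leb)"
        by (rule nn_integral_liminf) measurable
      also have "\<dots> \<le> ennreal (\<phi> T - x)"
      proof (rule Liminf_le[OF _ always_eventually], simp, rule allI)
        fix n
        have "(\<integral>\<^sup>+t. ennreal (indicator {0..T} t * ode_rhs p (fn n) \<phi> t) \<partial>unit_leb)
            \<le> (\<integral>\<^sup>+t. ennreal (indicator {0..T} t * ode_rhs p (fn n) (\<phi>n n) t) \<partial>unit_leb)"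
        proof (intro nn_integral_mono ennreal_leI mult_left_mono)
          fix t assume "t \<in> space unit_leb"
          then have t: "t \<in> {0..1}" by simp
          show "ode_rhs p (fn n) \<phi> t \<le> ode_rhs p (fn n) (\<phi>n n) t"
            using xn[OF t, of n] x by (intro ode_rhs_antimono p1 t ge) auto
        qed simp
        also have "\<dots> = ennreal (\<phi>n n T - x)" by (rule primitive_nn[OF \<phi>n(1)[unfolded solves_ode_def] T])
        also have "\<dots> \<le> ennreal (\<phi> T - x)" using ge[OF T, of n] by (intro ennreal_leI) simp
        finally show "(\<integral>\<^sup>+t. ennreal (indicator {0..T} t * ode_rhs p (fn n) \<phi> t) \<partial>unit_leb) \<le> ennreal (\<phi> T - x)" .
      qed
      finally show "(\<integral>\<^sup>+t. ennreal (indicator {0..T} t * u t) \<partial>unit_leb) \<le> ennreal (\<phi> T - x)" .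
    next
      show "ennreal (\<phi> T - x) \<le> (\<integral>\<^sup>+t. ennreal (indicator {0..T} t * u t) \<partial>unit_leb)"
      proof (rule ennreal_le_epsilon)
        fix \<epsilon> :: real assume \<epsilon>: "0 < \<epsilon>"
        obtain n :: nat where n: "rho_sup p (\<lambda>t. ennreal \<bar>f t * indicator {t. real n < p t} t\<bar>) \<le> ennreal \<epsilon>"
          using tail[OF \<epsilon>] by blast
        define I where "I = (\<lambda>y. \<integral>t. indicator {0..T} t * ode_rhs p (fn n) y t \<partial>unit_leb)"
        have in_n: "integrable unit_leb (ode_rhs p (fn n) (\<phi>n n))"
          using \<phi>n(1)[of n] by (simp add: solves_ode_def primitive_def)
        have bound: "ode_rhs p (fn n) y t \<le> ode_rhs p (fn n) (\<phi>n n) t" if "t \<in> {0..1}" "\<phi>n n t \<le> y t" for y t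
          using xn[OF that(1), of n] x that by (intro ode_rhs_antimono p1) auto
        have int_y: "integrable unit_leb (ode_rhs p (fn n) y)"
          if "y \<in> borel_measurable unit_leb" "\<And>t. t \<in> {0..1} \<Longrightarrow> \<phi>n n t \<le> y t" for y
        proof (rule Bochner_Integration.integrable_bound[OF in_n])
          show "ode_rhs p (fn n) y \<in> borel_measurable unit_leb" using that(1) by measurable
          show "AE t in unit_leb. norm (ode_rhs p (fn n) y t) \<le> norm (ode_rhs p (fn n) (\<phi>n n) t)"
            using AE_in_unit_interval by eventually_elim (use bound that(2) rn0 in auto)
        qed
        have step: "\<phi>n m T - x \<le> I (\<phi>n m) + \<epsilon>" if m: "n \<le> m" for m
        proof -
          \<comment> \<open>This is \<open>fn m - fn n\<close>. Its own solution
            \<open>\<psi>\<close> lies below \<open>\<phi>n m\<close>, so \<open>d\<close>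
            contributes at most as much along \<open>\<phi>n m\<close> as along
            \<open>\<psi>\<close>, and there it contributes at most \<open>\<psi> 1 - x\<close>,
            hence at most \<open>\<epsilon>\<close>.\<close>
          define d where "d = (\<lambda>t. f t * indicator {t. real n < p t \<and> p t \<le> real m} t)"
          have dm: "d \<in> borel_measurable unit_leb"
          proof -
            have "(\<lambda>t. if real n < p t \<and> p t \<le> real m then f t else 0) \<in> borel_measurable unit_leb" by measurable
            then show ?thesis by (simp add: d_def indicator_def if_distrib cong: if_cong)
          qed
          have "rho_sup p (\<lambda>t. ennreal \<bar>d t\<bar>) \<le> ennreal \<epsilon>"
            by (rule order_trans[OF rho_sup_mono[OF AE_I2] n]) (simp add: d_def indicator_def)
          moreover have "p t \<le> real m" if "d t \<noteq> 0" for t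
            using that by (simp add: d_def indicator_def split: if_splits)
          ultimately obtain \<psi> where \<psi>: "solves_ode p d x \<psi>" "\<psi> 1 \<le> x + \<epsilon>"
            using solves_ode_if_bounded_exponent[OF pm p1 dm _ _ less_imp_le[OF \<epsilon>] x] by metis
          have \<psi>le: "\<psi> t \<le> \<phi>n m t" if "t \<in> {0..1}" for t
          proof (rule solves_ode_mono[OF \<phi>n(1) \<psi>(1) pm p1 _ x order_refl that])
            show "AE t in unit_leb. \<bar>d t\<bar> \<le> \<bar>fn m t\<bar>"
              by (rule AE_I2) (auto simp: d_def fn_def indicator_def)
          qed
          have i\<psi>: "integrable unit_leb (ode_rhs p d \<psi>)" using \<psi>(1) by (simp add: solves_ode_def primitive_def)
          have i1: "integrable unit_leb (ode_rhs p (fn n) (\<phi>n m))"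
            by (rule int_y[OF \<phi>nm]) (rule mono[OF m])
          have im: "integrable unit_leb (ode_rhs p (fn m) (\<phi>n m))"
            using \<phi>n(1)[of m] by (simp add: solves_ode_def primitive_def)
          have "\<phi>n m T - x = (\<integral>t. indicator {0..T} t * ode_rhs p (fn m) (\<phi>n m) t \<partial>unit_leb)"
            using \<phi>n(1)[of m] T by (simp add: solves_ode_def primitive_def)
          also have "\<dots> \<le> (\<integral>t. indicator {0..T} t * ode_rhs p (fn n) (\<phi>n m) t + indicator {0..1} t * ode_rhs p d \<psi> t \<partial>unit_leb)"
          proof (rule integral_mono)
            fix t assume "t \<in> space unit_leb"
            then have t: "t \<in> {0..1}" by simp
            have "ode_rhs p (fn m) (\<phi>n m) t = ode_rhs p (fn n) (\<phi>n m) t + ode_rhs p d (\<phi>n m) t"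
              using m by (auto simp: ode_rhs_def fn_def d_def indicator_def)
            also have "ode_rhs p d (\<phi>n m) t \<le> ode_rhs p d \<psi> t"
              by (intro ode_rhs_antimono p1 t \<psi>le solves_ode_pos[OF \<psi>(1) x])
            finally have "ode_rhs p (fn m) (\<phi>n m) t \<le> ode_rhs p (fn n) (\<phi>n m) t + ode_rhs p d \<psi> t" by simp
            then show "indicator {0..T} t * ode_rhs p (fn m) (\<phi>n m) t
                \<le> indicator {0..T} t * ode_rhs p (fn n) (\<phi>n m) t + indicator {0..1} t * ode_rhs p d \<psi> t"
              using t ode_rhs_nonneg[of p t d \<psi>] p1[OF t] by (simp add: indicator_def)
          next
            show "integrable unit_leb (\<lambda>t. indicator {0..T} t * ode_rhs p (fn m) (\<phi>n m) t)"
              by (rule integrable_indicator_times[OF im]) simp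
            show "integrable unit_leb (\<lambda>t. indicator {0..T} t * ode_rhs p (fn n) (\<phi>n m) t + indicator {0..1} t * ode_rhs p d \<psi> t)"
              by (intro Bochner_Integration.integrable_add integrable_indicator_times i1 i\<psi>) auto
          qed
          also have "\<dots> = I (\<phi>n m) + (\<integral>t. indicator {0..1} t * ode_rhs p d \<psi> t \<partial>unit_leb)"
            unfolding I_def by (intro Bochner_Integration.integral_add integrable_indicator_times i1 i\<psi>) auto
          also have "(\<integral>t. indicator {0..1} t * ode_rhs p d \<psi> t \<partial>unit_leb) = \<psi> 1 - x"
            using \<psi>(1) by (simp add: solves_ode_def primitive_def)
          finally show ?thesis using \<psi>(2) by simp
        qed
        have Ilim: "(\<lambda>m. I (\<phi>n (m + n))) \<longlonglongrightarrow> I \<phi>"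
          unfolding I_def
        \<comment> \<open>Antitonicity makes the right-hand side along \<open>\<phi>n n\<close> a
          majorant for those along all later solutions; the shift by \<open>n\<close> skips the
          earlier ones.\<close>
        proof (rule integral_dominated_convergence[where w="ode_rhs p (fn n) (\<phi>n n)"])
          show "AE t in unit_leb. (\<lambda>m. indicator {0..T} t * ode_rhs p (fn n) (\<phi>n (m + n)) t) \<longlonglongrightarrow> indicator {0..T} t * ode_rhs p (fn n) \<phi> t"
            using AE_in_unit_interval
          proof eventually_elim
            case (elim t)
            then have t: "t \<in> {0..1}" by simp
            show ?case unfolding ode_rhs_def
              by (intro tendsto_mult tendsto_powr tendsto_const LIMSEQ_ignore_initial_segment[OF lim[OF t]])
                (use x\<phi>[OF t] x in simp)
          qed
          show "AE t in unit_leb. norm (indicator {0..T} t * ode_rhs p (fn n) (\<phi>n (m + n)) t) \<le> ode_rhs p (fn n) (\<phi>n n) t" for m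
            using AE_in_unit_interval
          proof eventually_elim
            case (elim t)
            then have t: "t \<in> {0..1}" by simp
            have "ode_rhs p (fn n) (\<phi>n (m + n)) t \<le> ode_rhs p (fn n) (\<phi>n n) t"
              by (rule bound[OF t]) (rule mono[OF _ t], simp)
            then show ?case using rn0[OF t] by (simp add: indicator_def)
          qed
          show "integrable unit_leb (ode_rhs p (fn n) (\<phi>n n))" by (rule in_n)
        qed measurable
        have "\<phi> T - x \<le> I \<phi> + \<epsilon>"
        proof (rule LIMSEQ_le)
          show "(\<lambda>m. \<phi>n (m + n) T - x) \<longlonglongrightarrow> \<phi> T - x"
            by (intro tendsto_diff tendsto_const LIMSEQ_ignore_initial_segment[OF lim[OF T]])
          show "(\<lambda>m. I (\<phi>n (m + n)) + \<epsilon>) \<longlonglongrightarrow> I \<phi> + \<epsilon>" by (intro tendsto_add tendsto_const Ilim)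
          show "\<exists>N. \<forall>m\<ge>N. \<phi>n (m + n) T - x \<le> I (\<phi>n (m + n)) + \<epsilon>" using step by auto
        qed
        then have "ennreal (\<phi> T - x) \<le> ennreal (I \<phi> + \<epsilon>)" by (rule ennreal_leI)
        also have "\<dots> = ennreal (I \<phi>) + ennreal \<epsilon>"
          unfolding I_def using \<epsilon> nn_integral_indicator_eq(2)[OF int_y[OF \<phi>m ge] rn0, of "{0..T}"] by simp
        also have "ennreal (I \<phi>) = (\<integral>\<^sup>+t. ennreal (indicator {0..T} t * ode_rhs p (fn n) \<phi> t) \<partial>unit_leb)"
          unfolding I_def by (rule nn_integral_indicator_eq(1)[OF int_y[OF \<phi>m ge] rn0, symmetric]) auto
        also have "\<dots> \<le> (\<integral>\<^sup>+t. ennreal (indicator {0..T} t * u t) \<partial>unit_leb)"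
          by (intro nn_integral_mono ennreal_leI mult_left_mono leu) auto
        finally show "ennreal (\<phi> T - x) \<le> (\<integral>\<^sup>+t. ennreal (indicator {0..T} t * u t) \<partial>unit_leb) + ennreal \<epsilon>"
          by (simp add: add_right_mono)
      qed
    qed
  qed
  then show ?thesis unfolding solves_ode_def u_def by blast
qed

section \<open>The function spaces\<close>

lemma solves_ode_imp_ode_solution:
  assumes pm: "p \<in> borel_measurable unit_leb" and p1: "\<And>t. t \<in> {0..1} \<Longrightarrow> 1 \<le> p t"
    and gm: "g \<in> borel_measurable unit_leb" and x: "0 < x" and \<phi>: "solves_ode p g x \<phi>"
  shows "ode_solution p (abs_L0 g) x \<phi>"
proof -
  have pr: "primitive (ode_rhs p g \<phi>) x \<phi>" using \<phi> by (simp add: solves_ode_def)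
  have "ennreal (\<phi> T) = ennreal x
      + (\<integral>\<^sup>+t\<in>{0..T}. ennreal (\<bar>g t\<bar> powr p t / p t * \<phi> t powr (1 - p t)) \<partial>unit_leb)" if T: "T \<in> {0..1}" for T
  proof -
    have "(\<integral>\<^sup>+t\<in>{0..T}. ennreal (\<bar>g t\<bar> powr p t / p t * \<phi> t powr (1 - p t)) \<partial>unit_leb)
        = (\<integral>\<^sup>+t. ennreal (indicator {0..T} t * ode_rhs p g \<phi> t) \<partial>unit_leb)"
      by (rule nn_integral_cong) (simp add: indicator_def ode_rhs_def)
    also have "\<dots> = ennreal (\<phi> T - x)" by (rule primitive_nn[OF pr T])
    finally show ?thesis using primitive_ge[OF pr T] x by (simp flip: ennreal_plus)
  qed
  moreover have "ae_eq_rel g g" using gm by (simp add: ae_eq_rel_def)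
  ultimately show ?thesis
    using primitive_abs_cont[OF pr] solves_ode_pos[OF \<phi> x] by (simp add: ode_solution.abs_eq)
qed

text \<open>Finiteness of \<open>\<phi> T\<close> makes the right-hand side integrable; absolute
  continuity supplies the measurability of \<open>\<phi>\<close>.\<close>

lemma ode_solution_imp_solves_ode:
  assumes pm: "p \<in> borel_measurable unit_leb" and p1: "\<And>t. t \<in> {0..1} \<Longrightarrow> 1 \<le> p t"
    and x: "0 < x" and \<phi>: "ode_solution p f x \<phi>"
  shows "solves_ode p (rep_L0 f) x \<phi>"
proof -
  define g where "g = rep_L0 f"
  have gm: "g \<in> borel_measurable unit_leb" by (simp add: g_def rep_L0_measurable)
  have sol': "ode_solution p (abs_L0 g) x \<phi>" using \<phi> by (simp add: g_def abs_rep_L0)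
  have ae: "ae_eq_rel g g" using gm by (simp add: ae_eq_rel_def)
  have sol: "abs_cont_on {0..1} \<phi> \<and> (\<forall>t\<in>{0..1}. 0 < \<phi> t)
     \<and> (\<forall>T\<in>{0..1}. ennreal (\<phi> T) = ennreal x +
          (\<integral>\<^sup>+t\<in>{0..T}. ennreal (\<bar>g t\<bar> powr p t / p t * \<phi> t powr (1 - p t)) \<partial>unit_leb))"
    using sol' unfolding ode_solution.abs_eq[OF ae] .
  then have ac: "abs_cont_on {0..1} \<phi>" and pos: "\<And>t. t \<in> {0..1} \<Longrightarrow> 0 < \<phi> t"
    by blast+
  have eq: "ennreal (\<phi> T) = ennreal x
      + (\<integral>\<^sup>+t\<in>{0..T}. ennreal (\<bar>g t\<bar> powr p t / p t * \<phi> t powr (1 - p t)) \<partial>unit_leb)"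
    if "T \<in> {0..1}" for T
    using sol that by blast
  have \<phi>m: "\<phi> \<in> borel_measurable unit_leb"
    by (rule continuous_measurable_unit_leb[OF abs_cont_on_imp_continuous_on[OF ac]])
  have "primitive (ode_rhs p g \<phi>) x \<phi>"
  proof (rule primitive_nnI)
    show "ode_rhs p g \<phi> \<in> borel_measurable unit_leb" by (rule ode_rhs_measurable[OF pm gm \<phi>m])
    show "0 \<le> ode_rhs p g \<phi> t" if "t \<in> {0..1}" for t by (rule ode_rhs_nonneg) (rule p1[OF that])
    fix T :: real assume T: "T \<in> {0..1}"
    have "ennreal x \<le> ennreal (\<phi> T)" unfolding eq[OF T] by simp
    then show le: "x \<le> \<phi> T" using pos[OF T] x by (simp add: ennreal_le_iff)
    have "ennreal (\<phi> T) - ennreal x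
        = (\<integral>\<^sup>+t\<in>{0..T}. ennreal (\<bar>g t\<bar> powr p t / p t * \<phi> t powr (1 - p t)) \<partial>unit_leb)"
      unfolding eq[OF T] by simp
    also have "\<dots> = (\<integral>\<^sup>+t. ennreal (indicator {0..T} t * ode_rhs p g \<phi> t) \<partial>unit_leb)"
      by (rule nn_integral_cong) (simp add: indicator_def ode_rhs_def)
    finally show "(\<integral>\<^sup>+t. ennreal (indicator {0..T} t * ode_rhs p g \<phi> t) \<partial>unit_leb) = ennreal (\<phi> T - x)"
      using x by (simp add: ennreal_minus)
  qed
  then show ?thesis by (simp add: solves_ode_def g_def)
qed

section \<open>Banach spaces inside a vector space\<close>

lemma banach_space_onI:
  fixes V :: "'a::real_vector set"
  assumes "subspace V" "\<And>x. x \<in> V \<Longrightarrow> 0 \<le> \<nu> x" "\<And>x. x \<in> V \<Longrightarrow> \<nu> x = 0 \<longleftrightarrow> x = 0"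
    and "\<And>x c. x \<in> V \<Longrightarrow> \<nu> (c *\<^sub>R x) = \<bar>c\<bar> * \<nu> x"
    and "\<And>x y. x \<in> V \<Longrightarrow> y \<in> V \<Longrightarrow> \<nu> (x + y) \<le> \<nu> x + \<nu> y"
    and "\<And>s. range s \<subseteq> V \<Longrightarrow> \<forall>\<epsilon>>0. \<exists>M. \<forall>m\<ge>M. \<forall>n\<ge>M. \<nu> (s m - s n) < \<epsilon>
      \<Longrightarrow> \<exists>l\<in>V. (\<lambda>n. \<nu> (s n - l)) \<longlonglongrightarrow> 0"
  shows "banach_space_on V \<nu>"
  unfolding banach_space_on_def
proof (intro conjI)
  show "\<forall>s. range s \<subseteq> V \<longrightarrow> (\<forall>\<epsilon>>0. \<exists>M. \<forall>m\<ge>M. \<forall>n\<ge>M. \<nu> (s m - s n) < \<epsilon>)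
      \<longrightarrow> (\<exists>l\<in>V. (\<lambda>n. \<nu> (s n - l)) \<longlonglongrightarrow> 0)"
    by (intro allI impI) (rule assms(6); assumption)
qed (simp_all add: assms(1-5))

lemma banach_space_onD:
  fixes V :: "'a::real_vector set"
  assumes "banach_space_on V \<nu>"
  shows "subspace V" "\<And>x. x \<in> V \<Longrightarrow> 0 \<le> \<nu> x" "\<And>x. x \<in> V \<Longrightarrow> \<nu> x = 0 \<longleftrightarrow> x = 0"
    and "\<And>x c. x \<in> V \<Longrightarrow> \<nu> (c *\<^sub>R x) = \<bar>c\<bar> * \<nu> x"
    and "\<And>x y. x \<in> V \<Longrightarrow> y \<in> V \<Longrightarrow> \<nu> (x + y) \<le> \<nu> x + \<nu> y"
    and "\<And>s. range s \<subseteq> V \<Longrightarrow> \<forall>\<epsilon>>0. \<exists>M. \<forall>m\<ge>M. \<forall>n\<ge>M. \<nu> (s m - s n) < \<epsilon>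
      \<Longrightarrow> \<exists>l\<in>V. (\<lambda>n. \<nu> (s n - l)) \<longlonglongrightarrow> 0"
proof -
  note * = assms[unfolded banach_space_on_def]
  show "subspace V" using * by (elim conjE)
  show "0 \<le> \<nu> x" "\<nu> x = 0 \<longleftrightarrow> x = 0" if "x \<in> V" for x using * that by (elim conjE; blast)+
  show "\<nu> (c *\<^sub>R x) = \<bar>c\<bar> * \<nu> x" if "x \<in> V" for x c using * that by (elim conjE; blast)
  show "\<nu> (x + y) \<le> \<nu> x + \<nu> y" if "x \<in> V" "y \<in> V" for x y using * that by (elim conjE; blast)
  fix s :: "nat \<Rightarrow> 'a" assume s: "range s \<subseteq> V" "\<forall>\<epsilon>>0. \<exists>M. \<forall>m\<ge>M. \<forall>n\<ge>M. \<nu> (s m - s n) < \<epsilon>"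
  have "\<forall>s. range s \<subseteq> V \<longrightarrow> (\<forall>\<epsilon>>0. \<exists>M. \<forall>m\<ge>M. \<forall>n\<ge>M. \<nu> (s m - s n) < \<epsilon>)
          \<longrightarrow> (\<exists>l\<in>V. (\<lambda>n. \<nu> (s n - l)) \<longlonglongrightarrow> 0)" using * by (elim conjE)
  from this[THEN spec, THEN mp, OF s(1), THEN mp, OF s(2)]
  show "\<exists>l\<in>V. (\<lambda>n. \<nu> (s n - l)) \<longlonglongrightarrow> 0" .
qed

lemma banach_space_on_cong:
  fixes V :: "'a::real_vector set"
  assumes V: "banach_space_on V \<nu>" and eq: "\<And>x. x \<in> V \<Longrightarrow> \<mu> x = \<nu> x"
  shows "banach_space_on V \<mu>"
proof (rule banach_space_onI)
  note D = banach_space_onD[OF V]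
  show "subspace V" by (rule D(1))
  show "0 \<le> \<mu> x" "\<mu> x = 0 \<longleftrightarrow> x = 0" if "x \<in> V" for x using D(2,3)[OF that] eq[OF that] by simp_all
  show "\<mu> (c *\<^sub>R x) = \<bar>c\<bar> * \<mu> x" if "x \<in> V" for x c
    using D(4)[OF that] eq[OF that] eq[OF subspace_scale[OF D(1) that]] by simp
  show "\<mu> (x + y) \<le> \<mu> x + \<mu> y" if "x \<in> V" "y \<in> V" for x y
    using D(5)[OF that] eq[OF that(1)] eq[OF that(2)] eq[OF subspace_add[OF D(1) that]] by simp
  have diff: "\<mu> (x - y) = \<nu> (x - y)" if "x \<in> V" "y \<in> V" for x y
    by (rule eq[OF subspace_diff[OF D(1) that]])
  fix s :: "nat \<Rightarrow> 'a" assume s: "range s \<subseteq> V" and C: "\<forall>\<epsilon>>0. \<exists>M. \<forall>m\<ge>M. \<forall>n\<ge>M. \<mu> (s m - s n) < \<epsilon>"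
  have sV: "s n \<in> V" for n using s by auto
  have "\<forall>\<epsilon>>0. \<exists>M. \<forall>m\<ge>M. \<forall>n\<ge>M. \<nu> (s m - s n) < \<epsilon>" using C unfolding diff[OF sV sV] .
  from D(6)[OF s this] obtain l where l: "l \<in> V" "(\<lambda>n. \<nu> (s n - l)) \<longlonglongrightarrow> 0" by blast
  have "(\<lambda>n. \<mu> (s n - l)) \<longlonglongrightarrow> 0" using l(2) unfolding diff[OF sV l(1)] .
  with l(1) show "\<exists>l\<in>V. (\<lambda>n. \<mu> (s n - l)) \<longlonglongrightarrow> 0" by blast
qed

lemma banach_space_on_closed_subspace:
  fixes V :: "'a::real_vector set"
  assumes V: "banach_space_on V \<nu>" and W: "subspace W" "W \<subseteq> V"
    and closed: "\<And>l s. l \<in> V \<Longrightarrow> range s \<subseteq> W \<Longrightarrow> (\<lambda>n. \<nu> (s n - l)) \<longlonglongrightarrow> 0 \<Longrightarrow> l \<in> W"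
  shows "banach_space_on W \<nu>"
proof (rule banach_space_onI)
  note D = banach_space_onD[OF V]
  show "subspace W" by (rule W(1))
  show "0 \<le> \<nu> x" "\<nu> x = 0 \<longleftrightarrow> x = 0" "\<nu> (c *\<^sub>R x) = \<bar>c\<bar> * \<nu> x" if "x \<in> W" for x c
    using D(2,3,4)[OF subsetD[OF W(2) that]] by simp_all
  show "\<nu> (x + y) \<le> \<nu> x + \<nu> y" if "x \<in> W" "y \<in> W" for x y
    using D(5) subsetD[OF W(2)] that by simp
  fix s :: "nat \<Rightarrow> 'a" assume s: "range s \<subseteq> W" and C: "\<forall>\<epsilon>>0. \<exists>M. \<forall>m\<ge>M. \<forall>n\<ge>M. \<nu> (s m - s n) < \<epsilon>"
  obtain l where l: "l \<in> V" "(\<lambda>n. \<nu> (s n - l)) \<longlonglongrightarrow> 0"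
    using D(6)[OF order_trans[OF s W(2)] C] by blast
  show "\<exists>l\<in>W. (\<lambda>n. \<nu> (s n - l)) \<longlonglongrightarrow> 0"
    using l(2) closed[OF l(1) s l(2)] by blast
qed

section \<open>The space normed by the limit superior\<close>

context
  fixes p :: "real \<Rightarrow> real"
  assumes pm: "p \<in> borel_measurable unit_leb" and p1: "\<And>t. t \<in> {0..1} \<Longrightarrow> 1 \<le> p t"
begin

lemma rho_eq_rho_sup: "rho p f = rho_sup p (\<lambda>t. ennreal \<bar>rep_L0 f t\<bar>)"
  by (rule rho_eq[OF pm p1])

lemma abs_rep_measurable [measurable]: "(\<lambda>t. ennreal \<bar>rep_L0 f t\<bar>) \<in> borel_measurable unit_leb"
  by measurable

lemma rho_sup_zero: "rho_sup p (\<lambda>_. 0) = 0"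
  using rho_sup_cmult[of "\<lambda>_. 0" p 0] by simp

text \<open>Definiteness is inherited from the L1 norm, which \<open>rho p\<close> dominates up to a
  constant.\<close>

lemma rho_zero_iff: "rho p f = 0 \<longleftrightarrow> f = 0"
proof
  assume "rho p f = 0"
  then have "ennreal (exp (-1)) * (\<integral>\<^sup>+t. ennreal \<bar>rep_L0 f t\<bar> \<partial>unit_leb) \<le> 0"
    using rho_sup_ge_L1[OF pm p1, of "\<lambda>t. ennreal \<bar>rep_L0 f t\<bar>"] by (simp add: rho_eq_rho_sup)
  then have "(\<integral>\<^sup>+t. ennreal \<bar>rep_L0 f t\<bar> \<partial>unit_leb) = 0" by simp
  then have "AE t in unit_leb. ennreal \<bar>rep_L0 f t\<bar> = 0"
    by (subst (asm) nn_integral_0_iff_AE) (rule abs_rep_measurable)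
  then have "AE t in unit_leb. rep_L0 f t = rep_L0 0 t"
    using rep_L0_zero by eventually_elim simp
  then show "f = 0" by (rule L0_eqI)
next
  assume "f = 0"
  have "AE t in unit_leb. ennreal \<bar>rep_L0 0 t\<bar> = 0" using rep_L0_zero by eventually_elim simp
  then have "rho_sup p (\<lambda>t. ennreal \<bar>rep_L0 0 t\<bar>) = rho_sup p (\<lambda>_. 0)" by (rule rho_sup_cong)
  then have "rho_sup p (\<lambda>t. ennreal \<bar>rep_L0 0 t\<bar>) = 0" by (simp only: rho_sup_zero)
  with \<open>f = 0\<close> show "rho p f = 0" by (simp add: rho_eq_rho_sup)
qed

lemma rho_triangle: "rho p (f + g) \<le> rho p f + rho p g"
proof -
  have "rho_sup p (\<lambda>t. ennreal \<bar>rep_L0 (f + g) t\<bar>) \<le> rho_sup p (\<lambda>t. ennreal \<bar>rep_L0 f t\<bar> + ennreal \<bar>rep_L0 g t\<bar>)"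
  proof (rule rho_sup_mono)
    show "AE t in unit_leb. ennreal \<bar>rep_L0 (f + g) t\<bar> \<le> ennreal \<bar>rep_L0 f t\<bar> + ennreal \<bar>rep_L0 g t\<bar>"
      using rep_L0_plus[of f g] by eventually_elim (simp add: ennreal_leI flip: ennreal_plus)
  qed
  also have "\<dots> \<le> rho_sup p (\<lambda>t. ennreal \<bar>rep_L0 f t\<bar>) + rho_sup p (\<lambda>t. ennreal \<bar>rep_L0 g t\<bar>)"
    by (rule rho_sup_triangle) measurable
  finally show ?thesis by (simp add: rho_eq_rho_sup)
qed

lemma rho_scale: "rho p (c *\<^sub>R f) = ennreal \<bar>c\<bar> * rho p f"
proof -
  have "rho_sup p (\<lambda>t. ennreal \<bar>rep_L0 (c *\<^sub>R f) t\<bar>) = rho_sup p (\<lambda>t. ennreal \<bar>c\<bar> * ennreal \<bar>rep_L0 f t\<bar>)"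
  proof (rule rho_sup_cong)
    show "AE t in unit_leb. ennreal \<bar>rep_L0 (c *\<^sub>R f) t\<bar> = ennreal \<bar>c\<bar> * ennreal \<bar>rep_L0 f t\<bar>"
      using rep_L0_scale[of c f] by eventually_elim (simp add: abs_mult flip: ennreal_mult)
  qed
  also have "\<dots> = ennreal \<bar>c\<bar> * rho_sup p (\<lambda>t. ennreal \<bar>rep_L0 f t\<bar>)"
    by (rule rho_sup_cmult) measurable
  finally show ?thesis by (simp add: rho_eq_rho_sup)
qed

lemma rho_solid:
  assumes "AE t in unit_leb. \<bar>rep_L0 f t\<bar> \<le> \<bar>rep_L0 g t\<bar>"
  shows "rho p f \<le> rho p g"
  unfolding rho_eq_rho_sup
proof (rule rho_sup_mono)
  show "AE t in unit_leb. ennreal \<bar>rep_L0 f t\<bar> \<le> ennreal \<bar>rep_L0 g t\<bar>"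
    using assms by eventually_elim (rule ennreal_leI)
qed

lemma rho_minus_commute: "rho p (f - g) = rho p (g - f)"
proof -
  have "f - g = (-1) *\<^sub>R (g - f)" by simp
  then have "rho p (f - g) = ennreal \<bar>-1\<bar> * rho p (g - f)" by (simp only: rho_scale)
  then show ?thesis unfolding abs_neg_one ennreal_1 mult_1 .
qed

lemma Ltilde_iff: "f \<in> Ltilde p \<longleftrightarrow> rho p f < \<infinity>"
  by (simp add: Ltilde_def)

lemma subspace_Ltilde: "subspace (Ltilde p)"
proof (rule subspaceI)
  have "rho p 0 = 0" by (rule rho_zero_iff[THEN iffD2]) simp
  then show "0 \<in> Ltilde p" by (simp add: Ltilde_iff)
  show "f + g \<in> Ltilde p" if "f \<in> Ltilde p" "g \<in> Ltilde p" for f g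
  proof -
    have "rho p f + rho p g < \<infinity>" using that by (simp add: Ltilde_iff)
    then show ?thesis unfolding Ltilde_iff by (rule le_less_trans[OF rho_triangle])
  qed
  show "c *\<^sub>R f \<in> Ltilde p" if "f \<in> Ltilde p" for c f
    using that unfolding Ltilde_iff rho_scale by (simp add: ennreal_mult_less_top)
qed

lemma rho_norm_eq:
  assumes "f \<in> Ltilde p"
  shows "ennreal (rho_norm p f) = rho p f"
  using assms unfolding rho_norm_def Ltilde_iff by simp

lemma rho_norm_nonneg: "0 \<le> rho_norm p f"
  by (simp add: rho_norm_def)

lemma rho_norm_le_iff: "f \<in> Ltilde p \<Longrightarrow> 0 \<le> c \<Longrightarrow> rho_norm p f \<le> c \<longleftrightarrow> rho p f \<le> ennreal c"
  by (subst rho_norm_eq[symmetric]) (simp_all add: ennreal_le_iff)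

lemma rho_norm_triangle:
  assumes "f \<in> Ltilde p" "g \<in> Ltilde p"
  shows "rho_norm p (f + g) \<le> rho_norm p f + rho_norm p g"
proof -
  have "rho p (f + g) \<le> ennreal (rho_norm p f + rho_norm p g)"
    using rho_triangle[of f g] unfolding ennreal_plus[OF rho_norm_nonneg rho_norm_nonneg] rho_norm_eq[OF assms(1)] rho_norm_eq[OF assms(2)] .
  then show ?thesis
    by (subst rho_norm_le_iff[OF subspace_add[OF subspace_Ltilde assms]]) (simp_all add: rho_norm_nonneg)
qed

lemma Metric_space_Ltilde: "Metric_space (Ltilde p) (\<lambda>f g. rho_norm p (f - g))"
proof
  fix f g h
  show "0 \<le> rho_norm p (f - g)" by (rule rho_norm_nonneg)
  show "rho_norm p (f - g) = rho_norm p (g - f)" unfolding rho_norm_def rho_minus_commute[of f g] ..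
  assume fg: "f \<in> Ltilde p" "g \<in> Ltilde p"
  then have d: "f - g \<in> Ltilde p" by (rule subspace_diff[OF subspace_Ltilde])
  show "rho_norm p (f - g) = 0 \<longleftrightarrow> f = g"
    using rho_norm_eq[OF d] rho_zero_iff[of "f - g"] by (auto simp: rho_norm_def)
  assume h: "h \<in> Ltilde p"
  show "rho_norm p (f - h) \<le> rho_norm p (f - g) + rho_norm p (g - h)"
    using rho_norm_triangle[OF d subspace_diff[OF subspace_Ltilde fg(2) h]] by simp
qed

text \<open>A Cauchy sequence for \<open>rho_norm p\<close> is Cauchy in L1, so a subsequence
  converges almost everywhere. That its limit is also the limit for \<open>rho_norm p\<close> is the
  Fatou property.\<close>

lemma banach_space_on_Ltilde: "banach_space_on (Ltilde p) (rho_norm p)"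
proof (rule banach_space_onI)
  show "subspace (Ltilde p)" by (rule subspace_Ltilde)
  show "0 \<le> rho_norm p f" for f by (rule rho_norm_nonneg)
  show "rho_norm p f = 0 \<longleftrightarrow> f = 0" if "f \<in> Ltilde p" for f
    using rho_norm_eq[OF that] rho_zero_iff[of f] by (auto simp: rho_norm_def)
  show "rho_norm p (c *\<^sub>R f) = \<bar>c\<bar> * rho_norm p f" for c f
    by (simp add: rho_norm_def rho_scale enn2real_mult)
  show "rho_norm p (f + g) \<le> rho_norm p f + rho_norm p g" if "f \<in> Ltilde p" "g \<in> Ltilde p" for f g
    by (rule rho_norm_triangle[OF that])
  fix s :: "nat \<Rightarrow> L0"
  assume s: "range s \<subseteq> Ltilde p" and Cauchy: "\<forall>\<epsilon>>0. \<exists>M. \<forall>m\<ge>M. \<forall>n\<ge>M. rho_norm p (s m - s n) < \<epsilon>"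
  have sV: "s n \<in> Ltilde p" for n using s by auto
  have sd: "s m - s n \<in> Ltilde p" for m n by (rule subspace_diff[OF subspace_Ltilde sV sV])
  define F where "F = (\<lambda>n. rep_L0 (s n))"
  have Fm [measurable]: "F n \<in> borel_measurable unit_leb" for n by (simp add: F_def rep_L0_measurable)
  \<comment> \<open>\<open>exp 1\<close> cancels the constant of
    \<open>rho_sup_ge_L1\<close>.\<close>
  have L1: "(\<integral>\<^sup>+t. ennreal \<bar>rep_L0 f t\<bar> \<partial>unit_leb) \<le> ennreal (exp 1 * rho_norm p f)" if "f \<in> Ltilde p" for f
  proof -
    have "ennreal (exp 1) * (ennreal (exp (-1)) * (\<integral>\<^sup>+t. ennreal \<bar>rep_L0 f t\<bar> \<partial>unit_leb)) \<le> ennreal (exp 1) * rho p f"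
      unfolding rho_eq_rho_sup by (intro mult_left_mono rho_sup_ge_L1 pm p1) auto
    then have "(\<integral>\<^sup>+t. ennreal \<bar>rep_L0 f t\<bar> \<partial>unit_leb) \<le> ennreal (exp 1) * rho p f"
      by (simp flip: mult.assoc ennreal_mult exp_add)
    also have "\<dots> = ennreal (exp 1 * rho_norm p f)"
      by (simp add: ennreal_mult rho_norm_nonneg rho_norm_eq[OF that])
    finally show ?thesis .
  qed
  have Fi: "integrable unit_leb (F n)" for n
  proof (rule integrableI_bounded[OF Fm])
    show "(\<integral>\<^sup>+t. ennreal (norm (F n t)) \<partial>unit_leb) < \<infinity>"
      using le_less_trans[OF L1[OF sV[of n]]] by (simp add: F_def)
  qed
  have Fd: "AE t in unit_leb. \<bar>rep_L0 (s m - s n) t\<bar> = \<bar>F m t - F n t\<bar>" for m n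
    using rep_L0_minus[of "s m" "s n"] by eventually_elim (simp add: F_def)
  have FC: "(\<integral>t. norm (F m t - F n t) \<partial>unit_leb) \<le> exp 1 * rho_norm p (s m - s n)" for m n
  proof -
    have "ennreal (\<integral>t. norm (F m t - F n t) \<partial>unit_leb) = (\<integral>\<^sup>+t. ennreal (norm (F m t - F n t)) \<partial>unit_leb)"
      by (intro nn_integral_eq_integral[symmetric] integrable_norm Bochner_Integration.integrable_diff Fi) simp
    also have "\<dots> = (\<integral>\<^sup>+t. ennreal \<bar>rep_L0 (s m - s n) t\<bar> \<partial>unit_leb)"
      by (rule nn_integral_cong_AE) (use Fd[of m n] in \<open>eventually_elim, simp\<close>)
    also have "\<dots> \<le> ennreal (exp 1 * rho_norm p (s m - s n))" by (rule L1[OF sd])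
    finally show ?thesis by (simp add: ennreal_le_iff rho_norm_nonneg)
  qed
  have CL: "\<exists>N. \<forall>i\<ge>N. \<forall>j\<ge>N. (\<integral>t. norm (F i t - F j t) \<partial>unit_leb) < e" if e: "e > 0" for e
  proof -
    have "0 < e / exp 1" using e by simp
    then obtain M where M: "\<forall>m\<ge>M. \<forall>n\<ge>M. rho_norm p (s m - s n) < e / exp 1" using Cauchy by blast
    show ?thesis
    proof (intro exI[of _ M] allI impI)
      fix i j assume "M \<le> i" "M \<le> j"
      then have "exp 1 * rho_norm p (s i - s j) < e" using M by (simp add: field_simps)
      then show "(\<integral>t. norm (F i t - F j t) \<partial>unit_leb) < e" using FC[of i j] by simp
    qed
  qed
  obtain r where r: "strict_mono r" "AE t in unit_leb. Cauchy (\<lambda>i. F (r i) t)"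
    by (rule cauchy_L1_AE_cauchy_subseq[of unit_leb F, OF Fi CL])
  define L where "L = (\<lambda>t. lim (\<lambda>i. F (r i) t))"
  have Lm [measurable]: "L \<in> borel_measurable unit_leb" unfolding L_def by measurable
  have Llim: "AE t in unit_leb. (\<lambda>i. F (r i) t) \<longlonglongrightarrow> L t"
    using r(2) by eventually_elim (simp add: L_def Cauchy_convergent_iff convergent_LIMSEQ_iff)
  define l where "l = abs_L0 L"
  have lL: "AE t in unit_leb. rep_L0 l t = L t" unfolding l_def by (rule rep_abs_L0[OF Lm])
  \<comment> \<open>Bounds against late terms of the sequence pass to \<open>l\<close> by the Fatou
    property along the subsequence \<open>r\<close>.\<close>
  have key: "rho p (s n - l) \<le> ennreal \<epsilon>" if \<epsilon>: "0 \<le> \<epsilon>" and M: "\<And>m. M \<le> m \<Longrightarrow> rho_norm p (s n - s m) \<le> \<epsilon>" for n M \<epsilon>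
  proof -
    have "rho p (s n - l) \<le> rho_sup p (\<lambda>t. liminf (\<lambda>i. ennreal \<bar>F n t - F (r i) t\<bar>))"
      unfolding rho_eq_rho_sup
    proof (rule rho_sup_mono)
      show "AE t in unit_leb. ennreal \<bar>rep_L0 (s n - l) t\<bar> \<le> liminf (\<lambda>i. ennreal \<bar>F n t - F (r i) t\<bar>)"
        using rep_L0_minus[of "s n" l] lL Llim
      proof eventually_elim
        case (elim t)
        have "(\<lambda>i. ennreal \<bar>F n t - F (r i) t\<bar>) \<longlonglongrightarrow> ennreal \<bar>F n t - L t\<bar>"
          by (intro tendsto_ennrealI tendsto_rabs tendsto_diff tendsto_const elim(3))
        then have "liminf (\<lambda>i. ennreal \<bar>F n t - F (r i) t\<bar>) = ennreal \<bar>F n t - L t\<bar>"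
          by (intro lim_imp_Liminf) auto
        then show ?case using elim by (simp add: F_def)
      qed
    qed
    also have "\<dots> \<le> liminf (\<lambda>i. rho_sup p (\<lambda>t. ennreal \<bar>F n t - F (r i) t\<bar>))"
      by (rule rho_sup_liminf) measurable
    also have "\<dots> \<le> ennreal \<epsilon>"
    proof (rule Liminf_le)
      show "\<forall>\<^sub>F i in sequentially. rho_sup p (\<lambda>t. ennreal \<bar>F n t - F (r i) t\<bar>) \<le> ennreal \<epsilon>"
        using eventually_ge_at_top[of M]
      proof eventually_elim
        case (elim i)
        then have "M \<le> r i" using seq_suble[OF r(1), of i] by simp
        then have "rho p (s n - s (r i)) \<le> ennreal \<epsilon>"
          using M[of "r i"] rho_norm_le_iff[OF sd \<epsilon>] by simp
        moreover have "rho_sup p (\<lambda>t. ennreal \<bar>F n t - F (r i) t\<bar>) = rho p (s n - s (r i))"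
          unfolding rho_eq_rho_sup by (rule rho_sup_cong) (use Fd[of n "r i"] in \<open>eventually_elim, simp\<close>)
        ultimately show ?case by simp
      qed
    qed simp
    finally show ?thesis .
  qed
  \<comment> \<open>\<open>key\<close> speaks about differences, so membership of \<open>l\<close>
    is obtained from \<open>s M\<close> and \<open>s M - l\<close>.\<close>
  have lV: "l \<in> Ltilde p"
  proof -
    obtain M where M: "\<forall>m\<ge>M. \<forall>n\<ge>M. rho_norm p (s m - s n) < 1" using Cauchy zero_less_one by blast
    have "rho p (s M - l) \<le> ennreal 1" by (rule key[of 1 M]) (use M in \<open>auto intro: less_imp_le\<close>)
    then have "rho p (s M - l) < \<infinity>" by (rule le_less_trans) simp
    then have "s M - l \<in> Ltilde p" by (simp add: Ltilde_iff)
    from subspace_diff[OF subspace_Ltilde sV[of M] this] show ?thesis by simp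
  qed
  have "(\<lambda>n. rho_norm p (s n - l)) \<longlonglongrightarrow> 0"
  proof (rule LIMSEQ_I)
    fix e :: real assume e: "0 < e"
    then obtain M where M: "\<forall>m\<ge>M. \<forall>n\<ge>M. rho_norm p (s m - s n) < e / 2" using Cauchy half_gt_zero by blast
    have "norm (rho_norm p (s n - l) - 0) < e" if n: "M \<le> n" for n
    proof -
      have "rho p (s n - l) \<le> ennreal (e / 2)" by (rule key[of _ M]) (use M n e in \<open>auto intro: less_imp_le\<close>)
      then have "rho_norm p (s n - l) \<le> e / 2"
        using e by (subst rho_norm_le_iff[OF subspace_diff[OF subspace_Ltilde sV lV]]) auto
      then show ?thesis using e rho_norm_nonneg[of "s n - l"] by simp
    qed
    then show "\<exists>no. \<forall>n\<ge>no. norm (rho_norm p (s n - l) - 0) < e" by blast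
  qed
  with lV show "\<exists>l\<in>Ltilde p. (\<lambda>n. rho_norm p (s n - l)) \<longlonglongrightarrow> 0" by blast
qed

section \<open>Restriction to bounded exponents and the closure\<close>

definition cut :: "nat \<Rightarrow> L0 \<Rightarrow> L0" where
  "cut n f = abs_L0 (indicator {t. p t \<le> real n}) * f"

lemma rep_cut: "AE t in unit_leb. rep_L0 (cut n f) t = indicator {t. p t \<le> real n} t * rep_L0 f t"
  unfolding cut_def
proof (rule rep_L0_times_abs)
  note [measurable] = pm
  have "(\<lambda>t. if p t \<le> real n then 1 else 0 :: real) \<in> borel_measurable unit_leb" by measurable
  then show "(indicator {t. p t \<le> real n} :: real \<Rightarrow> real) \<in> borel_measurable unit_leb"
    by (simp add: indicator_def[abs_def])
qed


lemma cut_add: "cut n (f + g) = cut n f + cut n g"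
proof (rule L0_eqI)
  show "AE t in unit_leb. rep_L0 (cut n (f + g)) t = rep_L0 (cut n f + cut n g) t"
    using rep_cut[of n "f + g"] rep_cut[of n f] rep_cut[of n g] rep_L0_plus[of f g] rep_L0_plus[of "cut n f" "cut n g"]
    by eventually_elim (simp add: distrib_left)
qed

lemma cut_Ltilde: "f \<in> Ltilde p \<Longrightarrow> cut n f \<in> Ltilde p"
proof -
  assume f: "f \<in> Ltilde p"
  have "rho p (cut n f) \<le> rho p f"
    by (rule rho_solid) (use rep_cut[of n f] in \<open>eventually_elim, simp add: indicator_def\<close>)
  then show ?thesis using f unfolding Ltilde_iff by (rule le_less_trans)
qed

text \<open>Where \<open>p \<le> n\<close> the left function vanishes; elsewhere
  \<open>p > m\<close>, so \<open>cut m g\<close> vanishes and both functions are \<open>f\<close>.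
  Hence no function that vanishes on \<open>{p > n}\<close> approximates \<open>f\<close> better
  than \<open>cut n f\<close>.\<close>

lemma rho_tail_le:
  assumes "m \<le> n"
  shows "rho p (f - cut n f) \<le> rho p (f - cut m g)"
proof (rule rho_solid)
  show "AE t in unit_leb. \<bar>rep_L0 (f - cut n f) t\<bar> \<le> \<bar>rep_L0 (f - cut m g) t\<bar>"
    using rep_L0_minus[of f "cut n f"] rep_L0_minus[of f "cut m g"] rep_cut[of n f] rep_cut[of m g]
    by eventually_elim (use assms in \<open>auto simp: indicator_def\<close>)
qed

text \<open>By \<open>rho_tail_le\<close> the best approximations of \<open>f\<close> are its own
  cuts, so the topological closure turns into a condition on tails.\<close>

lemma Lzero_iff: "f \<in> Lzero p \<longleftrightarrow> f \<in> Ltilde p \<and> (\<forall>\<epsilon>>0. \<exists>n. rho p (f - cut n f) < ennreal \<epsilon>)"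
proof -
  define S where "S = (\<Union>n::nat. {abs_L0 (indicator {t. p t \<le> real n}) * f |f. f \<in> Ltilde p})"
  have S: "y \<in> S \<longleftrightarrow> (\<exists>n g. g \<in> Ltilde p \<and> y = cut n g)" for y by (auto simp: S_def cut_def)
  interpret Metric_space "Ltilde p" "\<lambda>f g. rho_norm p (f - g)" by (rule Metric_space_Ltilde)
  have lt: "rho_norm p h < \<epsilon> \<longleftrightarrow> rho p h < ennreal \<epsilon>" if "h \<in> Ltilde p" "0 < \<epsilon>" for h \<epsilon>
    using rho_norm_eq[OF that(1)] that(2) rho_norm_nonneg[of h] by (metis ennreal_less_iff)
  have "Lzero p = mtopology closure_of S" by (simp add: Lzero_def S_def)
  then have "f \<in> Lzero p \<longleftrightarrow> f \<in> Ltilde p \<and> (\<forall>\<epsilon>>0. \<exists>y\<in>S. y \<in> mball f \<epsilon>)"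
    by (simp add: metric_closure_of)
  also have "\<dots> \<longleftrightarrow> f \<in> Ltilde p \<and> (\<forall>\<epsilon>>0. \<exists>n. rho p (f - cut n f) < ennreal \<epsilon>)"
  proof (intro conj_cong refl all_cong1 imp_cong iffI)
    fix \<epsilon> :: real assume f: "f \<in> Ltilde p" and \<epsilon>: "0 < \<epsilon>"
    {
      assume "\<exists>y\<in>S. y \<in> mball f \<epsilon>"
      then obtain n g where g: "g \<in> Ltilde p" "rho_norm p (f - cut n g) < \<epsilon>" by (auto simp: S)
      then have "rho p (f - cut n g) < ennreal \<epsilon>"
        using lt[OF subspace_diff[OF subspace_Ltilde f cut_Ltilde] \<epsilon>] by blast
      then show "\<exists>n. rho p (f - cut n f) < ennreal \<epsilon>" using rho_tail_le[of n n f g] by (auto intro: le_less_trans)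
    }
    assume "\<exists>n. rho p (f - cut n f) < ennreal \<epsilon>"
    then obtain n where "rho_norm p (f - cut n f) < \<epsilon>"
      using lt[OF subspace_diff[OF subspace_Ltilde f cut_Ltilde[OF f]] \<epsilon>] by blast
    then show "\<exists>y\<in>S. y \<in> mball f \<epsilon>"
      using f cut_Ltilde[OF f, of n] by (intro bexI[of _ "cut n f"]) (auto simp: S)
  qed
  finally show ?thesis .
qed

lemma subspace_Lzero: "subspace (Lzero p)"
proof (rule subspaceI)
  have "cut 0 0 = 0"
    by (rule L0_eqI) (use rep_cut[of 0 0] rep_L0_zero in \<open>eventually_elim, simp\<close>)
  then have "rho p (0 - cut 0 0) = 0" using rho_zero_iff[of 0] by simp
  then show "0 \<in> Lzero p"
    using subspace_0[OF subspace_Ltilde] by (auto simp: Lzero_iff intro!: exI[of _ 0])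
next
  fix f g assume fg: "f \<in> Lzero p" "g \<in> Lzero p"
  show "f + g \<in> Lzero p" unfolding Lzero_iff
  proof (intro conjI allI impI)
    show "f + g \<in> Ltilde p" using fg by (auto simp: Lzero_iff intro: subspace_add[OF subspace_Ltilde])
    fix \<epsilon> :: real assume \<epsilon>: "0 < \<epsilon>"
    obtain m where m: "rho p (f - cut m f) < ennreal (\<epsilon> / 2)"
      using fg(1) \<epsilon> half_gt_zero[OF \<epsilon>] unfolding Lzero_iff by blast
    obtain n where n: "rho p (g - cut n g) < ennreal (\<epsilon> / 2)"
      using fg(2) \<epsilon> half_gt_zero[OF \<epsilon>] unfolding Lzero_iff by blast
    define k where "k = max m n"
    have "f + g - cut k (f + g) = (f - cut k f) + (g - cut k g)"
      by (simp add: cut_add)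
    then have "rho p (f + g - cut k (f + g)) \<le> rho p (f - cut k f) + rho p (g - cut k g)"
      using rho_triangle by metis
    also have "\<dots> \<le> rho p (f - cut m f) + rho p (g - cut n g)"
      by (intro add_mono rho_tail_le) (auto simp: k_def)
    also have "\<dots> < ennreal (\<epsilon> / 2) + ennreal (\<epsilon> / 2)" using m n by (rule add_strict_mono)
    also have "\<dots> = ennreal \<epsilon>" using \<epsilon> by (simp flip: ennreal_plus)
    finally show "\<exists>n. rho p (f + g - cut n (f + g)) < ennreal \<epsilon>" by blast
  qed
next
  fix c :: real and f assume f: "f \<in> Lzero p"
  show "c *\<^sub>R f \<in> Lzero p" unfolding Lzero_iff
  proof (intro conjI allI impI)
    show "c *\<^sub>R f \<in> Ltilde p" using f by (auto simp: Lzero_iff intro: subspace_scale[OF subspace_Ltilde])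
    fix \<epsilon> :: real assume \<epsilon>: "0 < \<epsilon>"
    \<comment> \<open>\<open>\<bar>c\<bar> + 1\<close> instead of \<open>\<bar>c\<bar>\<close>
      avoids a separate case \<open>c = 0\<close>.\<close>
    have "0 < \<epsilon> / (\<bar>c\<bar> + 1)" using \<epsilon> by simp
    then obtain n where n: "rho p (f - cut n f) < ennreal (\<epsilon> / (\<bar>c\<bar> + 1))"
      using f unfolding Lzero_iff by blast
    have "rho p (c *\<^sub>R f - cut n (c *\<^sub>R f)) \<le> rho p ((\<bar>c\<bar> + 1) *\<^sub>R (f - cut n f))"
    proof (rule rho_solid)
      show "AE t in unit_leb. \<bar>rep_L0 (c *\<^sub>R f - cut n (c *\<^sub>R f)) t\<bar> \<le> \<bar>rep_L0 ((\<bar>c\<bar> + 1) *\<^sub>R (f - cut n f)) t\<bar>"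
        using rep_L0_minus[of "c *\<^sub>R f" "cut n (c *\<^sub>R f)"] rep_L0_scale[of c f] rep_cut[of n "c *\<^sub>R f"]
          rep_L0_scale[of "\<bar>c\<bar> + 1" "f - cut n f"] rep_L0_minus[of f "cut n f"] rep_cut[of n f]
        by eventually_elim (auto simp: indicator_def abs_mult intro!: mult_right_mono)
    qed
    also have "\<dots> = ennreal (\<bar>c\<bar> + 1) * rho p (f - cut n f)" by (simp add: rho_scale)
    also have "\<dots> < ennreal (\<bar>c\<bar> + 1) * ennreal (\<epsilon> / (\<bar>c\<bar> + 1))"
      by (rule ennreal_mult_strict_left_mono[OF n]) (auto simp: ennreal_zero_less_one add_pos_nonneg simp flip: ennreal_1 ennreal_plus)
    also have "\<dots> = ennreal ((\<bar>c\<bar> + 1) * (\<epsilon> / (\<bar>c\<bar> + 1)))"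
      by (rule ennreal_mult[symmetric]) (use \<epsilon> in auto)
    also have "(\<bar>c\<bar> + 1) * (\<epsilon> / (\<bar>c\<bar> + 1)) = \<epsilon>"
      by (rule nonzero_mult_div_cancel_left[of "\<bar>c\<bar> + 1" \<epsilon>, simplified times_divide_eq_right[symmetric]]) linarith
    finally show "\<exists>n. rho p (c *\<^sub>R f - cut n (c *\<^sub>R f)) < ennreal \<epsilon>" by blast
  qed
qed

lemma banach_space_on_Lzero: "banach_space_on (Lzero p) (rho_norm p)"
proof (rule banach_space_on_closed_subspace[OF banach_space_on_Ltilde subspace_Lzero])
  show "Lzero p \<subseteq> Ltilde p" by (auto simp: Lzero_iff)
  fix l s assume l: "l \<in> Ltilde p" and s: "range s \<subseteq> Lzero p" and lim: "(\<lambda>n. rho_norm p (s n - l)) \<longlonglongrightarrow> 0"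
  show "l \<in> Lzero p" unfolding Lzero_iff
  proof (intro conjI allI impI l)
    fix \<epsilon> :: real assume \<epsilon>: "0 < \<epsilon>"
    have "\<forall>\<^sub>F k in sequentially. rho_norm p (s k - l) < \<epsilon> / 2"
      by (rule order_tendstoD(2)[OF lim half_gt_zero[OF \<epsilon>]])
    then obtain k where k: "rho_norm p (s k - l) < \<epsilon> / 2" by (auto simp: eventually_sequentially)
    have sk: "s k \<in> Lzero p" using s by auto
    then have "s k - l \<in> Ltilde p" using l by (auto simp: Lzero_iff intro: subspace_diff[OF subspace_Ltilde])
    then have k': "rho p (s k - l) < ennreal (\<epsilon> / 2)"
      using k rho_norm_eq rho_norm_nonneg[of "s k - l"] by (metis ennreal_less_iff)
    obtain n where n: "rho p (s k - cut n (s k)) < ennreal (\<epsilon> / 2)"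
      using sk half_gt_zero[OF \<epsilon>] unfolding Lzero_iff by blast
    \<comment> \<open>By \<open>rho_tail_le\<close> the cut of \<open>s k\<close> may stand in for
      that of \<open>l\<close>.\<close>
    have "rho p (l - cut n l) \<le> rho p ((l - s k) + (s k - cut n (s k)))"
      using rho_tail_le[of n n l "s k"] by simp
    also have "\<dots> \<le> rho p (l - s k) + rho p (s k - cut n (s k))" by (rule rho_triangle)
    also have "\<dots> < ennreal (\<epsilon> / 2) + ennreal (\<epsilon> / 2)"
      using k' n by (simp add: rho_minus_commute[of l] add_strict_mono)
    also have "\<dots> = ennreal \<epsilon>" using \<epsilon> by (simp flip: ennreal_plus)
    finally show "\<exists>n. rho p (l - cut n l) < ennreal \<epsilon>" by blast
  qed
qed

text \<open>\<open>f - cut n f\<close> is the part of \<open>f\<close> on \<open>{n < p}\<close>, so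
  \<open>Lzero_iff\<close> supplies exactly the smallness of tails.\<close>

lemma Lzero_subset_ode_class: "Lzero p \<subseteq> ode_class p"
proof
  fix f assume f: "f \<in> Lzero p"
  then have fL: "f \<in> Ltilde p" by (simp add: Lzero_iff)
  show "f \<in> ode_class p" unfolding ode_class_def
  proof (intro CollectI allI impI)
    fix x :: real assume x: "0 < x"
    have "\<exists>\<phi>. solves_ode p (rep_L0 f) x \<phi>"
    proof (rule solves_ode_if_tail_small[OF pm p1 rep_L0_measurable x])
      show "rho_sup p (\<lambda>t. ennreal \<bar>rep_L0 f t\<bar>) \<le> ennreal (rho_norm p f)"
        using rho_norm_eq[OF fL] by (simp add: rho_eq_rho_sup)
      show "0 \<le> rho_norm p f" by (rule rho_norm_nonneg)
      fix \<epsilon> :: real assume "0 < \<epsilon>"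
      then obtain n where n: "rho p (f - cut n f) < ennreal \<epsilon>" using f by (auto simp: Lzero_iff)
      have "rho_sup p (\<lambda>t. ennreal \<bar>rep_L0 f t * indicator {t. real n < p t} t\<bar>) = rho p (f - cut n f)"
        unfolding rho_eq_rho_sup
      proof (rule rho_sup_cong)
        show "AE t in unit_leb. ennreal \<bar>rep_L0 f t * indicator {t. real n < p t} t\<bar> = ennreal \<bar>rep_L0 (f - cut n f) t\<bar>"
          using rep_L0_minus[of f "cut n f"] rep_cut[of n f]
          by eventually_elim (auto simp: indicator_def)
      qed
      then show "\<exists>n. rho_sup p (\<lambda>t. ennreal \<bar>rep_L0 f t * indicator {t. real n < p t} t\<bar>) \<le> ennreal \<epsilon>"
        using n by (metis less_imp_le)
    qed
    then show "\<exists>\<phi>. ode_solution p f x \<phi>"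
      using solves_ode_imp_ode_solution[OF pm p1 rep_L0_measurable x, of f] by (auto simp: abs_rep_L0)
  qed
qed

section \<open>From solutions to the limit superior norm\<close>

lemma rho_le_ode_solution:
  assumes "ode_solution p f x \<phi>" "0 < x"
  shows "rho p f \<le> ennreal (\<phi> 1)"
  unfolding rho_eq_rho_sup
  by (rule rho_sup_le_ode[OF pm p1 ode_solution_imp_solves_ode[OF pm p1 assms(2,1)] assms(2) rep_L0_measurable])

lemma ode_class_subset_Ltilde: "ode_class p \<subseteq> Ltilde p"
proof
  fix f assume "f \<in> ode_class p"
  then have "\<exists>\<phi>. ode_solution p f 1 \<phi>" unfolding ode_class_def mem_Collect_eq using zero_less_one by blast
  then obtain \<phi> where "ode_solution p f 1 \<phi>" by blast
  then have "rho p f \<le> ennreal (\<phi> 1)" by (rule rho_le_ode_solution) simp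
  then show "f \<in> Ltilde p" unfolding Ltilde_iff by (rule le_less_trans) simp
qed

text \<open>Monotonicity in both directions gives uniqueness, so the definite description in
  \<open>ode_flow\<close> denotes the given solution.\<close>

lemma ode_flow_eq:
  assumes \<phi>: "ode_solution p f x \<phi>" and x: "0 < x" and T: "T \<in> {0..1}"
  shows "ode_flow p f x T = \<phi> T"
  unfolding ode_flow_def
proof (rule the_equality)
  show "\<exists>\<psi>. ode_solution p f x \<psi> \<and> \<phi> T = \<psi> T" using \<phi> by blast
  fix y assume "\<exists>\<psi>. ode_solution p f x \<psi> \<and> y = \<psi> T"
  then obtain \<psi> where \<psi>: "ode_solution p f x \<psi>" "y = \<psi> T" by blast
  note s = ode_solution_imp_solves_ode[OF pm p1 x \<phi>] ode_solution_imp_solves_ode[OF pm p1 x \<psi>(1)]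
  have "\<psi> T \<le> \<phi> T" by (rule solves_ode_mono[OF s pm p1 _ x order_refl T]) auto
  moreover have "\<phi> T \<le> \<psi> T" by (rule solves_ode_mono[OF s(2,1) pm p1 _ x order_refl T]) auto
  ultimately show "y = \<phi> T" using \<psi>(2) by simp
qed

section \<open>Essentially bounded exponents\<close>

context
  fixes n :: real
  assumes bounded: "AE t in unit_leb. p t \<le> n"
begin

lemma ode_solution_bounded:
  assumes f: "f \<in> Ltilde p" and x: "0 < x"
  obtains \<phi> where "ode_solution p f x \<phi>" "\<phi> 1 \<le> x + rho_norm p f"
proof -
  note [measurable] = pm rep_L0_measurable
  \<comment> \<open>The bound on \<open>p\<close> holds only almost everywhere; another
    representative of \<open>f\<close> makes it hold wherever the function is nonzero.\<close>
  define g where "g = (\<lambda>t. if p t \<le> n then rep_L0 f t else 0)"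
  have gm: "g \<in> borel_measurable unit_leb" unfolding g_def by measurable
  have gf: "AE t in unit_leb. g t = rep_L0 f t" using bounded by eventually_elim (simp add: g_def)
  have fg: "f = abs_L0 g"
    by (rule L0_eqI) (use gf rep_abs_L0[OF gm] in \<open>eventually_elim, simp\<close>)
  have "rho_sup p (\<lambda>t. ennreal \<bar>g t\<bar>) = rho p f"
    unfolding rho_eq_rho_sup by (rule rho_sup_cong) (use gf in \<open>eventually_elim, simp\<close>)
  then have "rho_sup p (\<lambda>t. ennreal \<bar>g t\<bar>) \<le> ennreal (rho_norm p f)" using rho_norm_eq[OF f] by simp
  moreover have "p t \<le> n" if "g t \<noteq> 0" for t using that by (simp add: g_def split: if_splits)
  ultimately obtain \<phi> where "solves_ode p g x \<phi>" "\<phi> 1 \<le> x + rho_norm p f"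
    using solves_ode_if_bounded_exponent[OF pm p1 gm _ _ rho_norm_nonneg x] by metis
  then show ?thesis using that solves_ode_imp_ode_solution[OF pm p1 gm x] fg by metis
qed

lemma ode_class_eq_Ltilde: "ode_class p = Ltilde p"
proof
  show "ode_class p \<subseteq> Ltilde p" by (rule ode_class_subset_Ltilde)
  show "Ltilde p \<subseteq> ode_class p"
    unfolding ode_class_def using ode_solution_bounded by blast
qed

text \<open>A squeeze as \<open>x\<close> decreases to 0: \<open>ode_flow p f x 1\<close> lies
  between \<open>rho_norm p f\<close>, which every solution dominates, and
  \<open>x + rho_norm p f\<close>, from the construction of a solution.\<close>

lemma ode_norm_eq_rho_norm:
  assumes f: "f \<in> Ltilde p"
  shows "ode_norm p f = rho_norm p f"
proof -
  have flow: "rho_norm p f \<le> ode_flow p f x 1 \<and> ode_flow p f x 1 \<le> x + rho_norm p f" if x: "0 < x" for x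
  proof -
    obtain \<phi> where \<phi>: "ode_solution p f x \<phi>" "\<phi> 1 \<le> x + rho_norm p f" using ode_solution_bounded[OF f x] .
    have "0 < \<phi> 1" using solves_ode_pos[OF ode_solution_imp_solves_ode[OF pm p1 x \<phi>(1)] x, of 1] by simp
    then have "rho_norm p f \<le> \<phi> 1"
      using rho_le_ode_solution[OF \<phi>(1) x] f by (simp add: rho_norm_le_iff)
    then show ?thesis using \<phi>(2) ode_flow_eq[OF \<phi>(1) x, of 1] by simp
  qed
  have "((\<lambda>x. ode_flow p f x 1) \<longlongrightarrow> rho_norm p f) (at_right 0)"
  proof (rule tendsto_sandwich)
    show "\<forall>\<^sub>F x in at_right 0. rho_norm p f \<le> ode_flow p f x 1"
      using eventually_at_right_less[of 0] by eventually_elim (use flow in blast)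
    show "\<forall>\<^sub>F x in at_right 0. ode_flow p f x 1 \<le> x + rho_norm p f"
      using eventually_at_right_less[of 0] by eventually_elim (use flow in blast)
    have "((\<lambda>x::real. x + rho_norm p f) \<longlongrightarrow> 0 + rho_norm p f) (at_right 0)"
      by (intro tendsto_add tendsto_const tendsto_ident_at)
    then show "((\<lambda>x::real. x + rho_norm p f) \<longlongrightarrow> rho_norm p f) (at_right 0)" by simp
  qed simp
  then show ?thesis unfolding ode_norm_def ode_flow0_def by (intro tendsto_Lim) auto
qed

end

end

theorem theorem3p7:
  fixes p :: "real \<Rightarrow> real"
  assumes "p \<in> borel_measurable unit_leb"
    and "\<forall>t\<in>{0..1}. 1 \<le> p t"
  shows "banach_space_on (Lzero p) (rho_norm p)
    \<and> Lzero p \<subseteq> ode_class p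
    \<and> (esssup unit_leb (\<lambda>t. ereal (p t)) < \<infinity> \<longrightarrow>
         ode_class p = Ltilde p
         \<and> (\<forall>f\<in>ode_class p. ode_norm p f = rho_norm p f)
         \<and> banach_space_on (ode_class p) (ode_norm p))"
proof (intro conjI impI)
  note pm = assms(1) and p1 = assms(2)[rule_format]
  show "banach_space_on (Lzero p) (rho_norm p)" by (rule banach_space_on_Lzero[OF pm p1])
  show "Lzero p \<subseteq> ode_class p" by (rule Lzero_subset_ode_class[OF pm p1])
  assume "esssup unit_leb (\<lambda>t. ereal (p t)) < \<infinity>"
  then obtain n :: real where n: "esssup unit_leb (\<lambda>t. ereal (p t)) \<le> ereal n"
    by (metis ereal_dense2 less_imp_le)
  have bounded: "AE t in unit_leb. p t \<le> n"
    using esssup_AE[of "\<lambda>t. ereal (p t)" unit_leb]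
  proof eventually_elim
    case (elim t)
    then have "ereal (p t) \<le> ereal n" using n by (rule order_trans)
    then show ?case by simp
  qed
  show eq: "ode_class p = Ltilde p" by (rule ode_class_eq_Ltilde[OF pm p1 bounded])
  show norm: "\<forall>f\<in>ode_class p. ode_norm p f = rho_norm p f"
    unfolding eq using ode_norm_eq_rho_norm[OF pm p1 bounded] by blast
  \<comment> \<open>Equality of the two norms transfers the structure from
    \<open>rho_norm p\<close>.\<close>
  show "banach_space_on (ode_class p) (ode_norm p)"
    using banach_space_on_cong[OF banach_space_on_Ltilde[OF pm p1]] norm unfolding eq by blast
qed

end
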